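(* Every finitely generated Artin--Tits monoid admits a finite Garside family.
   Context: **Artin--Tits monoids.** Let $S$ be a set and let $(m_{s,t})_{s,t\in S}$ be a Coxeter matrix on $S$, that is, $m_{s,s}=1$ and $m_{s,t}=m_{t,s}\in\{2,3,\dots\}\cup\{\infty\}$ for $s\neq t$. The associated Artin--Tits monoid is the monoid $M$ presented by the generating set $S$ and, for each pair $s\ne t$ in $S$ with $m_{s,t}<\infty$, the relation $sts\cdots = tst\cdots$, where both sides are alternating words of length $m_{s,t}$ (there is no relation for the pair when $m_{s,t}=\infty$). It is finitely generated exactly when $S$ is finite. Such a monoid is left-cancellative and has no nontrivial invertible element. **Left-divisibility.** For $f,g$ in a monoid $M$, write $f\preccurlyeq g$ ($f$ left-divides $g$) if $fg'=g$ for some $g'\in M$. **Garside families.** Let $M$ be a left-cancellative monoid with no nontrivial invertible element. A Garside family of $M$ is a subset $F\subseteq M$ containing $1$ and such that every $g\in M$ admits an $F$-normal decomposition, that is, a finite sequence $(s_1,\dots,s_p)$ with $s_1\cdots s_p=g$, all entries $s_i$ in $F$, and such that for every $i<p$: $$\forall s\in F\ \forall f\in M\ \bigl(s\preccurlyeq f s_i s_{i+1}\Rightarrow s\preccurlyeq f s_i\bigr).$$ *)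

theory Defs
  imports "HOL-Algebra.Divisibility" "HOL-Library.Extended_Nat"
begin

section \<open>Presented monoids\<close>

text \<open>The least congruence on the free monoid \<^term>\<open>lists S\<close> containing the relations \<open>R\<close>.
  It is meaningful for \<open>R \<subseteq> lists S \<times> lists S\<close>.\<close>

inductive_set presentation_congruence :: "'a set \<Rightarrow> ('a list \<times> 'a list) set \<Rightarrow> ('a list \<times> 'a list) set"
  for S :: "'a set" and R :: "('a list \<times> 'a list) set" where
  refl: "w \<in> lists S \<Longrightarrow> (w, w) \<in> presentation_congruence S R"
| sym: "(v, w) \<in> presentation_congruence S R \<Longrightarrow> (w, v) \<in> presentation_congruence S R"
| trans: "(u, v) \<in> presentation_congruence S R \<Longrightarrow> (v, w) \<in> presentation_congruence S R
    \<Longrightarrow> (u, w) \<in> presentation_congruence S R"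
| rel: "(v, w) \<in> R \<Longrightarrow> x \<in> lists S \<Longrightarrow> y \<in> lists S
    \<Longrightarrow> (x @ v @ y, x @ w @ y) \<in> presentation_congruence S R"

definition presented_monoid :: "'a set \<Rightarrow> ('a list \<times> 'a list) set \<Rightarrow> 'a list set monoid" where
  "presented_monoid S R =
    \<lparr>carrier = lists S // presentation_congruence S R,
     mult = (\<lambda>X Y. \<Union>x\<in>X. \<Union>y\<in>Y. presentation_congruence S R `` {x @ y}),
     one = presentation_congruence S R `` {[]}\<rparr>"

lemma presentation_congruence_lists:
  assumes R: "R \<subseteq> lists S \<times> lists S"
    and "(v, w) \<in> presentation_congruence S R"
  shows "v \<in> lists S \<and> w \<in> lists S"
  using assms(2)
proof induction
  case (rel v w x y)
  then have "v \<in> lists S" "w \<in> lists S" using R by auto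
  with rel show ?case by simp
qed auto

lemma equiv_presentation_congruence:
  assumes R: "R \<subseteq> lists S \<times> lists S"
  shows "equiv (lists S) (presentation_congruence S R)"
proof (rule equivI)
  show "presentation_congruence S R \<subseteq> lists S \<times> lists S"
    using presentation_congruence_lists[OF R] by auto
  show "refl_on (lists S) (presentation_congruence S R)"
    by (auto intro!: refl_onI presentation_congruence.refl)
  show "sym (presentation_congruence S R)"
    by (auto intro: symI presentation_congruence.sym)
  show "trans (presentation_congruence S R)"
    by (auto intro: transI presentation_congruence.trans)
qed

lemma presentation_congruence_context:
  assumes "(v, w) \<in> presentation_congruence S R" "x \<in> lists S" "y \<in> lists S"
  shows "(x @ v @ y, x @ w @ y) \<in> presentation_congruence S R"
  using assms
proof induction
  case (refl w)
  then show ?case by (intro presentation_congruence.refl) auto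
next
  case (rel v w x' y')
  then show ?case
    using presentation_congruence.rel[of v w R "x @ x'" S "y' @ y"] by simp
qed (auto intro: presentation_congruence.sym presentation_congruence.trans)

lemma presentation_congruence_append:
  assumes R: "R \<subseteq> lists S \<times> lists S"
    and v: "(v, v') \<in> presentation_congruence S R" and w: "(w, w') \<in> presentation_congruence S R"
  shows "(v @ w, v' @ w') \<in> presentation_congruence S R"
proof -
  have "(v @ w, v' @ w) \<in> presentation_congruence S R"
    using presentation_congruence_context[OF v, of "[]" w] presentation_congruence_lists[OF R w]
    by simp
  moreover have "(v' @ w, v' @ w') \<in> presentation_congruence S R"
    using presentation_congruence_context[OF w, of v' "[]"] presentation_congruence_lists[OF R v]
    by simp
  ultimately show ?thesis by (rule presentation_congruence.trans)
qed

lemma presented_monoid_mult: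
  assumes R: "R \<subseteq> lists S \<times> lists S" and "v \<in> lists S" "w \<in> lists S"
  shows "presentation_congruence S R `` {v} \<otimes>\<^bsub>presented_monoid S R\<^esub> presentation_congruence S R `` {w}
    = presentation_congruence S R `` {v @ w}"
proof -
  note E = equiv_presentation_congruence[OF R]
  have "congruent2 (presentation_congruence S R) (presentation_congruence S R)
      (\<lambda>x y. presentation_congruence S R `` {x @ y})"
    by (intro congruent2I' equiv_class_eq[OF E] presentation_congruence_append[OF R])
  from UN_equiv_class2[OF E E this assms(2,3)] show ?thesis
    by (simp add: presented_monoid_def)
qed

lemma monoid_presented_monoid:
  assumes R: "R \<subseteq> lists S \<times> lists S"
  shows "monoid (presented_monoid S R)"
proof -
  have car: "carrier (presented_monoid S R)
      = (\<lambda>w. presentation_congruence S R `` {w}) ` lists S"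
    by (auto simp: presented_monoid_def quotient_def)
  have one: "\<one>\<^bsub>presented_monoid S R\<^esub> = presentation_congruence S R `` {[]}"
    by (simp add: presented_monoid_def)
  show ?thesis
  proof (rule monoidI)
    fix X Y
    assume "X \<in> carrier (presented_monoid S R)" "Y \<in> carrier (presented_monoid S R)"
    then obtain v w where "v \<in> lists S" "w \<in> lists S"
      and "X = presentation_congruence S R `` {v}" "Y = presentation_congruence S R `` {w}"
      unfolding car by blast
    then show "X \<otimes>\<^bsub>presented_monoid S R\<^esub> Y \<in> carrier (presented_monoid S R)"
      unfolding car by (auto simp: presented_monoid_mult[OF R] simp del: in_lists_conv_set intro!: imageI)
  next
    fix X Y Z
    assume "X \<in> carrier (presented_monoid S R)" "Y \<in> carrier (presented_monoid S R)"
      "Z \<in> carrier (presented_monoid S R)"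
    then obtain u v w where "u \<in> lists S" "v \<in> lists S" "w \<in> lists S"
      and "X = presentation_congruence S R `` {u}" "Y = presentation_congruence S R `` {v}"
        "Z = presentation_congruence S R `` {w}"
      unfolding car by blast
    then show "X \<otimes>\<^bsub>presented_monoid S R\<^esub> Y \<otimes>\<^bsub>presented_monoid S R\<^esub> Z
        = X \<otimes>\<^bsub>presented_monoid S R\<^esub> (Y \<otimes>\<^bsub>presented_monoid S R\<^esub> Z)"
      by (simp add: presented_monoid_mult[OF R] del: in_lists_conv_set)
  next
    show "\<one>\<^bsub>presented_monoid S R\<^esub> \<in> carrier (presented_monoid S R)"
      unfolding car one by blast
  next
    fix X
    assume "X \<in> carrier (presented_monoid S R)"
    then obtain w where "w \<in> lists S" "X = presentation_congruence S R `` {w}"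
      unfolding car by blast
    then show "\<one>\<^bsub>presented_monoid S R\<^esub> \<otimes>\<^bsub>presented_monoid S R\<^esub> X = X"
      and "X \<otimes>\<^bsub>presented_monoid S R\<^esub> \<one>\<^bsub>presented_monoid S R\<^esub> = X"
      using presented_monoid_mult[OF R lists.Nil, of w] presented_monoid_mult[OF R _ lists.Nil, of w]
      by (simp_all add: one)
  qed
qed

section \<open>Artin--Tits monoids\<close>

definition coxeter_matrix :: "'a set \<Rightarrow> ('a \<Rightarrow> 'a \<Rightarrow> enat) \<Rightarrow> bool" where
  "coxeter_matrix S m \<longleftrightarrow>
    (\<forall>s\<in>S. m s s = 1) \<and>
    (\<forall>s\<in>S. \<forall>t\<in>S. s \<noteq> t \<longrightarrow> m s t = m t s \<and> 2 \<le> m s t)"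

fun alternating_word :: "nat \<Rightarrow> 'a \<Rightarrow> 'a \<Rightarrow> 'a list" where
  "alternating_word 0 s t = []"
| "alternating_word (Suc n) s t = s # alternating_word n t s"

definition braid_relations :: "'a set \<Rightarrow> ('a \<Rightarrow> 'a \<Rightarrow> enat) \<Rightarrow> ('a list \<times> 'a list) set" where
  "braid_relations S m =
    {(alternating_word n s t, alternating_word n t s) | n s t.
      s \<in> S \<and> t \<in> S \<and> s \<noteq> t \<and> m s t = enat n}"

definition artin_tits_monoid :: "'a set \<Rightarrow> ('a \<Rightarrow> 'a \<Rightarrow> enat) \<Rightarrow> 'a list set monoid" where
  "artin_tits_monoid S m = presented_monoid S (braid_relations S m)"

lemma braid_relations_lists: "braid_relations S m \<subseteq> lists S \<times> lists S"
proof -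
  have "alternating_word n s t \<in> lists S" if "s \<in> S" "t \<in> S" for n s t
    using that by (induction n s t rule: alternating_word.induct) auto
  then show ?thesis by (auto simp: braid_relations_def)
qed

lemma monoid_artin_tits_monoid: "monoid (artin_tits_monoid S m)"
  unfolding artin_tits_monoid_def by (rule monoid_presented_monoid[OF braid_relations_lists])

section \<open>Finite generation and Garside families\<close>

definition list_prod :: "('a, 'b) monoid_scheme \<Rightarrow> 'a list \<Rightarrow> 'a" where
  "list_prod M xs = foldr (\<otimes>\<^bsub>M\<^esub>) xs \<one>\<^bsub>M\<^esub>"

definition finitely_generated_monoid :: "('a, 'b) monoid_scheme \<Rightarrow> bool" where
  "finitely_generated_monoid M \<longleftrightarrow>
    (\<exists>A. finite A \<and> A \<subseteq> carrier M \<and> (\<forall>g\<in>carrier M. \<exists>xs. set xs \<subseteq> A \<and> list_prod M xs = g))"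

definition normal_sequence :: "('a, 'b) monoid_scheme \<Rightarrow> 'a set \<Rightarrow> 'a list \<Rightarrow> bool" where
  "normal_sequence M F ss \<longleftrightarrow>
    set ss \<subseteq> F \<and>
    (\<forall>i. Suc i < length ss \<longrightarrow>
      (\<forall>s\<in>F. \<forall>f\<in>carrier M.
        s divides\<^bsub>M\<^esub> (f \<otimes>\<^bsub>M\<^esub> ss ! i \<otimes>\<^bsub>M\<^esub> ss ! Suc i) \<longrightarrow> s divides\<^bsub>M\<^esub> (f \<otimes>\<^bsub>M\<^esub> ss ! i)))"

text \<open>This is the notion of Garside family for a left-cancellative monoid without nontrivial
  invertible elements, a class that contains all Artin--Tits monoids; these two properties of
  \<open>M\<close> are not part of the definition. \<^const>\<open>factor\<close> (written \<open>divides\<close>) is left-divisibility,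
  also when \<open>M\<close> is not commutative.\<close>

definition garside_family :: "('a, 'b) monoid_scheme \<Rightarrow> 'a set \<Rightarrow> bool" where
  "garside_family M F \<longleftrightarrow>
    F \<subseteq> carrier M \<and> \<one>\<^bsub>M\<^esub> \<in> F \<and>
    (\<forall>g\<in>carrier M. \<exists>ss. normal_sequence M F ss \<and> list_prod M ss = g)"

end

theory Submission
  imports Defs Complex_Main
begin

text \<open>Let \<open>W\<close> be the Coxeter group of the monoid \<open>M\<close>, acting on its root system, and let \<open>\<N>(g)\<close> be the set of
  positive roots made negative by \<open>g\<inverse>\<close>. The cone type of \<open>x\<close> is the set of all \<open>v\<close> with
  \<open>\<N>(v) \<inter> \<N>(x) = \<emptyset>\<close>, and a gate is an element that is minimal, for the weak order, among the elements of
  its cone type. There are only finitely many cone types, because the cone type of \<open>x\<close> depends only on the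
  small roots in \<open>\<N>(x)\<close>, and there are finitely many small roots (Brink--Howlett); distinct
  gates have distinct cone types, so there are finitely many gates. The gates include the generators and are
  closed under suffixes and under the joins that exist in the weak order (Parkinson--Yau, Przytycki--Yau).
  Reduced words embed \<open>W\<close> into \<open>M\<close>, and every element \<open>g\<close> of \<open>M\<close> has a greatest left divisor in \<open>W\<close>, its
  head. Splitting off repeatedly the greatest gate below the head gives a decomposition of \<open>g\<close>, which is
  normal by the two closure properties.\<close>

section \<open>The geometric representation\<close>

text \<open>When \<open>W\<close> is finite, all of it would serve; the difficulty is to stay finite
  in an infinite \<open>W\<close> while keeping closure under suffixes and existing joins. Normality
  asks for just these two: a gate dividing a product with left factor \<open>f\<close> is pushed
  through \<open>f\<close> letter by letter, each time joined with the letter and then freed of it.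
  Closure under joins is the harder one. It rests on a rank-two fact: in a coset of a finite
  dihedral subgroup, if the last step to the top along one side does not change the cone type, then
  along the other side no step before the last changes it. Walking down that other side keeps a gate
  below every element met. For small roots the obstacle is that the form may take infinitely many
  values on pairs of roots. Those strictly between -1 and 1 are finite in number: such a pair spans
  a definite plane, which \<open>W\<close> moves into one of finitely many finite root subsystems. A
  chain of small roots climbing from a simple root then passes through finitely many states and
  repeats none.\<close>

type_synonym 'a vec = "'a \<Rightarrow> real"

definition lin_comb :: "real \<Rightarrow> 'a vec \<Rightarrow> real \<Rightarrow> 'a vec \<Rightarrow> 'a vec" where
  "lin_comb a v b w = (\<lambda>x. a * v x + b * w x)"

definition linear_map :: "('a vec \<Rightarrow> 'a vec) \<Rightarrow> bool" where
  "linear_map f \<longleftrightarrow> (\<forall>a v b w. f (lin_comb a v b w) = lin_comb a (f v) b (f w))"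

definition simple_root :: "'a \<Rightarrow> 'a \<Rightarrow> real" (\<open>\<alpha>\<close>) where
  "\<alpha> s = (\<lambda>x. if x = s then 1 else 0)"

definition nonneg :: "'a vec \<Rightarrow> bool" where
  "nonneg v \<longleftrightarrow> (\<forall>x. 0 \<le> v x)"

abbreviation neg :: "'a vec \<Rightarrow> 'a vec" where
  "neg v \<equiv> lin_comb (-1) v 0 v"

abbreviation alt :: "nat \<Rightarrow> 'a \<Rightarrow> 'a \<Rightarrow> 'a list" where
  "alt \<equiv> alternating_word"

text \<open>The letter that prolongs \<open>alt n s t\<close> to
  \<open>alt (Suc n) s t\<close>.\<close>

definition letter :: "nat \<Rightarrow> 'a \<Rightarrow> 'a \<Rightarrow> 'a" where
  "letter n s t = (if even n then s else t)"

lemma letter_0 [simp]: "letter 0 s t = s"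
  by (simp add: letter_def)

lemma letter_Suc [simp]: "letter (Suc n) s t = letter n t s"
  by (simp add: letter_def)

lemma letter_cases: "letter n s t = s \<and> letter n t s = t \<or> letter n s t = t \<and> letter n t s = s"
  by (simp add: letter_def)

lemma alternating_word_snoc:
  "alt (Suc n) s t = alt n s t @ [letter n s t]"
  by (induction n arbitrary: s t) auto

lemma length_alternating_word [simp]: "length (alt n s t) = n"
  by (induction n s t rule: alternating_word.induct) auto

lemma alternating_word_lists:
  "s \<in> S \<Longrightarrow> t \<in> S \<Longrightarrow> alt n s t \<in> lists S"
  by (induction n s t rule: alternating_word.induct) auto

lemma rev_alternating_word:
  "rev (alt n s t) = (if even n then alt n t s else alt n s t)"
proof (induction n arbitrary: s t)
  case (Suc n)
  have "rev (alt (Suc n) s t) = letter n s t # rev (alt n s t)"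
    unfolding alternating_word_snoc by simp
  then show ?case by (simp add: Suc letter_def)
qed auto

text \<open>The Chebyshev polynomial of the second kind of degree \<open>n - 1\<close> at
  \<open>c\<close>: it is \<open>sin (n x) / sin x\<close> at \<open>cos x\<close>, and
  \<open>n\<close> at 1. These numbers are the coordinates of the roots of a dihedral group.\<close>

fun dihedral_coeff :: "real \<Rightarrow> nat \<Rightarrow> real" where
  "dihedral_coeff c 0 = 0"
| "dihedral_coeff c (Suc 0) = 1"
| "dihedral_coeff c (Suc (Suc n)) = 2 * c * dihedral_coeff c (Suc n) - dihedral_coeff c n"

lemma dihedral_coeff_1: "dihedral_coeff 1 n = real n"
  by (induction "1::real" n rule: dihedral_coeff.induct) auto

lemma dihedral_coeff_cos: "dihedral_coeff (cos x) n * sin x = sin (real n * x)"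
proof (induction "cos x" n rule: dihedral_coeff.induct)
  case (3 n)
  define y where "y = real (Suc n) * x"
  have 1: "real (Suc (Suc n)) * x = y + x" "real n * x = y - x"
    by (simp_all add: y_def algebra_simps)
  have "dihedral_coeff (cos x) (Suc n) * sin x = sin y"
    using 3(1) by (simp add: y_def)
  moreover have "dihedral_coeff (cos x) n * sin x = sin y * cos x - cos y * sin x"
    using 3(2) unfolding 1 sin_diff by simp
  ultimately show ?case
    unfolding 1 sin_add by (simp only: dihedral_coeff.simps left_diff_distrib mult.assoc) simp
qed auto

lemma lin_comb_zero [simp]: "lin_comb 1 v 0 w = v"
  by (simp add: lin_comb_def)

lemma neg_neg [simp]: "neg (neg v) = v"
  by (simp add: lin_comb_def)

lemma nonneg_lin_comb: "0 \<le> a \<Longrightarrow> 0 \<le> b \<Longrightarrow> nonneg v \<Longrightarrow> nonneg w \<Longrightarrow> nonneg (lin_comb a v b w)"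
  by (simp add: nonneg_def lin_comb_def)

lemma nonneg_simple_root: "nonneg (\<alpha> s)"
  by (simp add: nonneg_def simple_root_def)

lemma linear_mapD: "linear_map f \<Longrightarrow> f (lin_comb a v b w) = lin_comb a (f v) b (f w)"
  by (simp add: linear_map_def)

lemma linear_map_comp: "linear_map f \<Longrightarrow> linear_map g \<Longrightarrow> linear_map (f \<circ> g)"
  by (simp add: linear_map_def)

locale coxeter_geometry =
  fixes S :: "'a set" and m :: "'a \<Rightarrow> 'a \<Rightarrow> enat"
  assumes finite_S: "finite S" and coxeter: "coxeter_matrix S m"
begin

lemma m_sym: "s \<in> S \<Longrightarrow> t \<in> S \<Longrightarrow> m s t = m t s"
  using coxeter by (cases "s = t") (auto simp: coxeter_matrix_def)

lemma m_ge_2: "s \<in> S \<Longrightarrow> t \<in> S \<Longrightarrow> s \<noteq> t \<Longrightarrow> m s t = enat k \<Longrightarrow> 2 \<le> k"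
  using coxeter unfolding coxeter_matrix_def
  by (metis enat_ord_simps(1) numeral_eq_enat)

definition gram :: "'a \<Rightarrow> 'a \<Rightarrow> real" where
  "gram s t = (if s = t then 1 else case m s t of enat k \<Rightarrow> - cos (pi / real k) | \<infinity> \<Rightarrow> -1)"

definition form :: "'a vec \<Rightarrow> 'a vec \<Rightarrow> real" where
  "form v w = (\<Sum>s\<in>S. \<Sum>t\<in>S. v s * w t * gram s t)"

definition reflection :: "'a vec \<Rightarrow> 'a vec \<Rightarrow> 'a vec" where
  "reflection b v = lin_comb 1 v (- 2 * form v b) b"

abbreviation refl :: "'a \<Rightarrow> 'a vec \<Rightarrow> 'a vec" where
  "refl s \<equiv> reflection (\<alpha> s)"

definition act :: "'a list \<Rightarrow> 'a vec \<Rightarrow> 'a vec" where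
  "act w = foldr (\<lambda>s g. refl s \<circ> g) w id"

lemma act_Nil [simp]: "act [] = id"
  by (simp add: act_def)

lemma act_Cons [simp]: "act (s # w) = refl s \<circ> act w"
  by (simp add: act_def)

lemma gram_sym: "s \<in> S \<Longrightarrow> t \<in> S \<Longrightarrow> gram s t = gram t s"
  by (simp add: gram_def m_sym)

lemma gram_nonpos:
  assumes "s \<in> S" "t \<in> S" "s \<noteq> t" shows "gram s t \<le> 0"
proof (cases "m s t")
  case (enat k)
  then have "2 \<le> k" using m_ge_2 assms by blast
  then have "pi / real k \<le> pi / 2" by (intro divide_left_mono) auto
  moreover have "- (pi / 2) \<le> 0" "0 \<le> pi / real k" by simp_all
  ultimately have "0 \<le> cos (pi / real k)" by (intro cos_ge_zero) linarith+
  then show ?thesis using assms enat by (simp add: gram_def)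
qed (use assms in \<open>auto simp: gram_def\<close>)

lemma abs_gram_le: "\<bar>gram s t\<bar> \<le> 1"
  by (auto simp: gram_def split: enat.split)

lemma form_sym: "form v w = form w v"
  unfolding form_def by (subst sum.swap) (auto intro!: sum.cong simp: gram_sym)

lemma form_lin_comb_left [simp]: "form (lin_comb a v b w) u = a * form v u + b * form w u"
  by (simp add: form_def lin_comb_def algebra_simps sum.distrib sum_distrib_left)

lemma form_lin_comb_right [simp]: "form u (lin_comb a v b w) = a * form u v + b * form u w"
  by (metis form_sym form_lin_comb_left)

lemma form_simple_right:
  assumes "s \<in> S" shows "form v (\<alpha> s) = (\<Sum>r\<in>S. v r * gram r s)"
  unfolding form_def simple_root_def
proof (rule sum.cong)
  fix r
  have "(\<Sum>t\<in>S. v r * (if t = s then 1 else 0) * gram r t) = (\<Sum>t\<in>S. if t = s then v r * gram r s else 0)"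
    by (rule sum.cong) auto
  then show "(\<Sum>t\<in>S. v r * (if t = s then 1 else 0) * gram r t) = v r * gram r s"
    using assms by (simp add: finite_S)
qed simp

lemma form_simple_simple: "s \<in> S \<Longrightarrow> t \<in> S \<Longrightarrow> form (\<alpha> s) (\<alpha> t) = gram s t"
  by (simp add: form_simple_right) (simp add: simple_root_def finite_S if_distrib[of "\<lambda>y. y * _"] cong: if_cong)

lemma form_simple_self [simp]: "s \<in> S \<Longrightarrow> form (\<alpha> s) (\<alpha> s) = 1"
  by (simp add: form_simple_simple gram_def)

lemma form_expand_right: "form v w = (\<Sum>s\<in>S. w s * form v (\<alpha> s))"
proof -
  have "form v w = (\<Sum>s\<in>S. \<Sum>t\<in>S. v t * w s * gram t s)"
    unfolding form_def by (rule sum.swap)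
  then show ?thesis
    by (simp add: form_simple_right sum_distrib_left mult.assoc mult.left_commute)
qed

lemma linear_reflection: "linear_map (reflection b)"
  unfolding linear_map_def reflection_def form_lin_comb_left
  by (auto simp: lin_comb_def algebra_simps)

lemma form_reflection: "form b b = 1 \<Longrightarrow> form (reflection b v) (reflection b w) = form v w"
  by (simp add: reflection_def form_sym[of b w] algebra_simps)

lemma reflection_involutive: "form b b = 1 \<Longrightarrow> reflection b (reflection b v) = v"
  by (simp add: reflection_def) (simp add: lin_comb_def algebra_simps)

lemma reflection_self: "form b b = 1 \<Longrightarrow> reflection b b = neg b"
  by (auto simp: reflection_def lin_comb_def algebra_simps)

lemma act_append: "act (u @ v) = act u \<circ> act v"
  by (induction u) auto

lemma linear_act: "linear_map (act w)"
proof (induction w)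
  case (Cons s w)
  then show ?case unfolding act_Cons by (rule linear_map_comp[OF linear_reflection])
qed (simp add: linear_map_def)

lemma form_act: "w \<in> lists S \<Longrightarrow> form (act w u) (act w v) = form u v"
  by (induction w) (auto simp: form_reflection)

lemma act_rev: "w \<in> lists S \<Longrightarrow> act (rev w) (act w v) = v"
  by (induction w arbitrary: v) (auto simp: act_append reflection_involutive)

lemma act_rev': "w \<in> lists S \<Longrightarrow> act w (act (rev w) v) = v"
  using act_rev[of "rev w"] by (simp add: in_lists_conv_set)

lemma act_outside: "w \<in> lists S \<Longrightarrow> x \<notin> S \<Longrightarrow> act w v x = v x"
  by (induction w) (auto simp: reflection_def lin_comb_def simple_root_def)

section \<open>Dihedral subgroups in the geometric representation\<close>

definition dcoeff :: "'a \<Rightarrow> 'a \<Rightarrow> nat \<Rightarrow> real" where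
  "dcoeff s t = dihedral_coeff (- gram s t)"

lemma dcoeff_sym: "s \<in> S \<Longrightarrow> t \<in> S \<Longrightarrow> dcoeff s t = dcoeff t s"
  by (simp add: dcoeff_def gram_sym)

lemma dcoeff_rec [simp]:
  "dcoeff s t 0 = 0" "dcoeff s t (Suc 0) = 1"
  "dcoeff s t (Suc (Suc n)) = - 2 * gram s t * dcoeff s t (Suc n) - dcoeff s t n"
  by (simp_all add: dcoeff_def)

lemma dcoeff_inf: "s \<noteq> t \<Longrightarrow> m s t = \<infinity> \<Longrightarrow> dcoeff s t n = real n"
  by (simp add: dcoeff_def gram_def dihedral_coeff_1)

text \<open>With \<open>x = pi / k\<close> the coefficients are \<open>sin (n x) / sin x\<close>, so
  the claims are read off from the sine at \<open>n x\<close> for \<open>n < k\<close> and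
  \<open>n = k, k + 1, k - 1\<close>.\<close>

lemma
  assumes "s \<in> S" "t \<in> S" "s \<noteq> t" "m s t = enat k"
  shows dcoeff_pos: "0 < n \<Longrightarrow> n < k \<Longrightarrow> 0 < dcoeff s t n"
    and dcoeff_top: "dcoeff s t k = 0"
    and dcoeff_Suc_top: "dcoeff s t (Suc k) = -1"
    and gram_sq_less: "gram s t * gram s t < 1"
    and dcoeff_before_top: "k = Suc n \<Longrightarrow> dcoeff s t n = 1"
proof -
  have k: "2 \<le> k" using m_ge_2 assms by blast
  define x where "x = pi / real k"
  have x: "0 < x" "x < pi" "real k * x = pi" using k by (auto simp: x_def field_simps)
  have g: "- gram s t = cos x" using assms by (simp add: gram_def x_def)
  have s: "sin x > 0" using x by (simp add: sin_gt_zero)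
  have eq: "dcoeff s t n * sin x = sin (real n * x)" for n
    unfolding dcoeff_def g by (rule dihedral_coeff_cos)
  { assume "0 < n" "n < k"
    then have "0 < real n * x" "real n * x < pi" using x mult_strict_right_mono[of "real n" "real k" x] by simp_all
    then have "0 < sin (real n * x)" using x by (intro sin_gt_zero) linarith+
    then show "0 < dcoeff s t n" using eq[of n] s by (metis zero_less_mult_pos2) }
  show "dcoeff s t k = 0" using eq[of k] x s by simp
  have "real (Suc k) * x = x + pi" using x by (simp add: algebra_simps)
  then have "dcoeff s t (Suc k) * sin x = - sin x" using eq[of "Suc k"] by simp
  then have "(dcoeff s t (Suc k) + 1) * sin x = 0" by (simp only: distrib_right)
  then show "dcoeff s t (Suc k) = -1" using s by simp
  have "(cos x)\<^sup>2 + (sin x)\<^sup>2 = 1" "0 < (sin x)\<^sup>2" using s by (simp_all add: power2_eq_square)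
  then have "(cos x)\<^sup>2 < 1" by linarith
  moreover have "gram s t = - cos x" using g by simp
  ultimately show "gram s t * gram s t < 1" by (simp add: power2_eq_square)
  assume "k = Suc n"
  then have "real n * x = pi - x" using x by (simp add: algebra_simps)
  then have "dcoeff s t n * sin x = sin x" using eq[of n] by simp
  then show "dcoeff s t n = 1" using s by simp
qed

lemma dcoeff_nonneg:
  assumes "s \<in> S" "t \<in> S" "s \<noteq> t" "enat n \<le> m s t" shows "0 \<le> dcoeff s t n"
proof (cases "m s t")
  case (enat k)
  then have "n \<le> k" using assms by simp
  then show ?thesis using dcoeff_pos[OF assms(1-3) enat, of n] dcoeff_top[OF assms(1-3) enat]
    by (cases "n = 0"; cases "n = k") auto
qed (use assms dcoeff_inf in auto)

text \<open>These are the roots met along an alternating word. Putting \<open>refl s\<close> in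
  front of the case with \<open>s\<close> and \<open>t\<close> exchanged reproduces the three-term
  recurrence of \<open>dcoeff\<close>.\<close>

lemma act_alternating_word:
  assumes "s \<in> S" "t \<in> S" "s \<noteq> t"
  shows "act (alt n s t) (\<alpha> (letter n s t))
    = lin_comb (dcoeff s t (Suc n)) (\<alpha> s) (dcoeff s t n) (\<alpha> t)"
  using assms
proof (induction n arbitrary: s t)
  case 0
  then show ?case by simp
next
  case (Suc n)
  have "act (alt (Suc n) s t) (\<alpha> (letter (Suc n) s t))
    = refl s (lin_comb (dcoeff t s (Suc n)) (\<alpha> t) (dcoeff t s n) (\<alpha> s))"
    using Suc by simp
  also have "\<dots> = lin_comb (dcoeff s t (Suc (Suc n))) (\<alpha> s) (dcoeff s t (Suc n)) (\<alpha> t)"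
    using Suc.prems
    by (simp add: reflection_def form_simple_simple dcoeff_sym[of t s] gram_sym[of t s])
      (auto simp: lin_comb_def gram_def[of s s] algebra_simps)
  finally show ?case .
qed

text \<open>Both words send \<alpha> s and \<alpha> t to the same negatives of simple roots and fix
  the vectors orthogonal to both. For finite \<open>k\<close> the plane is nondegenerate, so this
  determines the map.\<close>

lemma act_braid:
  assumes "s \<in> S" "t \<in> S" "s \<noteq> t" "m s t = enat k"
  shows "act (alt k s t) = act (alt k t s)"
proof
  fix v
  obtain n where n: "k = Suc n" using m_ge_2[OF assms] by (cases k) auto
  have flip: "act (alt k a b) (\<alpha> (letter k a b)) = neg (\<alpha> a)
    \<and> act (alt k a b) (\<alpha> (letter n a b)) = neg (\<alpha> b)"
    if "a = s \<and> b = t \<or> a = t \<and> b = s" for a b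
  proof -
    have ab: "a \<in> S" "b \<in> S" "a \<noteq> b" "m a b = enat k" using that assms m_sym by auto
    have "letter n a b \<in> S" using ab by (simp add: letter_def)
    then have "act (alt k a b) (\<alpha> (letter n a b))
      = neg (act (alt n a b) (\<alpha> (letter n a b)))"
      unfolding n alternating_word_snoc
      by (simp add: act_append reflection_self linear_mapD[OF linear_act])
    moreover have "act (alt n a b) (\<alpha> (letter n a b)) = \<alpha> b"
      using dcoeff_top[OF ab] dcoeff_before_top[OF ab n] n
      by (simp add: act_alternating_word[OF ab(1-3)]) (simp add: lin_comb_def)
    moreover have "act (alt k a b) (\<alpha> (letter k a b)) = neg (\<alpha> a)"
      using dcoeff_top[OF ab] dcoeff_Suc_top[OF ab]
      by (simp only: act_alternating_word[OF ab(1-3)]) (simp add: lin_comb_def)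
    ultimately show ?thesis by simp
  qed
  have s: "act (alt k s t) (\<alpha> r) = act (alt k t s) (\<alpha> r)"
    if "r = s \<or> r = t" for r
    using flip[of s t] flip[of t s] that unfolding n by (cases "even n") (auto simp: letter_def)
  define g where "g = gram s t"
  define d where "d = 1 - g * g"
  have d: "d \<noteq> 0" using gram_sq_less[OF assms] by (simp add: d_def g_def)
  \<comment> \<open>The Gram system of the plane, with determinant \<open>d\<close>, solved for the
    component \<open>p\<close> of \<open>v\<close> in the plane; the rest \<open>q\<close> is
    orthogonal to both simple roots.\<close>
  define x y where "x = (form v (\<alpha> s) - g * form v (\<alpha> t)) / d"
    and "y = (form v (\<alpha> t) - g * form v (\<alpha> s)) / d"
  define p where "p = lin_comb x (\<alpha> s) y (\<alpha> t)"
  define q where "q = lin_comb 1 v (-1) p"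
  have v: "v = lin_comb 1 q 1 p" by (simp add: q_def lin_comb_def)
  have "x + y * g = form v (\<alpha> s)" "x * g + y = form v (\<alpha> t)"
    using d by (simp_all add: x_def y_def divide_simps) (simp_all add: d_def algebra_simps)
  then have "form q (\<alpha> s) = 0" "form q (\<alpha> t) = 0"
    using assms by (simp_all add: q_def p_def form_simple_simple gram_sym[of t s] g_def)
  then have fix_q: "act w q = q" if "w \<in> lists {s, t}" for w
    using that by (induction w) (auto simp: reflection_def)
  have "set (alt j a b) \<subseteq> {a, b}" for j and a b :: 'a
    by (induction j a b rule: alternating_word.induct) auto
  then have "alt k s t \<in> lists {s,t}" "alt k t s \<in> lists {s,t}" by blast+
  then show "act (alt k s t) v = act (alt k t s) v"
    unfolding v linear_mapD[OF linear_act] by (simp add: fix_q p_def linear_mapD[OF linear_act] s)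
qed

end

lemma braid_congruence_length:
  "(u, v) \<in> presentation_congruence S (braid_relations S m) \<Longrightarrow> length u = length v"
  by (induction rule: presentation_congruence.induct) (auto simp: braid_relations_def)

declare in_listsD [rule del] in_listsI [rule del]

lemma rev_lists [simp]: "rev w \<in> lists A \<longleftrightarrow> w \<in> lists A"
  by (simp add: in_lists_conv_set)

context coxeter_geometry
begin

section \<open>Roots and inversions\<close>

text \<open>The Coxeter group is taken as a group of linear maps, so that its equality is equality
  of maps; \<open>matsumoto\<close> leads back to words.\<close>

definition weyl :: "('a vec \<Rightarrow> 'a vec) set" where
  "weyl = act ` lists S"

definition word_length :: "('a vec \<Rightarrow> 'a vec) \<Rightarrow> nat" where
  "word_length g = (LEAST n. \<exists>w\<in>lists S. length w = n \<and> act w = g)"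

lemma word_length_le: "w \<in> lists S \<Longrightarrow> word_length (act w) \<le> length w"
  unfolding word_length_def by (rule Least_le) auto

lemma obtain_word_length:
  assumes "g \<in> weyl"
  obtains w where "w \<in> lists S" "act w = g" "length w = word_length g"
proof -
  have "\<exists>n. \<exists>w\<in>lists S. length w = n \<and> act w = g" using assms by (auto simp: weyl_def)
  from LeastI_ex[OF this] show ?thesis using that unfolding word_length_def by blast
qed

lemma act_weyl: "w \<in> lists S \<Longrightarrow> act w \<in> weyl"
  by (simp add: weyl_def)

lemma id_weyl [simp]: "id \<in> weyl"
  using act_weyl[of "[]"] by simp

lemma comp_weyl: "g \<in> weyl \<Longrightarrow> h \<in> weyl \<Longrightarrow> g \<circ> h \<in> weyl"
  unfolding weyl_def using act_append by (auto simp: image_iff) (metis append_in_lists_conv)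

lemma refl_weyl: "s \<in> S \<Longrightarrow> refl s \<in> weyl"
  using act_weyl[of "[s]"] by (simp add: act_Cons)

lemma refl_refl [simp]: "s \<in> S \<Longrightarrow> refl s (refl s v) = v"
  by (simp add: reflection_involutive)

lemma refl_comp_refl [simp]: "s \<in> S \<Longrightarrow> refl s \<circ> (refl s \<circ> g) = g"
  by (simp add: fun_eq_iff)

lemma comp_refl_refl [simp]: "s \<in> S \<Longrightarrow> g \<circ> refl s \<circ> refl s = g"
  by (simp add: fun_eq_iff)

lemma act_braid_rev:
  assumes "s \<in> S" "t \<in> S" "s \<noteq> t" "m s t = enat k"
  shows "act (rev (alt k s t)) = act (rev (alt k t s))"
  using act_braid[OF assms] by (simp add: rev_alternating_word)

lemma act_rev_alternating_word:
  assumes "s \<in> S" "t \<in> S" "s \<noteq> t" "enat (Suc k) \<le> m s t"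
  obtains a b where "0 \<le> a" "0 \<le> b"
    "act (rev (alt k t s)) (\<alpha> s) = lin_comb a (\<alpha> s) b (\<alpha> t)"
proof -
  have k: "enat k \<le> m s t" using assms(4) by (meson enat_ord_simps(1) le_SucI order.refl order_trans)
  have nn: "0 \<le> dcoeff s t (Suc k)" "0 \<le> dcoeff s t k"
    using dcoeff_nonneg assms k by blast+
  show ?thesis
  proof (cases "even k")
    case True
    then have "act (rev (alt k t s)) (\<alpha> s)
      = act (alt k s t) (\<alpha> (letter k s t))"
      by (simp add: rev_alternating_word letter_def)
    then show ?thesis using act_alternating_word[OF assms(1-3)] nn that by metis
  next
    case False
    then have "act (rev (alt k t s)) (\<alpha> s)
      = act (alt k t s) (\<alpha> (letter k t s))"
      by (simp add: rev_alternating_word letter_def)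
    also have "\<dots> = lin_comb (dcoeff s t k) (\<alpha> s) (dcoeff s t (Suc k)) (\<alpha> t)"
      using act_alternating_word[OF assms(2,1)] assms(3) dcoeff_sym[OF assms(1,2)]
      by (simp add: lin_comb_def add.commute)
    finally show ?thesis using nn that by blast
  qed
qed

text \<open>Induction on length. Among the shortest expressions of \<open>g\<close> choose one with
  the longest alternating tail in \<open>s\<close> and \<open>t\<close> that ends in
  \<open>t\<close>. The rest \<open>v\<close> has neither letter as a right descent, so the
  induction hypothesis applies to it, and the tail sends \<alpha> s to a nonnegative combination of
  \<alpha> s and \<alpha> t.\<close>

lemma nonneg_act_simple_root:
  assumes "g \<in> weyl" "s \<in> S" "word_length g \<le> word_length (g \<circ> refl s)"
  shows "nonneg (g (\<alpha> s))"
  using assms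
proof (induction "word_length g" arbitrary: g s rule: less_induct)
  case less
  obtain w where w: "w \<in> lists S" "act w = g" "length w = word_length g"
    using obtain_word_length less.prems by blast
  show ?case
  proof (cases w rule: rev_cases)
    case Nil
    then show ?thesis using w by (auto simp: nonneg_simple_root)
  next
    case (snoc w' t)
    have t: "t \<in> S" and w': "w' \<in> lists S" using w snoc by auto
    have st: "s \<noteq> t"
    proof
      assume "s = t"
      then have "g \<circ> refl s = act w'" using w snoc less.prems(2) by (auto simp: act_append act_Cons)
      then have "word_length (g \<circ> refl s) < word_length g"
        using word_length_le[OF w'] w snoc by simp
      then show False using less.prems(3) by simp
    qed
    \<comment> \<open>Reversing the alternating word makes the tail end in \<open>t\<close> for
      either parity of \<open>k\<close>.\<close>
    define P where "P k \<longleftrightarrow> (\<exists>v\<in>lists S. length v + k = word_length g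
      \<and> act (v @ rev (alt k t s)) = g)" for k
    have "P 1" unfolding P_def using w snoc w' by (intro bexI[of _ w']) auto
    moreover have bound: "\<forall>k. P k \<longrightarrow> k \<le> word_length g" by (auto simp: P_def)
    define k where "k = Greatest P"
    have "P k" and max: "\<And>j. P j \<Longrightarrow> j \<le> k" and k1: "1 \<le> k"
      unfolding k_def using GreatestI_nat[of P 1 "word_length g"] Greatest_le_nat[of P _ "word_length g"]
        \<open>P 1\<close> bound by auto
    then obtain v where v: "v \<in> lists S" "length v + k = word_length g"
      "act (v @ rev (alt k t s)) = g" by (auto simp: P_def)
    define x where "x = rev (alt k t s)"
    have x: "x \<in> lists S" "length x = k"
      using alternating_word_lists[OF t less.prems(2)] by (auto simp: x_def)
    have wl_v: "word_length (act v) = length v"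
    proof -
      obtain u where u: "u \<in> lists S" "act u = act v" "length u = word_length (act v)"
        using obtain_word_length[OF act_weyl[OF v(1)]] by blast
      have "act (u @ x) = g" using u v by (simp add: act_append x_def)
      then have "word_length g \<le> length u + k" using word_length_le[of "u @ x"] u x by auto
      then show ?thesis using u v word_length_le[OF v(1)] by simp
    qed
    have up: "word_length (act v) \<le> word_length (act v \<circ> refl r)" if r: "r = s \<or> r = t" for r
    proof (rule ccontr)
      assume "\<not> ?thesis"
      then have lt: "word_length (act v \<circ> refl r) < length v" using wl_v by simp
      have rS: "r \<in> S" using r t less.prems(2) by auto
      obtain u where u: "u \<in> lists S" "act u = act v \<circ> refl r" "length u = word_length (act v \<circ> refl r)"
        using obtain_word_length[OF comp_weyl[OF act_weyl[OF v(1)] refl_weyl[OF rS]]] by blast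
      have au: "act u \<circ> refl r = act v" using u rS by simp
      have "r = letter k t s \<or> r = letter k s t" using r by (auto simp: letter_def)
      then show False
      proof
        assume r: "r = letter k t s"
        have "act (u @ rev (alt (Suc k) t s)) = g"
          using au v(3) r unfolding alternating_word_snoc
          by (simp add: act_append act_Cons comp_assoc[symmetric])
        moreover from this have "word_length g \<le> length u + Suc k"
          using word_length_le[of "u @ rev (alt (Suc k) t s)"] u
            alternating_word_lists[OF t less.prems(2), of "Suc k"] by auto
        then have "length u + Suc k = word_length g" using u lt v by simp
        ultimately have "P (Suc k)" using u(1) by (auto simp: P_def)
        then show False using max by force
      next
        assume r: "r = letter k s t"
        obtain k' where k': "k = Suc k'" using k1 by (cases k) auto
        have "x = r # rev (alt k' t s)"
          unfolding x_def k' alternating_word_snoc using r k' by (simp add: letter_def)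
        then have "act v \<circ> act x = act u \<circ> act (rev (alt k' t s))"
          unfolding au[symmetric] using rS by (simp add: act_Cons comp_assoc)
        then have "act (u @ rev (alt k' t s)) = g"
          using v(3) by (simp add: act_append x_def)
        then have "word_length g \<le> length u + k'"
          using word_length_le[of "u @ rev (alt k' t s)"] u
            alternating_word_lists[OF t less.prems(2), of k'] by auto
        then show False using u lt v k' by simp
      qed
    qed
    have nn: "nonneg (act v (\<alpha> r))" if "r = s \<or> r = t" for r
      using less.hyps[of "act v" r] up[OF that] that act_weyl[OF v(1)] t less.prems(2) wl_v v(2) k1
      by auto
    \<comment> \<open>A tail of \<open>m s t\<close> or more letters could be rewritten by the braid
      relation so as to end in \<open>s\<close>; then \<open>g \<circ> refl s\<close> would be
      shorter than \<open>g\<close>.\<close>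
    have km: "enat (Suc k) \<le> m s t"
    proof (rule ccontr)
      assume "\<not> ?thesis"
      then obtain n where n: "m s t = enat n" "n \<le> k" by (cases "m s t") auto
      have n0: "0 < n" using m_ge_2[OF less.prems(2) t st n(1)] by simp
      have split: "\<exists>z\<in>lists S. alt k t s = alt n t s @ z" if "n \<le> k" for k
        using that
      proof (induction k rule: dec_induct)
        case (step k)
        then obtain z where "z \<in> lists S" "alt k t s = alt n t s @ z" by blast
        then show ?case unfolding alternating_word_snoc using t less.prems(2)
          by (intro bexI[of _ "z @ [letter k t s]"]) (auto simp: letter_def)
      qed (auto intro: bexI[of _ "[]"])
      obtain z where z: "z \<in> lists S" "alt k t s = alt n t s @ z"
        using split[OF n(2)] by blast
      have lz: "k = n + length z" using arg_cong[OF z(2), of length] by simp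
      obtain n' where n': "n = Suc n'" using n0 by (cases n) auto
      define u where "u = v @ rev z @ rev (alt n' t s)"
      have "g = act (v @ rev z @ rev (alt n s t))"
        using v(3) z act_braid_rev[OF less.prems(2) t st n(1)] by (simp add: act_append)
      also have "\<dots> = act u \<circ> refl s" by (simp add: u_def n' act_append act_Cons comp_assoc)
      finally have "g \<circ> refl s = act u" using less.prems(2) by simp
      moreover have "u \<in> lists S" "length u < word_length g"
        using v z lz n' alternating_word_lists[OF t less.prems(2), of n'] by (auto simp: u_def)
      ultimately show False using word_length_le[of u] less.prems(3) by simp
    qed
    obtain a b where "0 \<le> a" "0 \<le> b"
      "act x (\<alpha> s) = lin_comb a (\<alpha> s) b (\<alpha> t)"
      using act_rev_alternating_word[OF less.prems(2) t st km] unfolding x_def by blast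
    then have "g (\<alpha> s) = lin_comb a (act v (\<alpha> s)) b (act v (\<alpha> t))"
      using v(3) by (auto simp: x_def act_append linear_mapD[OF linear_act])
    then show ?thesis using nn nonneg_lin_comb \<open>0 \<le> a\<close> \<open>0 \<le> b\<close> by metis
  qed
qed

definition ginv :: "('a vec \<Rightarrow> 'a vec) \<Rightarrow> 'a vec \<Rightarrow> 'a vec" where
  "ginv g = inv_into UNIV g"

lemma ginv_act: "w \<in> lists S \<Longrightarrow> ginv (act w) = act (rev w)"
  unfolding ginv_def by (rule inv_equality) (auto simp: act_rev act_rev')

lemma ginv_weyl: "g \<in> weyl \<Longrightarrow> ginv g \<in> weyl"
  by (auto simp: weyl_def ginv_act)

lemma ginv_apply [simp]: "g \<in> weyl \<Longrightarrow> ginv g (g v) = v"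
  by (auto simp: weyl_def ginv_act act_rev)

lemma apply_ginv [simp]: "g \<in> weyl \<Longrightarrow> g (ginv g v) = v"
  by (auto simp: weyl_def ginv_act act_rev')

lemma ginv_ginv [simp]: "g \<in> weyl \<Longrightarrow> ginv (ginv g) = g"
  by (metis apply_ginv ginv_apply ginv_weyl ext)

lemma ginv_comp: "g \<in> weyl \<Longrightarrow> h \<in> weyl \<Longrightarrow> ginv (g \<circ> h) = ginv h \<circ> ginv g"
  unfolding ginv_def[of "g \<circ> h"] by (rule inv_equality) auto

lemma ginv_id [simp]: "ginv id = id"
  by (simp add: ginv_def)

lemma ginv_refl [simp]: "s \<in> S \<Longrightarrow> ginv (refl s) = refl s"
  using ginv_act[of "[s]"] by (simp add: act_Cons)

lemma comp_ginv [simp]: "g \<in> weyl \<Longrightarrow> g \<circ> ginv g = id" "g \<in> weyl \<Longrightarrow> ginv g \<circ> g = id"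
  by (auto simp: fun_eq_iff)

lemma linear_weyl: "g \<in> weyl \<Longrightarrow> linear_map g"
  by (auto simp: weyl_def linear_act)

lemma weyl_lin_comb: "g \<in> weyl \<Longrightarrow> g (lin_comb a v b w) = lin_comb a (g v) b (g w)"
  by (simp add: linear_weyl linear_mapD)

lemma form_weyl: "g \<in> weyl \<Longrightarrow> form (g v) (g w) = form v w"
  by (auto simp: weyl_def form_act)

lemma weyl_inject: "g \<in> weyl \<Longrightarrow> g v = g w \<longleftrightarrow> v = w"
  by (metis ginv_apply)

lemma nonneg_weyl_simple_root:
  assumes "g \<in> weyl" "s \<in> S"
  shows "nonneg (g (\<alpha> s)) \<or> nonneg (neg (g (\<alpha> s)))"
proof (cases "word_length g \<le> word_length (g \<circ> refl s)")
  case False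
  then have "nonneg ((g \<circ> refl s) (\<alpha> s))"
    using nonneg_act_simple_root[of "g \<circ> refl s" s] assms comp_weyl refl_weyl by simp
  then show ?thesis using assms by (simp add: reflection_self weyl_lin_comb)
qed (use nonneg_act_simple_root assms in blast)

lemma nonneg_both_zero: "nonneg v \<Longrightarrow> nonneg (neg v) \<Longrightarrow> v = (\<lambda>_. 0)"
  by (auto simp: nonneg_def lin_comb_def fun_eq_iff intro: antisym)

definition roots :: "'a vec set" where
  "roots = {g (\<alpha> s) | g s. g \<in> weyl \<and> s \<in> S}"

definition pos :: "'a vec set" where
  "pos = {b \<in> roots. nonneg b}"

lemma form_root [simp]: "b \<in> roots \<Longrightarrow> form b b = 1"
  by (auto simp: roots_def form_weyl)

lemma pos_roots: "b \<in> pos \<Longrightarrow> b \<in> roots" and pos_nonneg: "b \<in> pos \<Longrightarrow> nonneg b"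
  by (auto simp: pos_def)

lemma weyl_roots: "g \<in> weyl \<Longrightarrow> b \<in> roots \<Longrightarrow> g b \<in> roots"
  unfolding roots_def using comp_weyl by (auto) (metis comp_apply)

lemma simple_root_roots: "s \<in> S \<Longrightarrow> \<alpha> s \<in> roots"
  unfolding roots_def using id_weyl by (metis (mono_tags, lifting) id_apply mem_Collect_eq)

lemma simple_root_pos: "s \<in> S \<Longrightarrow> \<alpha> s \<in> pos"
  by (simp add: pos_def simple_root_roots nonneg_simple_root)

lemma neg_roots: "b \<in> roots \<Longrightarrow> neg b \<in> roots"
proof -
  assume "b \<in> roots"
  then obtain g s where "g \<in> weyl" "s \<in> S" "b = g (\<alpha> s)" by (auto simp: roots_def)
  then have "neg b = (g \<circ> refl s) (\<alpha> s)" by (simp add: reflection_self weyl_lin_comb)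
  moreover have "g \<circ> refl s \<in> weyl" using \<open>g \<in> weyl\<close> \<open>s \<in> S\<close> comp_weyl refl_weyl by blast
  ultimately show ?thesis unfolding roots_def using \<open>s \<in> S\<close> by blast
qed

lemma root_nonzero: "b \<in> roots \<Longrightarrow> b \<noteq> (\<lambda>_. 0)"
  using form_root[of b] by (auto simp: form_def)

lemma nonneg_neg_iff: "b \<in> roots \<Longrightarrow> nonneg (neg b) \<longleftrightarrow> \<not> nonneg b"
  using nonneg_weyl_simple_root nonneg_both_zero root_nonzero unfolding roots_def by blast

lemma neg_pos_iff: "b \<in> roots \<Longrightarrow> neg b \<in> pos \<longleftrightarrow> b \<notin> pos"
  using neg_roots nonneg_neg_iff by (auto simp: pos_def)

lemma root_outside: "b \<in> roots \<Longrightarrow> x \<notin> S \<Longrightarrow> b x = 0"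
  by (auto simp: roots_def weyl_def act_outside) (auto simp: simple_root_def)

text \<open>Faithfulness: if a shortest word of \<open>g\<close> ended in \<open>s\<close>, then
  \<open>g (\<alpha> s)\<close> would be negative.\<close>

lemma weyl_eq_id:
  assumes g: "g \<in> weyl" and nn: "\<And>s. s \<in> S \<Longrightarrow> nonneg (g (\<alpha> s))" shows "g = id"
proof -
  obtain w where w: "w \<in> lists S" "act w = g" "length w = word_length g"
    using obtain_word_length g by blast
  show ?thesis
  proof (cases w rule: rev_cases)
    case (snoc v s)
    then have s: "s \<in> S" "v \<in> lists S" using w by auto
    have v: "g \<circ> refl s = act v" using w snoc s by (auto simp: act_append)
    then have "word_length (g \<circ> refl s) < word_length g" using word_length_le[OF s(2)] w snoc by simp
    then have "nonneg ((g \<circ> refl s) (\<alpha> s))"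
      using nonneg_act_simple_root[of "g \<circ> refl s" s] s g comp_weyl refl_weyl by simp
    then have "nonneg (neg (g (\<alpha> s)))" using s g by (simp add: reflection_self weyl_lin_comb)
    then show ?thesis using nn[OF s(1)] nonneg_neg_iff weyl_roots[OF g simple_root_roots[OF s(1)]] by blast
  qed (use w in auto)
qed

lemma pos_other_coeff:
  assumes "b \<in> pos" "s \<in> S" "b \<noteq> \<alpha> s"
  obtains x where "x \<noteq> s" "0 < b x"
proof (cases "\<exists>x. x \<noteq> s \<and> b x \<noteq> 0")
  case True
  then show ?thesis using that pos_nonneg[OF assms(1)] by (auto simp: nonneg_def) (metis order_le_less)
next
  case False
  then have "b = lin_comb (b s) (\<alpha> s) 0 b" by (auto simp: lin_comb_def simple_root_def fun_eq_iff)
  then obtain c where c: "b = lin_comb c (\<alpha> s) 0 b" "c \<ge> 0"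
    using pos_nonneg[OF assms(1)] by (auto simp: nonneg_def)
  have "form b b = form (lin_comb c (\<alpha> s) 0 b) (lin_comb c (\<alpha> s) 0 b)"
    using c(1) by metis
  then have "c * c = 1" using assms form_root pos_roots by (auto simp: form_simple_self)
  then have "c = 1" using c(2) by (metis abs_mult_self_eq abs_of_nonneg square_eq_1_iff abs_1 abs_minus_cancel)
  then have "b = \<alpha> s" using c(1) by (metis lin_comb_zero)
  then show ?thesis using assms by simp
qed

text \<open>\<open>refl s\<close> changes only the coordinate at \<open>s\<close>; some other
  coordinate of \<open>b\<close> is positive, and it alone decides the sign of the reflected
  root.\<close>

lemma refl_pos:
  assumes "b \<in> pos" "s \<in> S" "b \<noteq> \<alpha> s" shows "refl s b \<in> pos"
proof -
  obtain x where x: "x \<noteq> s" "0 < b x" using pos_other_coeff[OF assms] .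
  have "refl s b x = b x" using x by (simp add: reflection_def lin_comb_def simple_root_def)
  then have "\<not> nonneg (neg (refl s b))" using x by (auto simp: nonneg_def lin_comb_def intro!: exI[of _ x])
  moreover have "refl s b \<in> roots" using weyl_roots refl_weyl assms pos_roots by blast
  ultimately show ?thesis using nonneg_neg_iff by (auto simp: pos_def)
qed

section \<open>Inversion sets\<close>

definition inversions :: "('a vec \<Rightarrow> 'a vec) \<Rightarrow> 'a vec set" (\<open>\<N>\<close>) where
  "\<N> g = {b \<in> pos. ginv g b \<notin> pos}"

lemma inversions_pos: "\<N> g \<subseteq> pos"
  by (auto simp: inversions_def)

lemma inversions_id [simp]: "\<N> id = {}"
  by (auto simp: inversions_def)

lemma lin_comb_pos:
  assumes "a \<ge> 0" "b \<ge> 0" "v \<in> pos" "w \<in> pos" "lin_comb a v b w \<in> roots"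
  shows "lin_comb a v b w \<in> pos"
  using assms nonneg_lin_comb[of a b v w] by (simp add: pos_def)

text \<open>\<open>ginv g\<close> is linear and every root has a sign, so a nonnegative combination
  of roots made negative is again made negative. Together with \<open>inversions_cocone\<close> this
  says that inversion sets are biclosed.\<close>

lemma inversions_cone:
  assumes g: "g \<in> weyl" and "a \<ge> 0" "b \<ge> 0" "lin_comb a v b w \<in> roots"
    and "v \<in> \<N> g" "w \<in> \<N> g"
  shows "lin_comb a v b w \<in> \<N> g"
proof -
  have vw: "v \<in> pos" "w \<in> pos" "ginv g v \<notin> pos" "ginv g w \<notin> pos"
    using assms by (auto simp: inversions_def)
  have r: "ginv g x \<in> roots" if "x \<in> roots" for x using weyl_roots[OF ginv_weyl[OF g] that] .
  have "neg (ginv g v) \<in> pos" "neg (ginv g w) \<in> pos" using vw r neg_pos_iff pos_roots by auto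
  then have "nonneg (lin_comb a (neg (ginv g v)) b (neg (ginv g w)))"
    using assms by (intro nonneg_lin_comb pos_nonneg)
  also have "lin_comb a (neg (ginv g v)) b (neg (ginv g w)) = neg (ginv g (lin_comb a v b w))"
    by (simp add: weyl_lin_comb[OF ginv_weyl[OF g]]) (auto simp: lin_comb_def algebra_simps)
  finally have "ginv g (lin_comb a v b w) \<notin> pos"
    using r[OF assms(4)] nonneg_neg_iff by (auto simp: pos_def)
  then show ?thesis using lin_comb_pos assms vw by (auto simp: inversions_def)
qed

lemma inversions_cocone:
  assumes g: "g \<in> weyl" and "a \<ge> 0" "b \<ge> 0" "lin_comb a v b w \<in> roots" "v \<in> pos" "w \<in> pos"
    and "v \<notin> \<N> g" "w \<notin> \<N> g"
  shows "lin_comb a v b w \<notin> \<N> g"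
proof -
  have "ginv g v \<in> pos" "ginv g w \<in> pos" using assms by (auto simp: inversions_def)
  then have "lin_comb a (ginv g v) b (ginv g w) \<in> pos"
    using assms weyl_roots[OF ginv_weyl[OF g]] lin_comb_pos weyl_lin_comb[OF ginv_weyl[OF g]] by metis
  then show ?thesis using weyl_lin_comb[OF ginv_weyl[OF g]] by (auto simp: inversions_def)
qed

text \<open>The hypothesis excludes cancellation: if \<open>ginv g\<close> makes \<open>b\<close>
  negative, then \<open>neg (ginv g b)\<close> is an inversion of \<open>ginv g\<close>, hence not
  one of \<open>h\<close>, so \<open>ginv h\<close> does not turn the sign back.\<close>

lemma inversions_comp:
  assumes "g \<in> weyl" "h \<in> weyl" and disj: "\<N> (ginv g) \<inter> \<N> h = {}"
  shows "\<N> (g \<circ> h) = \<N> g \<union> g ` \<N> h"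
    and "\<N> g \<inter> g ` \<N> h = {}"
proof -
  have r: "f x \<in> roots" if "x \<in> roots" "f \<in> weyl" for x f using weyl_roots that by blast
  have 1: "ginv (g \<circ> h) b = ginv h (ginv g b)" for b by (simp add: ginv_comp assms)
  have 2: "b \<in> \<N> (g \<circ> h) \<longleftrightarrow> b \<in> \<N> g \<union> g ` \<N> h" if b: "b \<in> pos" for b
  proof (cases "ginv g b \<in> pos")
    case True
    then have "b \<in> \<N> (g \<circ> h) \<longleftrightarrow> ginv g b \<in> \<N> h" "b \<notin> \<N> g"
      using b by (simp_all add: inversions_def 1)
    moreover have "b \<in> g ` \<N> h \<longleftrightarrow> ginv g b \<in> \<N> h"
    proof
      assume "b \<in> g ` \<N> h"
      then show "ginv g b \<in> \<N> h" using assms(1) by auto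
    next
      assume "ginv g b \<in> \<N> h"
      then show "b \<in> g ` \<N> h" using apply_ginv[OF assms(1), of b] by (intro image_eqI) auto
    qed
    ultimately show ?thesis by blast
  next
    case False
    define c where "c = neg (ginv g b)"
    have gb: "ginv g b \<in> roots" using r ginv_weyl assms b pos_roots by blast
    have c: "c \<in> pos" using gb False neg_pos_iff by (simp add: c_def)
    have "g c = neg b" using assms by (simp add: c_def weyl_lin_comb)
    moreover have "neg b \<notin> pos" using b neg_pos_iff[OF pos_roots[OF b]] by blast
    ultimately have "c \<in> \<N> (ginv g)" using c assms by (simp add: inversions_def)
    then have "c \<notin> \<N> h" using disj by blast
    then have "ginv h c \<in> pos" using c by (auto simp: inversions_def)
    moreover have "ginv h c = neg (ginv h (ginv g b))"
      using assms by (simp add: c_def weyl_lin_comb[OF ginv_weyl])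
    ultimately have "ginv h (ginv g b) \<notin> pos"
      using neg_pos_iff r gb ginv_weyl assms by auto
    then show ?thesis using b False by (auto simp: inversions_def 1)
  qed
  have "g c \<in> pos \<and> g c \<notin> \<N> g" if "c \<in> \<N> h" for c
  proof -
    have "c \<in> pos" "c \<notin> \<N> (ginv g)" using that disj by (auto simp: inversions_def)
    then show ?thesis using assms by (auto simp: inversions_def)
  qed
  then have 3: "g ` \<N> h \<subseteq> pos" and "\<N> g \<inter> g ` \<N> h = {}" by blast+
  then show "\<N> g \<inter> g ` \<N> h = {}" by simp
  show "\<N> (g \<circ> h) = \<N> g \<union> g ` \<N> h"
    using 2 3 inversions_pos by (intro subset_antisym subsetI) blast+
qed

lemma inversions_refl: "s \<in> S \<Longrightarrow> \<N> (refl s) = {\<alpha> s}"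
proof -
  assume s: "s \<in> S"
  have "refl s (\<alpha> s) \<notin> pos"
    using neg_pos_iff[OF simple_root_roots[OF s]] simple_root_pos[OF s] s by (simp add: reflection_self)
  then show ?thesis using s refl_pos simple_root_pos by (auto simp: inversions_def)
qed

lemma inversions_refl_comp:
  assumes "s \<in> S" "g \<in> weyl" "\<alpha> s \<notin> \<N> g"
  shows "\<N> (refl s \<circ> g) = insert (\<alpha> s) (refl s ` \<N> g)"
    and "\<alpha> s \<notin> refl s ` \<N> g"
  using inversions_comp[OF refl_weyl assms(2), of s] assms by (auto simp: inversions_refl)

lemma simple_inversion_refl_comp:
  assumes "s \<in> S" "g \<in> weyl"
  shows "\<alpha> s \<in> \<N> (refl s \<circ> g) \<longleftrightarrow> \<alpha> s \<notin> \<N> g"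
proof -
  have r: "ginv g (\<alpha> s) \<in> roots" using assms ginv_weyl weyl_roots simple_root_roots by blast
  have "ginv (refl s \<circ> g) (\<alpha> s) = neg (ginv g (\<alpha> s))"
    using assms refl_weyl by (simp add: ginv_comp reflection_self weyl_lin_comb[OF ginv_weyl])
  then show ?thesis using neg_pos_iff[OF r] simple_root_pos assms by (auto simp: inversions_def)
qed

lemma inversions_refl_comp_down:
  assumes "s \<in> S" "g \<in> weyl" "\<alpha> s \<in> \<N> g"
  shows "\<N> g = insert (\<alpha> s) (refl s ` \<N> (refl s \<circ> g))"
    and "\<alpha> s \<notin> refl s ` \<N> (refl s \<circ> g)"
  using inversions_refl_comp[of s "refl s \<circ> g"] simple_inversion_refl_comp[of s g] assms
    comp_weyl refl_weyl by simp_all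

lemma simple_inversion_ginv:
  "s \<in> S \<Longrightarrow> g \<in> weyl \<Longrightarrow> \<alpha> s \<in> \<N> (ginv g) \<longleftrightarrow> g (\<alpha> s) \<notin> pos"
  by (simp add: inversions_def simple_root_pos)

lemma inversions_comp_refl:
  assumes "s \<in> S" "g \<in> weyl" "g (\<alpha> s) \<in> pos"
  shows "\<N> (g \<circ> refl s) = insert (g (\<alpha> s)) (\<N> g)"
    and "g (\<alpha> s) \<notin> \<N> g"
  using inversions_comp[OF assms(2) refl_weyl, of s] assms
  by (auto simp: inversions_refl simple_inversion_ginv)

lemma finite_inversions: "g \<in> weyl \<Longrightarrow> finite (\<N> g)"
proof -
  have "w \<in> lists S \<Longrightarrow> finite (\<N> (act w))" for w
  proof (induction w)
    case (Cons s w)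
    then have "w \<in> lists S" "s \<in> S" by auto
    have "finite (\<N> (refl s \<circ> act w))"
    proof (cases "\<alpha> s \<in> \<N> (act w)")
      case True
      have "finite (refl s ` \<N> (refl s \<circ> act w))"
        using inversions_refl_comp_down(1)[OF \<open>s \<in> S\<close> act_weyl True] Cons.IH \<open>w \<in> lists S\<close>
        by (metis finite_insert)
      then show ?thesis
        by (rule finite_imageD) (simp add: inj_on_def weyl_inject[OF refl_weyl[OF \<open>s \<in> S\<close>]])
    next
      case False
      then show ?thesis
        using inversions_refl_comp(1)[OF \<open>s \<in> S\<close> act_weyl False] Cons.IH \<open>w \<in> lists S\<close> by simp
    qed
    then show ?case by (simp only: act_Cons)
  qed simp
  then show "g \<in> weyl \<Longrightarrow> ?thesis" by (auto simp: weyl_def)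
qed

abbreviation len :: "('a vec \<Rightarrow> 'a vec) \<Rightarrow> nat" where
  "len g \<equiv> card (\<N> g)"

lemma exists_simple_inversion:
  assumes "g \<in> weyl" "g \<noteq> id" obtains s where "s \<in> S" "\<alpha> s \<in> \<N> g"
proof -
  have "ginv g \<noteq> id" using assms by (metis ginv_ginv ginv_id)
  then obtain s where "s \<in> S" "\<not> nonneg (ginv g (\<alpha> s))"
    using weyl_eq_id ginv_weyl assms by blast
  then show ?thesis using that[of s] simple_root_pos by (auto simp: inversions_def pos_def)
qed

lemma len_refl_comp:
  assumes "s \<in> S" "g \<in> weyl" "\<alpha> s \<notin> \<N> g" shows "len (refl s \<circ> g) = Suc (len g)"
  using inversions_refl_comp[OF assms] finite_inversions[OF assms(2)] weyl_inject[OF refl_weyl[OF assms(1)]]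
  by (simp add: card_image inj_on_def)

lemma len_refl_comp_down:
  assumes "s \<in> S" "g \<in> weyl" "\<alpha> s \<in> \<N> g" shows "len g = Suc (len (refl s \<circ> g))"
  using len_refl_comp[of s "refl s \<circ> g"] simple_inversion_refl_comp[of s g] assms comp_weyl refl_weyl by simp

section \<open>The weak order\<close>

abbreviation weak_le :: "('a vec \<Rightarrow> 'a vec) \<Rightarrow> ('a vec \<Rightarrow> 'a vec) \<Rightarrow> bool"
    (infix "\<preceq>" 50) where
  "g \<preceq> h \<equiv> \<N> g \<subseteq> \<N> h"

lemma refl_image_subset_iff: "s \<in> S \<Longrightarrow> refl s ` A \<subseteq> refl s ` B \<longleftrightarrow> A \<subseteq> B"
  by (rule inj_image_subset_iff) (simp add: inj_on_def weyl_inject[OF refl_weyl])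

lemma refl_image_disjoint_iff: "s \<in> S \<Longrightarrow> A \<inter> refl s ` B = {} \<longleftrightarrow> refl s ` A \<inter> B = {}"
  by (auto simp: disjoint_iff) (metis imageI refl_refl)

lemma weak_le_refl_comp_iff:
  assumes "s \<in> S" "g \<in> weyl" "h \<in> weyl" "\<alpha> s \<notin> \<N> g" "\<alpha> s \<notin> \<N> h"
  shows "refl s \<circ> g \<preceq> refl s \<circ> h \<longleftrightarrow> g \<preceq> h"
  using inversions_refl_comp[OF assms(1,2,4)] inversions_refl_comp[OF assms(1,3,5)]
    refl_image_subset_iff[OF assms(1)] by (simp add: subset_insert)

lemma weak_le_down_iff:
  assumes "s \<in> S" "g \<in> weyl" "h \<in> weyl" "\<alpha> s \<in> \<N> g" "\<alpha> s \<in> \<N> h"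
  shows "refl s \<circ> g \<preceq> refl s \<circ> h \<longleftrightarrow> g \<preceq> h"
proof -
  have "refl s \<circ> g \<in> weyl" "refl s \<circ> h \<in> weyl"
    "\<alpha> s \<notin> \<N> (refl s \<circ> g)" "\<alpha> s \<notin> \<N> (refl s \<circ> h)"
    using assms by (auto simp: simple_inversion_refl_comp intro: comp_weyl refl_weyl)
  from weak_le_refl_comp_iff[OF assms(1) this] show ?thesis
    unfolding refl_comp_refl[OF assms(1)] by (rule HOL.sym)
qed

lemma inversions_empty_iff: "g \<in> weyl \<Longrightarrow> \<N> g = {} \<longleftrightarrow> g = id"
  by (metis exists_simple_inversion empty_iff inversions_id)

lemma inversions_inject: "g \<in> weyl \<Longrightarrow> h \<in> weyl \<Longrightarrow> \<N> g = \<N> h \<Longrightarrow> g = h"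
proof (induction "len g" arbitrary: g h rule: less_induct)
  case less
  show ?case
  proof (cases "g = id")
    case True
    then show ?thesis using less.prems inversions_empty_iff[of h] by simp
  next
    case False
    then obtain s where s: "s \<in> S" "\<alpha> s \<in> \<N> g"
      using exists_simple_inversion less.prems by blast
    have "\<N> (refl s \<circ> g) = \<N> (refl s \<circ> h)"
      using weak_le_down_iff[of s g h] weak_le_down_iff[of s h g] s less.prems by auto
    then have "refl s \<circ> g = refl s \<circ> h"
      using less.hyps[of "refl s \<circ> g" "refl s \<circ> h"] len_refl_comp_down[OF s(1) less.prems(1) s(2)]
        less.prems comp_weyl refl_weyl s(1) by simp
    then show ?thesis using s(1) by (metis refl_comp_refl)
  qed
qed

lemma weak_le_antisym: "g \<in> weyl \<Longrightarrow> h \<in> weyl \<Longrightarrow> g \<preceq> h \<Longrightarrow> h \<preceq> g \<Longrightarrow> g = h"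
  using inversions_inject by blast

lemma len_mono: "h \<in> weyl \<Longrightarrow> g \<preceq> h \<Longrightarrow> len g \<le> len h"
  by (simp add: card_mono finite_inversions)

lemma weak_le_len_eq: "g \<in> weyl \<Longrightarrow> h \<in> weyl \<Longrightarrow> g \<preceq> h \<Longrightarrow> len h \<le> len g \<Longrightarrow> g = h"
  by (metis card_seteq finite_inversions inversions_inject)

text \<open>Inclusion of inversion sets is the prefix order: the factorization of \<open>h\<close>
  into \<open>g\<close> and \<open>ginv g \<circ> h\<close> has no cancellation. The converse is
  \<open>weak_le_comp\<close>.\<close>

lemma weak_le_disjoint:
  assumes "g \<in> weyl" "h \<in> weyl" "g \<preceq> h"
  shows "\<N> (ginv g) \<inter> \<N> (ginv g \<circ> h) = {}"
proof -
  have False if b: "b \<in> \<N> (ginv g)" "b \<in> \<N> (ginv g \<circ> h)" for b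
  proof -
    have bp: "b \<in> pos" "g b \<notin> pos" "ginv h (g b) \<notin> pos"
      using b assms ginv_weyl by (auto simp: inversions_def ginv_comp)
    have r: "b \<in> roots" "g b \<in> roots" "ginv h (g b) \<in> roots"
      using bp pos_roots weyl_roots assms ginv_weyl by blast+
    have "neg (g b) \<in> pos" using bp neg_pos_iff r by blast
    moreover have "ginv g (neg (g b)) = neg b" using assms weyl_lin_comb[OF ginv_weyl] by simp
    moreover have "neg b \<notin> pos" using neg_pos_iff r bp by blast
    ultimately have "neg (g b) \<in> \<N> h" using assms(3) by (auto simp: inversions_def)
    then have "neg (ginv h (g b)) \<notin> pos"
      using weyl_lin_comb[OF ginv_weyl] assms by (simp add: inversions_def)
    then show False using neg_pos_iff r bp by blast
  qed
  then show ?thesis by blast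
qed

lemma weak_le_comp: "g \<in> weyl \<Longrightarrow> h \<in> weyl \<Longrightarrow> \<N> (ginv g) \<inter> \<N> h = {} \<Longrightarrow> g \<preceq> g \<circ> h"
  using inversions_comp(1) by blast

lemma comp_ginv_comp [simp]: "g \<in> weyl \<Longrightarrow> g \<circ> (ginv g \<circ> h) = h" "g \<in> weyl \<Longrightarrow> ginv g \<circ> (g \<circ> h) = h"
  by (simp_all add: fun_eq_iff)

lemma simple_weak_le: "s \<in> S \<Longrightarrow> refl s \<preceq> g \<longleftrightarrow> \<alpha> s \<in> \<N> g"
  by (simp add: inversions_refl)

subsection \<open>Rank two\<close>

text \<open>For \<open>i < m s t\<close> these are the positive roots of the rank-two subsystem,
  listed from \<alpha> s at 0 towards \<alpha> t, which is reached at \<open>m s t - 1\<close> when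
  \<open>m s t\<close> is finite.\<close>

definition dihedral_root :: "'a \<Rightarrow> 'a \<Rightarrow> nat \<Rightarrow> 'a \<Rightarrow> real" where
  "dihedral_root s t i = lin_comb (dcoeff s t (Suc i)) (\<alpha> s) (dcoeff s t i) (\<alpha> t)"

lemma dihedral_root_act:
  "s \<in> S \<Longrightarrow> t \<in> S \<Longrightarrow> s \<noteq> t \<Longrightarrow>
    dihedral_root s t i = act (alt i s t) (\<alpha> (letter i s t))"
  by (simp add: dihedral_root_def act_alternating_word)

lemma dihedral_root_roots: "s \<in> S \<Longrightarrow> t \<in> S \<Longrightarrow> s \<noteq> t \<Longrightarrow> dihedral_root s t i \<in> roots"
  unfolding dihedral_root_act
  by (rule weyl_roots) (auto intro!: act_weyl alternating_word_lists simple_root_roots simp: letter_def)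

lemma dihedral_root_coeffs:
  assumes "s \<in> S" "t \<in> S" "s \<noteq> t" "enat (Suc i) \<le> m s t"
  shows "0 \<le> dcoeff s t (Suc i)" "0 \<le> dcoeff s t i"
  using dcoeff_nonneg[OF assms(1-3)] assms(4) Suc_ile_eq by (auto simp: order_less_imp_le)

lemma dihedral_root_pos:
  assumes "s \<in> S" "t \<in> S" "s \<noteq> t" "enat (Suc i) \<le> m s t" shows "dihedral_root s t i \<in> pos"
  using dihedral_root_coeffs[OF assms] dihedral_root_roots[OF assms(1-3)] assms simple_root_pos
  unfolding dihedral_root_def by (intro lin_comb_pos) auto

lemma dihedral_root_in_inversions:
  assumes "s \<in> S" "t \<in> S" "s \<noteq> t" "enat (Suc i) \<le> m s t" "g \<in> weyl"
    and "\<alpha> s \<in> \<N> g" "\<alpha> t \<in> \<N> g"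
  shows "dihedral_root s t i \<in> \<N> g"
  using dihedral_root_coeffs[OF assms(1-4)] dihedral_root_roots[OF assms(1-3)] assms inversions_cone
  unfolding dihedral_root_def by auto

lemma dihedral_root_notin_inversions:
  assumes "s \<in> S" "t \<in> S" "s \<noteq> t" "enat (Suc i) \<le> m s t" "g \<in> weyl"
    and "\<alpha> s \<notin> \<N> g" "\<alpha> t \<notin> \<N> g"
  shows "dihedral_root s t i \<notin> \<N> g"
  using dihedral_root_coeffs[OF assms(1-4)] dihedral_root_roots[OF assms(1-3)] assms inversions_cocone
    simple_root_pos unfolding dihedral_root_def by auto

lemma alternating_word_weyl: "s \<in> S \<Longrightarrow> t \<in> S \<Longrightarrow> act (alt k s t) \<in> weyl"
  by (simp add: act_weyl alternating_word_lists)

lemma inversions_alternating_word: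
  assumes "s \<in> S" "t \<in> S" "s \<noteq> t" "enat k \<le> m s t"
  shows "\<N> (act (alt k s t)) = dihedral_root s t ` {..<k}"
  using assms(4)
proof (induction k)
  case (Suc k)
  have 1: "letter k s t \<in> S" using assms by (simp add: letter_def)
  have "\<N> (act (alt k s t) \<circ> refl (letter k s t))
    = insert (dihedral_root s t k) (\<N> (act (alt k s t)))"
    using inversions_comp_refl(1)[OF 1 alternating_word_weyl[OF assms(1,2)], of k]
      dihedral_root_pos[OF assms(1-3) Suc.prems] dihedral_root_act[OF assms(1-3), of k] by simp
  moreover have "enat k \<le> m s t" using Suc.prems Suc_ile_eq order_less_imp_le by blast
  ultimately show ?case
    unfolding alternating_word_snoc using Suc.IH by (simp only: act_append act_Cons act_Nil comp_id lessThan_Suc image_insert)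
qed simp

text \<open>Without a braid relation there are infinitely many dihedral roots, and closedness would
  put all of them into the finite set \<N> g.\<close>

lemma m_finite_if_descents:
  assumes "s \<in> S" "t \<in> S" "s \<noteq> t" "g \<in> weyl"
    and "\<alpha> s \<in> \<N> g" "\<alpha> t \<in> \<N> g"
  obtains k where "m s t = enat k"
proof (cases "m s t")
  case infinity
  have "range (dihedral_root s t) \<subseteq> \<N> g"
    using dihedral_root_in_inversions[OF assms(1-3) _ assms(4-6)] infinity by auto
  moreover have "inj (dihedral_root s t)"
  proof (rule injI)
    fix i j assume "dihedral_root s t i = dihedral_root s t j"
    then have "dihedral_root s t i t = dihedral_root s t j t" by simp
    then show "i = j" using dcoeff_inf[OF assms(3) infinity] assms(3)
      by (simp add: dihedral_root_def lin_comb_def simple_root_def)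
  qed
  ultimately have False using finite_inversions[OF assms(4)] by (meson finite_imageD finite_subset infinite_UNIV_nat)
  then show ?thesis ..
qed (use that in blast)

lemma longest_alternating_word:
  assumes st: "s \<in> S" "t \<in> S" "s \<noteq> t" and k: "m s t = enat k"
  defines "d \<equiv> act (alt k s t)"
  shows "\<alpha> s \<in> \<N> d" "\<alpha> t \<in> \<N> d"
    and "g \<in> weyl \<Longrightarrow> \<alpha> s \<in> \<N> g \<Longrightarrow> \<alpha> t \<in> \<N> g \<Longrightarrow> d \<preceq> g"
    and "g \<in> weyl \<Longrightarrow> \<alpha> s \<notin> \<N> g \<Longrightarrow> \<alpha> t \<notin> \<N> g
      \<Longrightarrow> \<N> g \<inter> \<N> d = {}"
    and "ginv d = d"
proof -
  have k2: "2 \<le> k" using m_ge_2[OF st k] .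
  have d: "\<N> d = dihedral_root s t ` {..<k}"
    unfolding d_def using inversions_alternating_word[OF st] k by simp
  have "dihedral_root s t 0 = \<alpha> s" by (simp add: dihedral_root_def lin_comb_def)
  then show "\<alpha> s \<in> \<N> d" using k2 unfolding d by (intro image_eqI[of _ _ 0]) auto
  obtain n where n: "k = Suc n" using k2 by (cases k) auto
  have "dihedral_root s t n = \<alpha> t"
    using dcoeff_top[OF st k] dcoeff_before_top[OF st k n] n
    by (simp add: dihedral_root_def lin_comb_def)
  then show "\<alpha> t \<in> \<N> d" using n unfolding d by (intro image_eqI[of _ _ n]) auto
  show "d \<preceq> g" if "g \<in> weyl" "\<alpha> s \<in> \<N> g" "\<alpha> t \<in> \<N> g" for g
    unfolding d using dihedral_root_in_inversions[OF st _ that] k by auto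
  show "\<N> g \<inter> \<N> d = {}"
    if "g \<in> weyl" "\<alpha> s \<notin> \<N> g" "\<alpha> t \<notin> \<N> g" for g
    unfolding d using dihedral_root_notin_inversions[OF st _ that] k by auto
  show "ginv d = d" unfolding d_def
    using act_braid[OF st k] alternating_word_lists[OF st(1,2)] alternating_word_lists[OF st(2,1)] by (simp add: ginv_act rev_alternating_word)
qed

subsection \<open>Joins and meets in the weak order\<close>

text \<open>The last clause amounts to saying that the cone type of the join is the intersection of
  the two cone types. It carries the induction in \<open>is_join_refl_comp\<close> and is used again
  for \<open>cone_type_residue\<close> and for the existence of \<open>proj\<close>.\<close>

definition is_join where
  "is_join z z' j \<longleftrightarrow> j \<in> weyl \<and> z \<preceq> j \<and> z' \<preceq> j
    \<and> (\<forall>y\<in>weyl. z \<preceq> y \<longrightarrow> z' \<preceq> y \<longrightarrow> j \<preceq> y)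
    \<and> (\<forall>x\<in>weyl. \<N> x \<inter> \<N> z = {} \<longrightarrow> \<N> x \<inter> \<N> z' = {}
        \<longrightarrow> \<N> x \<inter> \<N> j = {})"

lemma is_joinD:
  assumes "is_join z z' j"
  shows "j \<in> weyl" "z \<preceq> j" "z' \<preceq> j" "\<And>y. y \<in> weyl \<Longrightarrow> z \<preceq> y \<Longrightarrow> z' \<preceq> y \<Longrightarrow> j \<preceq> y"
    "\<And>x. x \<in> weyl \<Longrightarrow> \<N> x \<inter> \<N> z = {} \<Longrightarrow> \<N> x \<inter> \<N> z' = {}
        \<Longrightarrow> \<N> x \<inter> \<N> j = {}"
  using assms unfolding is_join_def by blast+

lemma is_join_refl_comp:
  assumes s: "s \<in> S" and z: "z \<in> weyl" "\<alpha> s \<in> \<N> z"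
    and z': "z' \<in> weyl" "\<alpha> s \<in> \<N> z'"
    and j: "is_join (refl s \<circ> z) (refl s \<circ> z') j"
  shows "is_join z z' (refl s \<circ> j)"
proof -
  note jD = is_joinD[OF j]
  have sj: "\<alpha> s \<notin> \<N> j"
    using jD(5)[OF refl_weyl[OF s]] simple_inversion_refl_comp[OF s z(1)]
      simple_inversion_refl_comp[OF s z'(1)] z z' s by (simp add: inversions_refl)
  then have sj': "\<alpha> s \<in> \<N> (refl s \<circ> j)" using simple_inversion_refl_comp s jD(1) by blast
  have w: "refl s \<circ> x \<in> weyl" if "x \<in> weyl" for x using comp_weyl refl_weyl s that by blast
  have le: "x \<preceq> refl s \<circ> j \<longleftrightarrow> refl s \<circ> x \<preceq> j" if "x \<in> weyl" "\<alpha> s \<in> \<N> x" for x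
    using weak_le_down_iff[OF s that(1) w[OF jD(1)] that(2) sj'] s by simp
  have 1: "refl s \<circ> j \<preceq> y" if y: "y \<in> weyl" "z \<preceq> y" "z' \<preceq> y" for y
  proof -
    have sy: "\<alpha> s \<in> \<N> y" using y z by blast
    have "refl s \<circ> z \<preceq> refl s \<circ> y" "refl s \<circ> z' \<preceq> refl s \<circ> y"
      using weak_le_down_iff s z z' y sy by blast+
    then have "j \<preceq> refl s \<circ> y" using jD(4) w y by blast
    then show ?thesis using weak_le_down_iff[OF s w[OF jD(1)] y(1) sj' sy] s by simp
  qed
  have 2: "\<N> x \<inter> \<N> (refl s \<circ> j) = {}"
    if x: "x \<in> weyl" "\<N> x \<inter> \<N> z = {}" "\<N> x \<inter> \<N> z' = {}" for x
  proof -
    have sx: "\<alpha> s \<notin> \<N> x" using x z by blast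
    have key: "\<N> (refl s \<circ> x) \<inter> \<N> y = {} \<longleftrightarrow> \<N> x \<inter> \<N> (refl s \<circ> y) = {}"
      if "y \<in> weyl" "\<alpha> s \<notin> \<N> y" for y
      using inversions_refl_comp[OF s x(1) sx] inversions_refl_comp[OF s that] that sx
        refl_image_disjoint_iff[OF s, of "\<N> x" "\<N> y"] by auto
    have "\<N> (refl s \<circ> x) \<inter> \<N> (refl s \<circ> z) = {}"
      "\<N> (refl s \<circ> x) \<inter> \<N> (refl s \<circ> z') = {}"
      using key[OF w[OF z(1)]] key[OF w[OF z'(1)]] simple_inversion_refl_comp s z z' x by simp_all
    then have "\<N> (refl s \<circ> x) \<inter> \<N> j = {}" using jD(5) w x by blast
    then show ?thesis using key jD(1) sj by blast
  qed
  show ?thesis unfolding is_join_def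
    using 1 2 w[OF jD(1)] le[OF z] le[OF z'] jD(2,3) by blast
qed

text \<open>Induction on the length of the upper bound \<open>y\<close>. A common first letter is
  stripped from both elements and from \<open>y\<close>. If the first letters \<open>r\<close> and
  \<open>t\<close> differ, the longest element \<open>d\<close> of their dihedral group lies below
  \<open>y\<close>; it shares \<open>r\<close> with \<open>z\<close> and \<open>t\<close> with
  \<open>z'\<close>, and the joins \<open>p\<close> and \<open>q\<close> with \<open>d\<close> share
  \<open>r\<close> again.\<close>

lemma join_exists:
  "y \<in> weyl \<Longrightarrow> z \<in> weyl \<Longrightarrow> z' \<in> weyl \<Longrightarrow> z \<preceq> y \<Longrightarrow> z' \<preceq> y \<Longrightarrow> \<exists>j. is_join z z' j"
proof (induction "len y" arbitrary: y z z' rule: less_induct)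
  case less
  have common: "\<exists>j. is_join a b j"
    if "s \<in> S" "a \<in> weyl" "b \<in> weyl" "a \<preceq> y" "b \<preceq> y" "\<alpha> s \<in> \<N> a" "\<alpha> s \<in> \<N> b"
    for s a b
  proof -
    have sy: "\<alpha> s \<in> \<N> y" using that by blast
    have w: "refl s \<circ> x \<in> weyl" if "x \<in> weyl" for x using comp_weyl refl_weyl \<open>s \<in> S\<close> that by blast
    have "\<exists>j. is_join (refl s \<circ> a) (refl s \<circ> b) j"
      by (rule less.hyps[of "refl s \<circ> y"])
        (use that sy less.prems(1) w weak_le_down_iff len_refl_comp_down in auto)
    then show ?thesis using is_join_refl_comp that by blast
  qed
  show ?case
  proof (cases "z = id \<or> z' = id")
    case True
    then show ?thesis using less.prems by (auto simp: is_join_def)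
  next
    case False
    obtain r where r: "r \<in> S" "\<alpha> r \<in> \<N> z" using exists_simple_inversion less.prems False by blast
    obtain t where t: "t \<in> S" "\<alpha> t \<in> \<N> z'" using exists_simple_inversion less.prems False by blast
    show ?thesis
    proof (cases "r = t")
      case True
      then show ?thesis using common[OF r(1) less.prems(2-5)] r t by simp
    next
      case rt: False
      have "\<alpha> r \<in> \<N> y" "\<alpha> t \<in> \<N> y" using r t less.prems by blast+
      then obtain k where k: "m r t = enat k" using m_finite_if_descents[OF r(1) t(1) rt less.prems(1)] by blast
      define d where "d = act (alt k r t)"
      have d: "d \<in> weyl" using alternating_word_weyl r t by (simp add: d_def)
      note dD = longest_alternating_word[OF r(1) t(1) rt k, folded d_def]
      have dy: "d \<preceq> y" using dD(3) r t less.prems by blast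
      obtain p where p: "is_join z d p" using common[OF r(1) less.prems(2) d less.prems(4) dy r(2) dD(1)] by blast
      obtain q where q: "is_join z' d q" using common[OF t(1) less.prems(3) d less.prems(5) dy t(2) dD(2)] by blast
      note pD = is_joinD[OF p] and qD = is_joinD[OF q]
      have "p \<preceq> y" "q \<preceq> y" using pD(4) qD(4) less.prems dy by blast+
      moreover have "\<alpha> r \<in> \<N> p" "\<alpha> r \<in> \<N> q" using dD(1) pD(3) qD(3) by blast+
      ultimately obtain j where j: "is_join p q j" using common[OF r(1) pD(1) qD(1)] by blast
      note jD = is_joinD[OF j]
      have "j \<preceq> y'" if "y' \<in> weyl" "z \<preceq> y'" "z' \<preceq> y'" for y'
      proof -
        have "d \<preceq> y'" using dD(3) r t that by blast
        then show ?thesis using jD(4) pD(4) qD(4) that by blast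
      qed
      moreover have "\<N> x \<inter> \<N> j = {}"
        if "x \<in> weyl" "\<N> x \<inter> \<N> z = {}" "\<N> x \<inter> \<N> z' = {}" for x
      proof -
        have "\<N> x \<inter> \<N> d = {}" using dD(4) r t that by blast
        then show ?thesis using jD(5) pD(5) qD(5) that by blast
      qed
      ultimately have "is_join z z' j"
        unfolding is_join_def using jD(1-3) pD(2) qD(2) by blast
      then show ?thesis by blast
    qed
  qed
qed

text \<open>A longest member of \<open>P\<close> is the greatest one: its join with any other member
  exists below \<open>y\<close>, belongs to \<open>P\<close> and cannot be longer. This yields
  meets, projections and greatest gates.\<close>

lemma max_exists:
  assumes "y \<in> weyl" and P: "P id"
    and bounded: "\<And>z. P z \<Longrightarrow> z \<in> weyl \<and> z \<preceq> y"
    and join: "\<And>z z' j. P z \<Longrightarrow> P z' \<Longrightarrow> is_join z z' j \<Longrightarrow> P j"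
  shows "\<exists>z. P z \<and> (\<forall>z'. P z' \<longrightarrow> z' \<preceq> z)"
proof -
  have "\<forall>z. P z \<longrightarrow> len z < Suc (len y)"
    using bounded len_mono[OF assms(1)] by (simp add: less_Suc_eq_le)
  from arg_max_nat_lemma[where f=len, OF P this] obtain z
    where z: "P z" "\<And>z'. P z' \<Longrightarrow> len z' \<le> len z" by blast
  have "z' \<preceq> z" if z': "P z'" for z'
  proof -
    note b = bounded[OF z(1)] bounded[OF z']
    obtain j where j: "is_join z z' j"
      using join_exists[OF assms(1), of z z'] b by (elim conjE) blast
    have "len j \<le> len z" by (rule z(2)) (rule join[OF z(1) z' j])
    then have "z = j" using weak_le_len_eq[of z j] is_joinD(1,2)[OF j] b by (elim conjE) simp
    then show ?thesis using is_joinD(3)[OF j] by simp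
  qed
  then show ?thesis using z(1) by blast
qed

lemma meet_exists:
  assumes "x \<in> weyl" "y \<in> weyl"
  obtains z where "z \<in> weyl" "z \<preceq> x" "z \<preceq> y" "\<And>j. j \<in> weyl \<Longrightarrow> j \<preceq> x \<Longrightarrow> j \<preceq> y \<Longrightarrow> j \<preceq> z"
proof -
  have "\<exists>z. (z \<in> weyl \<and> z \<preceq> x \<and> z \<preceq> y) \<and> (\<forall>z'. z' \<in> weyl \<and> z' \<preceq> x \<and> z' \<preceq> y \<longrightarrow> z' \<preceq> z)"
  proof (rule max_exists[OF assms(1)])
    show "j \<in> weyl \<and> j \<preceq> x \<and> j \<preceq> y"
      if "z \<in> weyl \<and> z \<preceq> x \<and> z \<preceq> y" "z' \<in> weyl \<and> z' \<preceq> x \<and> z' \<preceq> y" "is_join z z' j" for z z' j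
      using is_joinD(1)[OF that(3)] is_joinD(4)[OF that(3) assms(1)] is_joinD(4)[OF that(3) assms(2)] that(1,2)
      by blast
  qed simp_all
  then show ?thesis using that by blast
qed

text \<open>For \<open>b\<close> in \<N> g the sign of \<open>form b (\<alpha> t)\<close> decides.
  If it is at most 0, \<open>refl t b\<close> is \<open>b\<close> plus a multiple of \<alpha> t, and
  \<N> y is closed. Otherwise \<open>b\<close> is \<open>refl t b\<close> plus a multiple of
  \<alpha> t, and the complement of \<N> g is closed, so \<open>refl t b\<close> was already in \<N>
  g.\<close>

lemma refl_comp_weak_le:
  assumes t: "t \<in> S" and g: "g \<in> weyl" "\<alpha> t \<notin> \<N> g"
    and y: "y \<in> weyl" "\<alpha> t \<in> \<N> y" "g \<preceq> y"
  shows "refl t \<circ> g \<preceq> y"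
proof -
  have "refl t b \<in> \<N> y" if b: "b \<in> \<N> g" for b
  proof (cases "form b (\<alpha> t) \<le> 0")
    have bp: "b \<in> pos" using b inversions_pos by blast
    have ne: "b \<noteq> \<alpha> t" using b g by blast
    have k: "refl t b \<in> pos" using refl_pos[OF bp t ne] .
    {
      case True
      then show ?thesis unfolding reflection_def
        using inversions_cone[OF y(1), of 1 "-2 * form b (\<alpha> t)" b "\<alpha> t"] y b
          pos_roots[OF k] by (auto simp: reflection_def)
    next
      case False
      show ?thesis
      proof (rule ccontr)
        assume "refl t b \<notin> \<N> y"
        then have "refl t b \<notin> \<N> g" using y by blast
        moreover have "b = lin_comb 1 (refl t b) (2 * form b (\<alpha> t)) (\<alpha> t)"
          by (simp add: reflection_def lin_comb_def)
        moreover have "b \<in> roots" using bp pos_roots by blast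
        ultimately have "b \<notin> \<N> g"
          using inversions_cocone[OF g(1), of 1 "2 * form b (\<alpha> t)" "refl t b" "\<alpha> t"]
            k simple_root_pos[OF t] g(2) False by simp
        then show False using b by blast
      qed
    }
  qed
  then show ?thesis using inversions_refl_comp[OF t g] y by auto
qed

section \<open>Cone types and gates\<close>

text \<open>\<open>v\<close> qualifies when \<open>ginv x \<circ> v\<close> has no cancellation, so
  this is the usual cone type of \<open>ginv x\<close>. The inverse makes cone types shrink as
  \<open>x\<close> grows in the prefix order.\<close>

definition cone_type :: "('a vec \<Rightarrow> 'a vec) \<Rightarrow> ('a vec \<Rightarrow> 'a vec) set" where
  "cone_type x = {v \<in> weyl. \<N> v \<inter> \<N> x = {}}"

lemma cone_type_antimono: "x \<preceq> y \<Longrightarrow> cone_type y \<subseteq> cone_type x"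
  by (auto simp: cone_type_def)

text \<open>The right-hand side involves \<open>y\<close> only through its cone type: this is the
  transition function of the automaton of reduced words.\<close>

lemma cone_type_refl_comp:
  assumes s: "s \<in> S" and y: "y \<in> weyl" "\<alpha> s \<notin> \<N> y"
  shows "cone_type (refl s \<circ> y) = {v \<in> weyl. \<alpha> s \<notin> \<N> v \<and> refl s \<circ> v \<in> cone_type y}"
proof -
  have "\<N> v \<inter> \<N> (refl s \<circ> y) = {} \<longleftrightarrow>
      \<alpha> s \<notin> \<N> v \<and> refl s \<circ> v \<in> cone_type y" if v: "v \<in> weyl" for v
  proof (cases "\<alpha> s \<in> \<N> v")
    case True
    then show ?thesis using inversions_refl_comp(1)[OF s y] by blast
  next
    case False
    show ?thesis
      unfolding cone_type_def mem_Collect_eq inversions_refl_comp(1)[OF s y]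
        inversions_refl_comp(1)[OF s v False]
      using False y(2) refl_image_disjoint_iff[OF s, of "\<N> v" "\<N> y"]
        comp_weyl[OF refl_weyl[OF s] v] by auto
  qed
  then show ?thesis unfolding cone_type_def[of "refl s \<circ> y"] by blast
qed

lemma obtain_last_step:
  assumes "v \<in> weyl" "v \<noteq> id"
  obtains v' r where "v' \<in> weyl" "r \<in> S" "v = v' \<circ> refl r" "v' (\<alpha> r) \<in> pos"
    "\<N> v = insert (v' (\<alpha> r)) (\<N> v')" "len v = Suc (len v')"
proof -
  have "ginv v \<noteq> id" using assms by (metis ginv_ginv ginv_id)
  then obtain r where r: "r \<in> S" "\<alpha> r \<in> \<N> (ginv v)"
    using exists_simple_inversion[OF ginv_weyl[OF assms(1)]] by blast
  define v' where "v' = v \<circ> refl r"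
  have v': "v' \<in> weyl" using comp_weyl refl_weyl r assms by (simp add: v'_def)
  have v: "v = v' \<circ> refl r" using r by (simp add: v'_def)
  have "v (\<alpha> r) \<notin> pos" using simple_inversion_ginv r assms by blast
  then have "neg (v (\<alpha> r)) \<in> pos"
    using neg_pos_iff weyl_roots[OF assms(1) simple_root_roots[OF r(1)]] by blast
  then have p: "v' (\<alpha> r) \<in> pos"
    using assms r by (simp add: v'_def reflection_self weyl_lin_comb)
  have i: "\<N> v = insert (v' (\<alpha> r)) (\<N> v')" "v' (\<alpha> r) \<notin> \<N> v'"
    using inversions_comp_refl[OF r(1) v' p] unfolding v[symmetric] by auto
  have "len v = Suc (len v')" using i finite_inversions[OF v'] by simp
  then show ?thesis using that v' r v p i by blast
qed

text \<open>For a shortest \<open>v = v' \<circ> refl r\<close> in the cone type of \<open>z\<close> but not of \<open>x\<close>, the join of \<open>refl r\<close> and \<open>v'\<inverse>\<close>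
  lies below \<open>v'\<inverse> x\<close> and \<open>v'\<inverse> y\<close>. Multiplied by \<open>v'\<close>, it lies below \<open>z\<close> and contradicts the choice of \<open>v\<close>.\<close>

lemma cone_type_meet:
  assumes x: "x \<in> weyl" and y: "y \<in> weyl" and eq: "cone_type x = cone_type y"
    and z: "z \<in> weyl" "z \<preceq> x" "z \<preceq> y" "\<And>j. j \<in> weyl \<Longrightarrow> j \<preceq> x \<Longrightarrow> j \<preceq> y \<Longrightarrow> j \<preceq> z"
  shows "cone_type z = cone_type x"
proof (rule ccontr)
  assume "cone_type z \<noteq> cone_type x"
  then have "\<exists>v. v \<in> cone_type z - cone_type x" using cone_type_antimono[OF z(2)] by blast
  from exists_least_iff[THEN iffD1, of "\<lambda>n. \<exists>v. v \<in> cone_type z - cone_type x \<and> len v = n"] this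
  obtain v where v: "v \<in> cone_type z" "v \<notin> cone_type x"
    and least: "\<And>u. len u < len v \<Longrightarrow> u \<in> cone_type z \<Longrightarrow> u \<in> cone_type x" by blast
  have vW: "v \<in> weyl" using v by (simp add: cone_type_def)
  have "v \<noteq> id" using v x by (auto simp: cone_type_def)
  obtain v' r where v': "v' \<in> weyl" "r \<in> S" "v = v' \<circ> refl r" "v' (\<alpha> r) \<in> pos"
    "\<N> v = insert (v' (\<alpha> r)) (\<N> v')" "len v = Suc (len v')"
    by (rule obtain_last_step[OF vW \<open>v \<noteq> id\<close>])
  \<comment> \<open>\<N> v exceeds \<N> v' by this root alone, so the failure of \<open>v\<close>
    for \<open>x\<close> and for \<open>y\<close> puts it into both \<N> x and \<N> y.\<close>
  define b where "b = v' (\<alpha> r)"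
  have "v' \<in> cone_type z" using v(1) v' by (auto simp: cone_type_def)
  then have v'x: "v' \<in> cone_type x" using least v'(6) by simp
  then have v'y: "v' \<in> cone_type y" using eq by simp
  have bx: "b \<in> \<N> x" using v(2) v'x v' vW by (auto simp: cone_type_def b_def)
  have "v \<notin> cone_type y" using v(2) eq by simp
  then have by': "b \<in> \<N> y" using v'y v' vW by (auto simp: cone_type_def b_def)
  have iW: "ginv v' \<in> weyl" by (rule ginv_weyl[OF v'(1)])
  have r_notin: "\<alpha> r \<notin> \<N> (ginv v')" using simple_inversion_ginv v' by simp
  have comp: "\<N> (ginv v' \<circ> u) = \<N> (ginv v') \<union> ginv v' ` \<N> u
      \<and> \<N> (ginv v') \<inter> ginv v' ` \<N> u = {}"
    if "u \<in> weyl" "\<N> v' \<inter> \<N> u = {}" for u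
    using inversions_comp[OF iW that(1)] that(2) v'(1) by simp
  have up: "\<alpha> r \<in> \<N> (ginv v' \<circ> u) \<and> ginv v' \<preceq> ginv v' \<circ> u"
    if "u \<in> weyl" "v' \<in> cone_type u" "b \<in> \<N> u" for u
  proof -
    have "ginv v' b = \<alpha> r" using v'(1) by (simp add: b_def)
    moreover have "\<N> v' \<inter> \<N> u = {}" using that by (simp add: cone_type_def)
    ultimately show ?thesis using comp[OF that(1)] that(3) by (metis UnCI Un_upper1 imageI)
  qed
  note ux = up[OF x v'x bx] and uy = up[OF y v'y by']
  obtain J where J: "is_join (refl r) (ginv v') J"
    using join_exists[OF comp_weyl[OF iW x] refl_weyl[OF v'(2)] iW] ux simple_weak_le[OF v'(2)] by blast
  note JD = is_joinD[OF J]
  define j where "j = v' \<circ> J"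
  have j: "j \<in> weyl" using comp_weyl v' JD by (simp add: j_def)
  have Jj: "J = ginv v' \<circ> j" using v' by (simp add: j_def)
  have "\<N> (ginv (ginv v')) \<inter> \<N> (ginv (ginv v') \<circ> J) = {}"
    by (rule weak_le_disjoint[OF iW JD(1,3)])
  then have "\<N> v' \<inter> \<N> j = {}" using v'(1) by (simp add: j_def)
  note Jc = comp[OF j this, folded Jj]
  have below: "j \<preceq> u" if u: "u \<in> weyl" "v' \<in> cone_type u"
    "\<alpha> r \<in> \<N> (ginv v' \<circ> u) \<and> ginv v' \<preceq> ginv v' \<circ> u" for u
  proof
    fix c assume c: "c \<in> \<N> j"
    have "J \<preceq> ginv v' \<circ> u"
      using JD(4)[OF comp_weyl[OF iW u(1)]] u(3) simple_weak_le[OF v'(2)] by blast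
    then have "ginv v' c \<in> \<N> (ginv v' \<circ> u) - \<N> (ginv v')" using Jc c by blast
    moreover have "\<N> v' \<inter> \<N> u = {}" using u by (simp add: cone_type_def)
    ultimately have "ginv v' c \<in> ginv v' ` \<N> u" using comp[OF u(1)] by blast
    then show "c \<in> \<N> u" using weyl_inject[OF iW] by auto
  qed
  have "j \<preceq> z" using z(4)[OF j below[OF x v'x ux] below[OF y v'y uy]] .
  moreover have "b \<in> \<N> j"
  proof -
    have "\<alpha> r \<in> \<N> J" using JD(2) simple_weak_le[OF v'(2)] by blast
    then obtain c where "c \<in> \<N> j" "\<alpha> r = ginv v' c" using Jc r_notin by blast
    then show ?thesis using v'(1) by (simp add: b_def)
  qed
  moreover have "b \<notin> \<N> z" using v(1) v'(5) by (auto simp: cone_type_def b_def)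
  ultimately show False by blast
qed

section \<open>Gates and their closure properties\<close>

definition gate :: "('a vec \<Rightarrow> 'a vec) \<Rightarrow> bool" where
  "gate w \<longleftrightarrow> w \<in> weyl \<and> (\<forall>y\<in>weyl. y \<preceq> w \<longrightarrow> cone_type y = cone_type w \<longrightarrow> y = w)"

lemma gate_weyl: "gate w \<Longrightarrow> w \<in> weyl"
  by (simp add: gate_def)

lemma gate_id: "gate id"
  by (simp add: gate_def inversions_empty_iff)

lemma gate_refl:
  assumes s: "s \<in> S" shows "gate (refl s)"
  unfolding gate_def
proof (intro conjI ballI impI refl_weyl s)
  fix y assume y: "y \<in> weyl" "y \<preceq> refl s" "cone_type y = cone_type (refl s)"
  have "refl s \<notin> cone_type y" unfolding y(3) by (simp add: cone_type_def inversions_refl s)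
  then have "\<alpha> s \<in> \<N> y"
    using refl_weyl[OF s] by (auto simp: cone_type_def inversions_refl s)
  then have "\<N> y = \<N> (refl s)" using y(2) s by (auto simp: inversions_refl)
  then show "y = refl s" using inversions_inject y(1) refl_weyl[OF s] by blast
qed

text \<open>By \<open>cone_type_refl_comp\<close>, an element below \<open>u\<close> with the cone
  type of \<open>u\<close> remains such a competitor after \<open>s\<close> is put in front of both,
  where minimality is known.\<close>

lemma gate_suffix:
  assumes s: "s \<in> S" and u: "u \<in> weyl" "\<alpha> s \<notin> \<N> u" and g: "gate (refl s \<circ> u)"
  shows "gate u"
  unfolding gate_def
proof (intro conjI ballI impI u(1))
  fix y assume y: "y \<in> weyl" "y \<preceq> u" "cone_type y = cone_type u"
  have sy: "\<alpha> s \<notin> \<N> y" using y u by blast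
  have "cone_type (refl s \<circ> y) = cone_type (refl s \<circ> u)"
    unfolding cone_type_refl_comp[OF s y(1) sy] cone_type_refl_comp[OF s u] y(3) ..
  moreover have "refl s \<circ> y \<preceq> refl s \<circ> u" using weak_le_refl_comp_iff[OF s y(1) u(1) sy u(2)] y(2) by blast
  ultimately have "refl s \<circ> y = refl s \<circ> u"
    using g comp_weyl[OF refl_weyl[OF s] y(1)] unfolding gate_def by blast
  then show "y = u" using refl_comp_refl[OF s] by metis
qed

text \<open>By \<open>cone_type_meet\<close> the meet of two gates with one cone type has that cone
  type too, and minimality makes both gates equal to it.\<close>

lemma inj_on_cone_type_gate: "inj_on cone_type (Collect gate)"
proof (rule inj_onI)
  fix w w' assume "w \<in> Collect gate" "w' \<in> Collect gate" and eq: "cone_type w = cone_type w'"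
  then have g: "gate w" "gate w'" by auto
  obtain z where z: "z \<in> weyl" "z \<preceq> w" "z \<preceq> w'" "\<And>j. j \<in> weyl \<Longrightarrow> j \<preceq> w \<Longrightarrow> j \<preceq> w' \<Longrightarrow> j \<preceq> z"
    using meet_exists[OF gate_weyl[OF g(1)] gate_weyl[OF g(2)]] by blast
  have "cone_type z = cone_type w"
    by (rule cone_type_meet[OF gate_weyl[OF g(1)] gate_weyl[OF g(2)] eq z])
  then have "z = w" "z = w'" using g z eq unfolding gate_def by auto
  then show "w = w'" by simp
qed

text \<open>Positivity of the two images says that \<open>g\<close> is shortest in its coset of the
  dihedral subgroup, so no cancellation occurs.\<close>

lemma dihedral_coset_inversions:
  assumes st: "s \<in> S" "t \<in> S" "s \<noteq> t" "enat i \<le> m s t"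
    and g: "g \<in> weyl" "g (\<alpha> s) \<in> pos" "g (\<alpha> t) \<in> pos"
  shows "\<N> (g \<circ> act (alt i s t)) = \<N> g \<union> g ` \<N> (act (alt i s t))"
proof (rule inversions_comp(1)[OF g(1) alternating_word_weyl[OF st(1,2)]])
  have "\<alpha> s \<notin> \<N> (ginv g)" "\<alpha> t \<notin> \<N> (ginv g)"
    using simple_inversion_ginv st g by auto
  then have "dihedral_root s t k \<notin> \<N> (ginv g)" if "k < i" for k
    using dihedral_root_notin_inversions[OF st(1-3) _ ginv_weyl[OF g(1)], of k] that st(4)
    by (meson Suc_leI enat_ord_simps(1) order_trans)
  then show "\<N> (ginv g) \<inter> \<N> (act (alt i s t)) = {}"
    using inversions_alternating_word[OF st] by auto
qed

text \<open>Counterpart for cone types of the bipodality of small roots: a wall through the residue of \<open>g\<close>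
  that is relevant for the cone type at any intermediate level stays relevant at the top.\<close>

lemma cone_type_residue:
  assumes st: "s \<in> S" "t \<in> S" "s \<noteq> t" and k: "m s t = enat k"
    and g: "g \<in> weyl" "g (\<alpha> s) \<in> pos" "g (\<alpha> t) \<in> pos"
    and top: "cone_type (g \<circ> act (alt (k - 1) t s)) = cone_type (g \<circ> act (alt k s t))"
    and i: "Suc i < k"
  shows "cone_type (g \<circ> act (alt (Suc i) s t)) = cone_type (g \<circ> act (alt i s t))"
proof (rule ccontr)
  note W = alternating_word_weyl
  define h where "h = ginv g"
  have h: "h \<in> weyl" using ginv_weyl g by (simp add: h_def)
  have gh: "ginv h = g" using g by (simp add: h_def)
  have sh: "\<alpha> s \<notin> \<N> h" "\<alpha> t \<notin> \<N> h"
    using simple_inversion_ginv st g by (auto simp: h_def)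
  have ik: "enat (Suc i) \<le> m s t" "enat i \<le> m s t" using i k by auto
  note inv_Suc = dihedral_coset_inversions[OF st ik(1) g] and inv_i = dihedral_coset_inversions[OF st ik(2) g]
  assume "cone_type (g \<circ> act (alt (Suc i) s t)) \<noteq> cone_type (g \<circ> act (alt i s t))"
  moreover have "g \<circ> act (alt i s t) \<preceq> g \<circ> act (alt (Suc i) s t)"
    unfolding inv_Suc inv_i inversions_alternating_word[OF st ik(1)] inversions_alternating_word[OF st ik(2)]
    by auto
  \<comment> \<open>\<open>v\<close> separates the two cone types, so it inverts
    \<open>g (dihedral_root s t i)\<close>, the only root by which the two inversion sets
    differ.\<close>
  ultimately obtain v where v: "v \<in> weyl" "\<N> v \<inter> \<N> (g \<circ> act (alt i s t)) = {}"
    "\<N> v \<inter> \<N> (g \<circ> act (alt (Suc i) s t)) \<noteq> {}"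
    using cone_type_antimono by (auto simp: cone_type_def)
  have vg: "\<N> v \<inter> \<N> g = {}" using v(2) inv_i by blast
  have vi: "g (dihedral_root s t i) \<in> \<N> v"
    using v(2,3) unfolding inv_Suc inv_i inversions_alternating_word[OF st ik(1)]
      inversions_alternating_word[OF st ik(2)] lessThan_Suc by auto
  have v0: "g (\<alpha> s) \<notin> \<N> v" if "i \<noteq> 0"
  proof -
    have "dihedral_root s t 0 = \<alpha> s" by (simp add: dihedral_root_def lin_comb_def)
    then have "\<alpha> s \<in> \<N> (act (alt i s t))"
      unfolding inversions_alternating_word[OF st ik(2)] using that by force
    then show ?thesis using v(2) inv_i by blast
  qed
  \<comment> \<open>Multiplication by \<open>h = ginv g\<close> moves the coset of \<open>g\<close>
    to the dihedral subgroup itself; \<open>a\<close> lies above \<open>h\<close>.\<close>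
  define a where "a = h \<circ> v"
  have a: "a \<in> weyl" using comp_weyl h v by (simp add: a_def)
  have inv_a: "\<N> a = \<N> h \<union> h ` \<N> v"
    unfolding a_def by (rule inversions_comp(1)[OF h v(1)]) (use vg gh in auto)
  have mem: "x \<in> \<N> a \<longleftrightarrow> x \<in> \<N> h \<or> g x \<in> \<N> v" for x
    unfolding inv_a using g by (auto simp: h_def image_iff) (metis ginv_apply)
  have ai: "dihedral_root s t i \<in> \<N> a" using mem vi by simp
  \<comment> \<open>A common upper bound of \<open>refl s\<close> and \<open>h\<close> is needed for
    their join: \<open>a\<close> serves when \<open>i = 0\<close>, and
    \<open>refl t \<circ> a\<close> otherwise.\<close>
  have "\<exists>y\<in>weyl. \<alpha> s \<in> \<N> y \<and> h \<preceq> y"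
  proof (cases "i = 0")
    case True
    then have "dihedral_root s t i = \<alpha> s" by (simp add: dihedral_root_def lin_comb_def)
    then show ?thesis using ai a inv_a by auto
  next
    case False
    have sa: "\<alpha> s \<notin> \<N> a" using mem sh v0[OF False] by simp
    have ta: "\<alpha> t \<in> \<N> a"
      using dihedral_root_notin_inversions[OF st ik(1) a sa] ai by blast
    define y where "y = refl t \<circ> a"
    have y: "y \<in> weyl" using comp_weyl refl_weyl st a by (simp add: y_def)
    have inv_a': "\<N> a = insert (\<alpha> t) (refl t ` \<N> y)"
      using inversions_refl_comp_down(1)[OF st(2) a ta] by (simp add: y_def)
    have "refl t \<circ> h \<preceq> a" using refl_comp_weak_le[OF st(2) h sh(2) a ta] inv_a by blast
    then have "h \<preceq> y"
      unfolding inv_a' inversions_refl_comp(1)[OF st(2) h sh(2)]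
      using inversions_refl_comp(2)[OF st(2) h sh(2)] refl_image_subset_iff[OF st(2)] by (simp add: subset_insert)
    moreover have "refl t (\<alpha> s) \<in> \<N> a"
    proof -
      \<comment> \<open>By the recurrence for \<open>d\<close>, \<open>refl t (\<alpha> s)\<close>
        is \<open>1/c\<close> times the root with index \<open>i\<close> plus \<open>d/c\<close>
        times \<alpha> t. The bound \<open>Suc i < k\<close> makes \<open>c\<close> positive and
        \<open>d\<close> nonnegative.\<close>
      define c d where "c = dcoeff s t (Suc i)" and "d = dcoeff s t (Suc (Suc i))"
      have c: "0 < c" using dcoeff_pos[OF st k, of "Suc i"] i by (simp add: c_def)
      have d: "0 \<le> d" using dcoeff_nonneg[OF st, of "Suc (Suc i)"] i k by (simp add: d_def)
      have "d = - 2 * gram s t * c - dcoeff s t i" by (simp add: c_def d_def)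
      then have "refl t (\<alpha> s) = lin_comb (1/c) (dihedral_root s t i) (d/c) (\<alpha> t)"
        using c by (simp add: reflection_def form_simple_simple st dihedral_root_def c_def[symmetric])
          (auto simp: lin_comb_def field_simps)
      moreover have "refl t (\<alpha> s) \<in> roots" using weyl_roots refl_weyl simple_root_roots st by blast
      ultimately show ?thesis using inversions_cone[OF a, of "1/c" "d/c"] c d ai ta by simp
    qed
    then have "\<alpha> s \<in> \<N> y"
      using simple_inversion_refl_comp[OF st(2) a] ta st unfolding inv_a'
      by (auto simp: weyl_inject[OF refl_weyl]) (metis reflection_self form_simple_self neg_pos_iff simple_root_pos simple_root_roots refl_refl)
    ultimately show ?thesis using y by blast
  qed
  then obtain y b where y: "y \<in> weyl" "is_join (refl s) h b"
    using join_exists[OF _ refl_weyl[OF st(1)] h] simple_weak_le[OF st(1)] by metis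
  note bD = is_joinD[OF y(2)]
  define x where "x = act (alt (k - 1) t s)"
  have x: "x \<in> weyl" using W st by (simp add: x_def)
  have tsk: "enat (k - 1) \<le> m t s" using k m_sym st by simp
  have inv_x: "\<N> x = dihedral_root t s ` {..<k-1}"
    unfolding x_def by (rule inversions_alternating_word[OF st(2,1) _ tsk]) (use st in simp)
  have xs: "dihedral_root t s j \<noteq> \<alpha> s" if "j < k - 1" for j
  proof
    assume "dihedral_root t s j = \<alpha> s"
    then have "dihedral_root t s j t = \<alpha> s t" by simp
    moreover have "dcoeff t s (Suc j) > 0"
      by (rule dcoeff_pos) (use st k m_sym that in auto)
    ultimately show False using st by (simp add: dihedral_root_def lin_comb_def simple_root_def)
  qed
  have "\<alpha> s \<notin> \<N> x" unfolding inv_x using xs by (metis imageE lessThan_iff)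
  then have "\<N> x \<inter> \<N> (refl s) = {}" using st by (simp add: inversions_refl)
  moreover have "\<N> x \<inter> \<N> h = {}"
  proof -
    have "dihedral_root t s j \<notin> \<N> h" if "j < k - 1" for j
      by (rule dihedral_root_notin_inversions) (use st k m_sym that sh h in auto)
    then show ?thesis unfolding inv_x by auto
  qed
  \<comment> \<open>This is the last clause of \<open>is_join\<close>. Moved back by
    \<open>g\<close>, the join becomes an element \<open>v0\<close> of the cone type of
    \<open>g \<circ> x\<close> that inverts \<open>g (\<alpha> s)\<close>; by \<open>top\<close> it
    would also lie in the cone type of the top element, which inverts that root.\<close>
  ultimately have xb: "\<N> x \<inter> \<N> b = {}" using bD(5)[OF x] by blast
  define v0 where "v0 = g \<circ> b"
  have v0: "v0 \<in> weyl" using comp_weyl g bD by (simp add: v0_def)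
  have b: "b = h \<circ> v0" using g by (simp add: v0_def h_def)
  have "\<N> (ginv h) \<inter> \<N> (ginv h \<circ> b) = {}" by (rule weak_le_disjoint[OF h bD(1,3)])
  then have v0g: "\<N> g \<inter> \<N> v0 = {}" by (simp add: gh v0_def)
  have inv_b: "\<N> b = \<N> h \<union> h ` \<N> v0"
    unfolding b by (rule inversions_comp(1)[OF h v0]) (use v0g gh in auto)
  have memb: "z \<in> \<N> b \<longleftrightarrow> z \<in> \<N> h \<or> g z \<in> \<N> v0" for z
    unfolding inv_b using g by (auto simp: h_def image_iff) (metis ginv_apply)
  have "\<N> v0 \<inter> \<N> (g \<circ> x) = {}"
  proof -
    have "\<N> (g \<circ> x) = \<N> g \<union> g ` \<N> x"
      unfolding x_def by (rule dihedral_coset_inversions) (use st g tsk in auto)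
    moreover have "g z \<notin> \<N> v0" if "z \<in> \<N> x" for z using memb xb that by blast
    ultimately show ?thesis using v0g by blast
  qed
  then have "v0 \<in> cone_type (g \<circ> x)" using v0 by (simp add: cone_type_def)
  then have "v0 \<in> cone_type (g \<circ> act (alt k s t))" using top unfolding x_def by simp
  then have "\<N> v0 \<inter> \<N> (g \<circ> act (alt k s t)) = {}"
    by (simp add: cone_type_def)
  moreover have "g (\<alpha> s) \<in> \<N> v0" using memb sh bD(2) simple_weak_le[OF st(1)] by blast
  moreover have "g (\<alpha> s) \<in> \<N> (g \<circ> act (alt k s t))"
    using dihedral_coset_inversions[OF st _ g, of k] longest_alternating_word(1)[OF st k] k by simp
  ultimately show False by blast
qed

lemma weak_less_last_step:
  assumes y: "y \<in> weyl" and w: "w \<in> weyl" and le: "y \<preceq> w" and ne: "y \<noteq> w"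
  obtains r where "r \<in> S" "y \<preceq> w \<circ> refl r" "w \<circ> refl r \<preceq> w" "w (\<alpha> r) \<notin> pos"
proof -
  define q where "q = ginv y \<circ> w"
  have q: "q \<in> weyl" using comp_weyl ginv_weyl y w by (simp add: q_def)
  have w_eq: "w = y \<circ> q" using y by (simp add: q_def)
  have "q \<noteq> id" using ne w_eq by auto
  then obtain q' r where q': "q' \<in> weyl" "r \<in> S" "q = q' \<circ> refl r"
    "\<N> q = insert (q' (\<alpha> r)) (\<N> q')" using obtain_last_step[OF q] by metis
  have wr: "w \<circ> refl r = y \<circ> q'" using w_eq q' by (simp add: comp_assoc[symmetric])
  have disj: "\<N> (ginv y) \<inter> \<N> q = {}" unfolding q_def by (rule weak_le_disjoint[OF y w le])
  then have disj': "\<N> (ginv y) \<inter> \<N> q' = {}" using q'(4) by blast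
  have below: "w \<circ> refl r \<preceq> w"
    unfolding wr using inversions_comp(1)[OF y q disj] inversions_comp(1)[OF y q'(1) disj'] q'(4) w_eq by auto
  then have "w (\<alpha> r) \<notin> pos" using inversions_comp_refl[OF q'(2) w] by blast
  moreover have "y \<preceq> w \<circ> refl r" unfolding wr by (rule weak_le_comp[OF y q'(1) disj'])
  ultimately show ?thesis using that q'(2) below by blast
qed

text \<open>Induction on the length of \<open>w\<close>. The gate property settles
  \<open>u = w\<close>; otherwise \<open>u\<close> survives the removal of some last letter
  \<open>t\<close>. If \<open>t\<close> differs from \<open>r\<close>, then \<open>w\<close> is the
  top of a finite dihedral coset, and \<open>u\<close> is carried down the side through
  \<open>w \<circ> refl t\<close> to the bottom \<open>g\<close>, which lies below
  \<open>w \<circ> refl r\<close>.\<close>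

lemma gate_weak_le_descent:
  assumes "gate u" "w \<in> weyl" "u \<preceq> w" "r \<in> S" "w (\<alpha> r) \<notin> pos"
    and "cone_type (w \<circ> refl r) = cone_type w"
  shows "u \<preceq> w \<circ> refl r"
  using assms(2-)
proof (induction "len w" arbitrary: w r rule: less_induct)
  case less
  note uW = gate_weyl[OF \<open>gate u\<close>]
  have down: "w \<circ> refl q \<in> weyl \<and> (w \<circ> refl q) (\<alpha> q) \<in> pos \<and> w \<circ> refl q \<preceq> w
      \<and> len w = Suc (len (w \<circ> refl q))"
    if q: "q \<in> S" "w (\<alpha> q) \<notin> pos" and w: "w \<in> weyl" for q and w :: "'a vec \<Rightarrow> 'a vec"
  proof -
    have W: "w \<circ> refl q \<in> weyl" using comp_weyl refl_weyl q w by blast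
    have "neg (w (\<alpha> q)) \<in> pos"
      using neg_pos_iff weyl_roots[OF w simple_root_roots[OF q(1)]] q by blast
    then have p: "(w \<circ> refl q) (\<alpha> q) \<in> pos"
      using w q by (simp add: reflection_self weyl_lin_comb)
    note ic = inversions_comp_refl[OF q(1) W p, unfolded comp_refl_refl[OF q(1)]]
    have "len w = Suc (len (w \<circ> refl q))"
      unfolding ic(1) by (rule card_insert_disjoint[OF finite_inversions[OF W] ic(2)])
    then show ?thesis using ic W p by blast
  qed
  show ?case
  proof (cases "u = w")
    case True
    have "w \<circ> refl r = w"
      using \<open>gate u\<close> down[OF less.prems(3,4,1)] less.prems(5) unfolding gate_def True by blast
    then show ?thesis using down[OF less.prems(3,4,1)] by simp
  next
    case False
    obtain t where tS: "t \<in> S" and ut: "u \<preceq> w \<circ> refl t" and t: "w (\<alpha> t) \<notin> pos"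
      using weak_less_last_step[OF uW less.prems(1,2) False] by metis
    show ?thesis
    proof (cases "r = t")
      case rt: False
      have iW: "ginv w \<in> weyl" using ginv_weyl less.prems by blast
      have ir: "\<alpha> r \<in> \<N> (ginv w)" "\<alpha> t \<in> \<N> (ginv w)"
        using simple_inversion_ginv less.prems t tS by auto
      obtain k where "m r t = enat k" using m_finite_if_descents[OF less.prems(3) tS rt iW ir] by blast
      \<comment> \<open>According to the parity of \<open>k\<close>, the letters are named so that
        \<open>alt k a b\<close> ends in \<open>t\<close> and \<open>alt k b a\<close> ends in
        \<open>r\<close>; a last letter has index \<open>k - 1\<close>.\<close>
      have "\<exists>a b. a \<in> S \<and> b \<in> S \<and> a \<noteq> b \<and> m a b = enat k \<and> letter (k - 1) a b = t \<and> letter (k - 1) b a = r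
          \<and> {a, b} = {r, t}"
        using letter_cases[of "k - 1" r t] rt less.prems(3) tS \<open>m r t = enat k\<close> m_sym[of r t]
        by (metis insert_commute)
      then obtain a b where ab: "a \<in> S" "b \<in> S" "a \<noteq> b" and k: "m a b = enat k"
        and last: "letter (k - 1) a b = t" "letter (k - 1) b a = r" and "{a, b} = {r, t}" by blast
      then have iab: "\<alpha> a \<in> \<N> (ginv w)" "\<alpha> b \<in> \<N> (ginv w)"
        using ir by (auto simp: doubleton_eq_iff)
      define d where "d = act (alt k a b)"
      note dD = longest_alternating_word[OF ab k, folded d_def]
      have d: "d \<in> weyl" using alternating_word_weyl ab by (simp add: d_def)
      have dd: "d \<circ> d = id" using comp_ginv(1)[OF d] dD(5) by simp
      define g where "g = w \<circ> d"
      have g: "g \<in> weyl" using comp_weyl less.prems d by (simp add: g_def)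
      have wgd: "w = g \<circ> d" using dd by (simp add: g_def comp_assoc)
      have "\<N> (ginv d) \<inter> \<N> (ginv d \<circ> ginv w) = {}"
        by (rule weak_le_disjoint[OF d iW dD(3)[OF iW iab]])
      then have "\<N> d \<inter> \<N> (ginv g) = {}"
        using dD(5) d less.prems(1) by (simp add: g_def ginv_comp)
      then have gp: "g (\<alpha> a) \<in> pos" "g (\<alpha> b) \<in> pos"
        using dD(1,2) simple_inversion_ginv ab g by blast+
      obtain n where n: "k = Suc n" using m_ge_2[OF ab k] by (cases k) auto
      have w1: "w \<circ> refl t = g \<circ> act (alt n a b)"
        using wgd last(1) ab tS unfolding d_def n alternating_word_snoc
        by (simp add: act_append comp_assoc[symmetric])
      have w2: "w \<circ> refl r = g \<circ> act (alt n b a)"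
      proof -
        have "d = act (alt n b a) \<circ> refl r"
          using act_braid[OF ab k] last(2) unfolding d_def n alternating_word_snoc[of n b a]
          by (simp add: act_append)
        then show ?thesis using wgd less.prems(3) by (simp add: comp_assoc[symmetric])
      qed
      have top: "cone_type (g \<circ> act (alt (k - 1) b a)) = cone_type (g \<circ> act (alt k a b))"
        using less.prems(5) n unfolding w2 unfolding wgd d_def by (simp only: diff_Suc_1)
      \<comment> \<open>One letter is removed at a time: \<open>cone_type_residue\<close> keeps the
        cone type constant, and the outer induction applies to each \<open>p\<close>, which is
        shorter than \<open>w\<close>.\<close>
      have "u \<preceq> g \<circ> act (alt (n - j) a b)" if "j \<le> n" for j
        using that
      proof (induction j)
        case 0
        show ?case using ut unfolding w1 diff_zero .
      next
        case (Suc j)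
        define i where "i = n - Suc j"
        have i: "n - j = Suc i" "Suc i < k" using Suc.prems n by (auto simp: i_def)
        define p where "p = g \<circ> act (alt (Suc i) a b)"
        have up: "u \<preceq> p" using Suc.IH[OF Suc_leD[OF Suc.prems]] unfolding p_def i(1) .
        have pW: "p \<in> weyl" unfolding p_def by (rule comp_weyl[OF g alternating_word_weyl[OF ab(1,2)]])
        define e where "e = letter i a b"
        have e: "e \<in> S" using ab by (simp add: e_def letter_def)
        have pe: "p \<circ> refl e = g \<circ> act (alt i a b)"
          using e unfolding p_def e_def alternating_word_snoc by (simp add: act_append comp_assoc[symmetric])
        have path: "\<N> (g \<circ> act (alt i' a b))
          = \<N> g \<union> g ` dihedral_root a b ` {..<i'}" if "i' \<le> k" for i'
        proof -
          have "enat i' \<le> m a b" using that k by simp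
          then show ?thesis
            using dihedral_coset_inversions[OF ab _ g gp] inversions_alternating_word[OF ab] by simp
        qed
        have "len p < len w"
        proof -
          have "p \<preceq> w \<circ> refl t"
            unfolding w1 p_def using path[of n] path[of "Suc i"] n i by auto
          then show ?thesis
            using len_mono[of "w \<circ> refl t" p] down[OF tS t less.prems(1)] by simp
        qed
        moreover have "p (\<alpha> e) \<notin> pos"
        proof
          assume "p (\<alpha> e) \<in> pos"
          then have "p (\<alpha> e) \<in> \<N> (p \<circ> refl e)" "p (\<alpha> e) \<notin> \<N> p"
            using inversions_comp_refl[OF e pW] by blast+
          moreover have "p \<circ> refl e \<preceq> p"
            unfolding pe unfolding p_def using path[of i] path[of "Suc i"] i by auto
          ultimately show False by blast
        qed
        moreover have "cone_type (p \<circ> refl e) = cone_type p"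
          unfolding pe unfolding p_def
          by (rule cone_type_residue[OF ab k g gp top i(2), symmetric])
        ultimately have "u \<preceq> p \<circ> refl e" using less.hyps[OF _ pW up e] by blast
        then show ?case unfolding pe i_def .
      qed
      from this[of n] have "u \<preceq> g" by simp
      also have "g \<preceq> w \<circ> refl r"
        unfolding w2 using dihedral_coset_inversions[OF ab(2,1) _ _ g gp(2,1)] ab k m_sym n by simp
      finally show ?thesis .
    qed (use ut in simp)
  qed
qed

text \<open>A smaller \<open>y\<close> with the cone type of \<open>w\<close> lies below some
  \<open>w \<circ> refl r\<close>, whose cone type is squeezed between the two. By
  \<open>gate_weak_le_descent\<close> both gates then lie below \<open>w \<circ> refl r\<close>,
  against the leastness of the join.\<close>

lemma gate_join:
  assumes "gate u" "gate v" "is_join u v w" shows "gate w"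
proof -
  note wD = is_joinD[OF assms(3)]
  show ?thesis unfolding gate_def
  proof (intro conjI ballI impI wD(1), rule ccontr)
    fix y assume y: "y \<in> weyl" "y \<preceq> w" "cone_type y = cone_type w" "y \<noteq> w"
    then obtain r where rS: "r \<in> S" and yr: "y \<preceq> w \<circ> refl r" and le: "w \<circ> refl r \<preceq> w"
      and r: "w (\<alpha> r) \<notin> pos" using weak_less_last_step[OF y(1) wD(1) y(2,4)] by metis
    have WR: "w \<circ> refl r \<in> weyl" using comp_weyl refl_weyl rS wD by blast
    have "cone_type (w \<circ> refl r) = cone_type w" using yr cone_type_antimono le y(3) by blast
    then have "u \<preceq> w \<circ> refl r" "v \<preceq> w \<circ> refl r"
      using gate_weak_le_descent[OF _ wD(1) _ rS r] assms(1,2) wD(2,3) by blast+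
    then have "w \<preceq> w \<circ> refl r" using wD(4) WR by blast
    then have "w \<circ> refl r = w" using weak_le_antisym WR wD(1) le by blast
    then have "w (refl r (\<alpha> r)) = w (\<alpha> r)" by (metis comp_apply)
    then have "neg (\<alpha> r) = \<alpha> r"
      using weyl_inject[OF wD(1)] rS by (simp add: reflection_self)
    then show False by (auto simp: lin_comb_def simple_root_def fun_eq_iff split: if_splits)
  qed
qed

section \<open>Finiteness properties of the root system\<close>

text \<open>A linear functional whose sign distinguishes positive from negative roots, see
  \<open>pos_iff_height\<close>.\<close>

definition height :: "'a vec \<Rightarrow> real" where
  "height v = (\<Sum>s\<in>S. v s)"

lemma height_lin_comb [simp]: "height (lin_comb a v b w) = a * height v + b * height w"
  by (simp add: height_def lin_comb_def sum.distrib sum_distrib_left)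

lemma height_simple_root [simp]: "s \<in> S \<Longrightarrow> height (\<alpha> s) = 1"
  by (simp add: height_def simple_root_def finite_S)

lemma pos_coeff:
  assumes "b \<in> pos" obtains x where "x \<in> S" "0 < b x"
proof -
  obtain x where x: "b x \<noteq> 0" using root_nonzero[OF pos_roots[OF assms]] by auto
  then have "x \<in> S" using root_outside[OF pos_roots[OF assms]] by blast
  moreover have "0 < b x" using x pos_nonneg[OF assms] unfolding nonneg_def by (metis order_le_less)
  ultimately show ?thesis using that by blast
qed

lemma height_pos: "b \<in> pos \<Longrightarrow> 0 < height b"
  unfolding height_def using pos_coeff[of b] pos_nonneg[of b]
  by (metis (no_types, lifting) finite_S nonneg_def sum_pos2)

lemma height_not_pos: "b \<in> roots \<Longrightarrow> b \<notin> pos \<Longrightarrow> height b < 0"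
  using height_pos[of "neg b"] neg_pos_iff by simp

lemma pos_iff_height: "b \<in> roots \<Longrightarrow> b \<in> pos \<longleftrightarrow> 0 < height b"
  using height_pos height_not_pos by (meson less_asym)

lemma root_pos_if_coeff: "b \<in> roots \<Longrightarrow> 0 < b x \<Longrightarrow> b \<in> pos"
  using neg_pos_iff[of b] pos_nonneg[of "neg b"] by (auto simp: nonneg_def lin_comb_def) (metis neg_0_le_iff_le not_le)

lemma reflection_weyl:
  assumes "b \<in> roots" shows "reflection b \<in> weyl"
proof -
  obtain g s where g: "g \<in> weyl" "s \<in> S" "b = g (\<alpha> s)" using assms by (auto simp: roots_def)
  have "reflection b v = (g \<circ> (refl s \<circ> ginv g)) v" for v
  proof -
    have "form (ginv g v) (\<alpha> s) = form v b"
      using form_weyl[OF g(1), of "ginv g v" "\<alpha> s"] g by simp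
    then show ?thesis using g by (simp add: reflection_def weyl_lin_comb)
  qed
  then have "reflection b = g \<circ> (refl s \<circ> ginv g)" by blast
  then show ?thesis using comp_weyl refl_weyl ginv_weyl g by simp
qed

lemma reflection_eq_imp_eq:
  assumes "b \<in> pos" "d \<in> pos" "reflection b = reflection d" shows "b = d"
proof -
  define c where "c = form b d"
  have 1: "form b b = 1" "form d d = 1" using assms pos_roots by auto
  have "reflection d b = neg b" using assms(3) reflection_self[OF 1(1)] by metis
  then have "\<And>x. b x + (- 2 * c) * d x = - b x" by (auto simp: reflection_def lin_comb_def c_def fun_eq_iff)
  then have bd: "b = lin_comb c d 0 d" by (auto simp: lin_comb_def fun_eq_iff)
  have "form (lin_comb c d 0 d) (lin_comb c d 0 d) = 1" using 1 bd by metis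
  then have "c * c = 1" using 1 by simp
  moreover have "0 < c"
  proof -
    have "height b = c * height d" using arg_cong[OF bd, of height] by simp
    then show ?thesis using height_pos assms by (metis zero_less_mult_pos2)
  qed
  ultimately have "c = 1" by (metis mult_cancel_right1 mult_less_cancel_right1 not_less_iff_gr_or_eq square_eq_1_iff less_asym neg_less_0_iff_less zero_less_one)
  then show ?thesis using bd by simp
qed

subsection \<open>Discreteness\<close>

definition l1 :: "'a vec \<Rightarrow> real" where
  "l1 v = (\<Sum>s\<in>S. \<bar>v s\<bar>)"

lemma abs_form_le: "\<bar>form v w\<bar> \<le> l1 v * l1 w"
proof -
  have "\<bar>form v w\<bar> \<le> (\<Sum>s\<in>S. \<bar>\<Sum>t\<in>S. v s * w t * gram s t\<bar>)" unfolding form_def by (rule sum_abs)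
  also have "\<dots> \<le> (\<Sum>s\<in>S. \<Sum>t\<in>S. \<bar>v s\<bar> * \<bar>w t\<bar>)"
  proof (rule sum_mono, rule order_trans[OF sum_abs], rule sum_mono)
    fix s t show "\<bar>v s * w t * gram s t\<bar> \<le> \<bar>v s\<bar> * \<bar>w t\<bar>"
      unfolding abs_mult using abs_gram_le[of s t] by (intro mult_left_le) auto
  qed
  also have "\<dots> = l1 v * l1 w" by (simp add: l1_def sum_product)
  finally show ?thesis .
qed

lemma abs_height_le: "\<bar>height v\<bar> \<le> l1 v"
  unfolding height_def l1_def by (rule sum_abs)

text \<open>If two positive roots are close, the product of their reflections is so close to the identity
  that it keeps all simple roots positive.\<close>

lemma close_roots_eq:
  assumes b: "b \<in> pos" "l1 b \<le> L" and d: "d \<in> pos" "l1 d \<le> L"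
    and e: "l1 (lin_comb 1 b (-1) d) \<le> e" and small: "e * (4 * L + 4 * L * L * L) < 1"
  shows "b = d"
proof -
  define \<epsilon> where "\<epsilon> = lin_comb 1 b (-1) d"
  have L: "0 \<le> L" using b(2) by (rule order_trans[rotated]) (simp add: l1_def sum_nonneg)
  have e0: "0 \<le> e" using e by (rule order_trans[rotated]) (simp add: l1_def sum_nonneg)
  have le: "l1 \<epsilon> \<le> e" using e by (simp add: \<epsilon>_def)
  define T where "T = reflection b \<circ> reflection d"
  have T: "T \<in> weyl" using reflection_weyl comp_weyl b d pos_roots by (simp add: T_def)
  have bound: "\<bar>form u v\<bar> \<le> A * B" if "l1 u \<le> A" "l1 v \<le> B" for u v A B
  proof -
    have "0 \<le> l1 u" "0 \<le> l1 v" by (auto simp: l1_def sum_nonneg)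
    then show ?thesis using order_trans[OF abs_form_le mult_mono[OF that]] that by linarith
  qed
  have "nonneg (T (\<alpha> r))" if r: "r \<in> S" for r
  proof -
    define v where "v = \<alpha> r"
    have lv: "l1 v \<le> 1" using r by (simp add: v_def l1_def simple_root_def finite_S if_distrib cong: if_cong)
    define x y z where "x = form v d" and "y = form v \<epsilon>" and "z = form d \<epsilon>"
    have xyz: "\<bar>x\<bar> \<le> 1 * L" "\<bar>y\<bar> \<le> 1 * e" "\<bar>z\<bar> \<le> L * e"
      unfolding x_def y_def z_def using bound lv d(2) le by blast+
    have hb: "\<bar>height b\<bar> \<le> L" "\<bar>height \<epsilon>\<bar> \<le> e" using abs_height_le order_trans b(2) le by blast+
    have "form d d = 1" using d pos_roots by simp
    then have "form d b = 1 + z" "form v b = x + y"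
      by (simp_all add: z_def \<epsilon>_def x_def y_def)
    then have "height (T v) = height v - 2 * x * height d - 2 * (x + y - 2 * x * (1 + z)) * height b"
      by (simp add: T_def reflection_def x_def algebra_simps)
    also have "\<dots> = 1 + 2 * x * height \<epsilon> - 2 * y * height b + 4 * x * z * height b"
      using r by (simp add: v_def \<epsilon>_def algebra_simps)
    \<comment> \<open>The three error terms are bounded by \<open>2 L e\<close>,
      \<open>2 e L\<close> and \<open>4 L^3 e\<close>, which explains the constant in
      \<open>small\<close>. Positive height suffices, because \<open>T v\<close> is a root.\<close>
    also have "\<dots> \<ge> 1 - (2 * (L * e) + 2 * (e * L) + 4 * (L * (L * e) * L))"
    proof -
      have "\<bar>x * height \<epsilon>\<bar> \<le> L * e" unfolding abs_mult using xyz hb by (intro mult_mono) auto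
      moreover have "\<bar>y * height b\<bar> \<le> e * L" unfolding abs_mult using xyz hb e0 by (intro mult_mono) auto
      moreover have "\<bar>x * z * height b\<bar> \<le> L * (L * e) * L"
        unfolding abs_mult using xyz hb L e0 by (intro mult_mono) auto
      ultimately show ?thesis unfolding abs_le_iff mult.assoc by linarith
    qed
    finally have "0 < height (T v)" using small by (simp add: algebra_simps)
    moreover have "T v \<in> roots" using weyl_roots[OF T] simple_root_roots[OF r] by (simp add: v_def)
    ultimately show ?thesis using pos_iff_height pos_nonneg by (auto simp: v_def)
  qed
  then have "T = id" using weyl_eq_id T by blast
  have "reflection d v = reflection b v" for v
  proof -
    have "reflection b (reflection d v) = v" using fun_cong[OF \<open>T = id\<close>, of v] by (simp add: T_def)
    moreover have "reflection b (reflection b (reflection d v)) = reflection d v"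
      by (rule reflection_involutive) (use b pos_roots in simp)
    ultimately show ?thesis by simp
  qed
  then show ?thesis by (intro reflection_eq_imp_eq[OF b(1) d(1)] ext) simp
qed

text \<open>Pigeonhole on a grid of mesh \<open>1 / N\<close>: roots in the same cell are close and
  hence equal by \<open>close_roots_eq\<close>, and a bounded region meets finitely many
  cells.\<close>

lemma finite_bounded_pos: "finite {b \<in> pos. \<forall>s\<in>S. b s \<le> R}"
proof -
  define L where "L = real (card S) * \<bar>R\<bar>"
  define C where "C = real (card S) * (4 * L + 4 * L * L * L)"
  have "0 \<le> L" by (simp add: L_def)
  \<comment> \<open>Two vectors in one cell differ by at most \<open>card S / N\<close> in the norm
    \<open>l1\<close>; \<open>N\<close> is taken large enough for
    \<open>close_roots_eq\<close>.\<close>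
  obtain N :: nat where N: "C < real N" "0 < N" using reals_Archimedean2[of "max C 1"] by (auto intro: Nat.gr0I)
  define A where "A = {b \<in> pos. \<forall>s\<in>S. b s \<le> R}"
  define f where "f b = restrict (\<lambda>s. \<lfloor>real N * b s\<rfloor>) S" for b :: "'a \<Rightarrow> real"
  have lA: "l1 b \<le> L" if "b \<in> A" for b
  proof -
    have "\<bar>b s\<bar> \<le> \<bar>R\<bar>" if "s \<in> S" for s
      using \<open>b \<in> A\<close> that pos_nonneg[of b] by (auto simp: A_def nonneg_def)
    then show ?thesis unfolding l1_def L_def by (intro sum_bounded_above) auto
  qed
  have "inj_on f A"
  proof (rule inj_onI)
    fix b d assume bd: "b \<in> A" "d \<in> A" "f b = f d"
    have "\<bar>b s - d s\<bar> \<le> 1 / real N" if "s \<in> S" for s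
    proof -
      have "\<lfloor>real N * b s\<rfloor> = \<lfloor>real N * d s\<rfloor>" using fun_cong[OF bd(3), of s] that by (simp add: f_def)
      then have "\<bar>real N * b s - real N * d s\<bar> \<le> 1" by linarith
      then have "real N * \<bar>b s - d s\<bar> \<le> 1" unfolding right_diff_distrib[symmetric] abs_mult by simp
      then show ?thesis using N(2) by (simp add: field_simps)
    qed
    then have "l1 (lin_comb 1 b (-1) d) \<le> real (card S) * (1 / real N)"
      unfolding l1_def by (intro sum_bounded_above) (auto simp: lin_comb_def)
    moreover have "real (card S) * (1 / real N) * (4 * L + 4 * L * L * L) < 1"
      using N by (simp add: C_def field_simps)
    moreover have "b \<in> pos" "d \<in> pos" using bd by (auto simp: A_def)
    ultimately show "b = d" using close_roots_eq[of b L d] lA bd(1,2) by blast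
  qed
  moreover have "f ` A \<subseteq> PiE S (\<lambda>_. {0..\<lfloor>real N * R\<rfloor>})"
  proof (rule image_subsetI, rule PiE_I)
    fix b s assume "b \<in> A" "s \<in> S"
    then have "0 \<le> b s" "b s \<le> R" using pos_nonneg by (auto simp: A_def nonneg_def)
    then show "f b s \<in> {0..\<lfloor>real N * R\<rfloor>}"
      using \<open>s \<in> S\<close> by (auto simp: f_def intro!: floor_mono mult_left_mono)
  qed (simp add: f_def)
  moreover have "finite (PiE S (\<lambda>_. {0..\<lfloor>real N * R\<rfloor>}))" using finite_S by (intro finite_PiE) auto
  ultimately show ?thesis unfolding A_def by (meson finite_imageD finite_subset)
qed

lemma finite_bounded_roots: "finite {b \<in> roots. \<forall>s\<in>S. \<bar>b s\<bar> \<le> R}"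
proof -
  let ?P = "{b \<in> pos. \<forall>s\<in>S. b s \<le> R}"
  have "b \<in> ?P \<union> neg ` ?P" if "b \<in> roots" "\<forall>s\<in>S. \<bar>b s\<bar> \<le> R" for b
  proof (cases "b \<in> pos")
    case True
    then show ?thesis using that by (auto simp: abs_le_iff)
  next
    case False
    then have "neg b \<in> ?P" using that neg_pos_iff by (auto simp: lin_comb_def abs_le_iff)
    then show ?thesis by (intro UnI2 image_eqI[of _ _ "neg b"]) simp_all
  qed
  then have "{b \<in> roots. \<forall>s\<in>S. \<bar>b s\<bar> \<le> R} \<subseteq> ?P \<union> neg ` ?P" by (intro subsetI) simp
  then show ?thesis by (rule finite_subset) (use finite_bounded_pos in simp)
qed

subsection \<open>Inner products of roots spanning a definite plane\<close>

lemma functional_expand: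
  assumes lin: "\<And>a v b w. f (lin_comb a v b w) = a * f v + b * (f w :: real)"
    and "finite A" "\<And>x. x \<notin> A \<Longrightarrow> v x = 0"
  shows "f v = (\<Sum>s\<in>A. v s * f (\<alpha> s))"
  using assms(2,3)
proof (induction A arbitrary: v rule: finite_induct)
  case empty
  then have "v = lin_comb 0 v 0 v" by (auto simp: lin_comb_def)
  then show ?case using lin[of 0 v 0 v] by simp
next
  case (insert a A)
  define u where "u = v(a := 0)"
  have v: "v = lin_comb 1 u (v a) (\<alpha> a)" by (auto simp: u_def lin_comb_def simple_root_def fun_eq_iff)
  have "f u = (\<Sum>s\<in>A. u s * f (\<alpha> s))" by (rule insert.IH) (use insert in \<open>auto simp: u_def\<close>)
  also have "\<dots> = (\<Sum>s\<in>A. v s * f (\<alpha> s))" using insert by (auto simp: u_def intro!: sum.cong)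
  finally show ?case using insert lin[of 1 u "v a" "\<alpha> a"] v by simp
qed

definition plane :: "'a vec \<Rightarrow> 'a vec \<Rightarrow> 'a vec set" where
  "plane a b = {lin_comb x a y b | x y. True}"

lemma plane_lin_comb: "p \<in> plane a b \<Longrightarrow> q \<in> plane a b \<Longrightarrow> lin_comb x p y q \<in> plane a b"
proof -
  assume "p \<in> plane a b" "q \<in> plane a b"
  then obtain c d e f where "p = lin_comb c a d b" "q = lin_comb e a f b" by (auto simp: plane_def)
  then have "lin_comb x p y q = lin_comb (x * c + y * e) a (x * d + y * f) b"
    by (auto simp: lin_comb_def algebra_simps)
  then show ?thesis by (auto simp: plane_def)
qed

lemma plane_left: "a \<in> plane a b" and plane_right: "b \<in> plane a b"
proof -
  have "a = lin_comb 1 a 0 b" "b = lin_comb 0 a 1 b" by (auto simp: lin_comb_def)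
  then show "a \<in> plane a b" "b \<in> plane a b" unfolding plane_def by blast+
qed

text \<open>This contains the reflections in all roots of the plane. Being defined by displacements
  instead of generators, its elements are determined by their values at \<open>a\<close> and
  \<open>b\<close> once the plane is nondegenerate.\<close>

definition plane_group :: "'a vec \<Rightarrow> 'a vec \<Rightarrow> ('a vec \<Rightarrow> 'a vec) set" where
  "plane_group a b = {d \<in> weyl. \<forall>v. lin_comb 1 (d v) (-1) v \<in> plane a b}"

lemma plane_group_comp: "d \<in> plane_group a b \<Longrightarrow> e \<in> plane_group a b \<Longrightarrow> d \<circ> e \<in> plane_group a b"
proof -
  assume d: "d \<in> plane_group a b" and e: "e \<in> plane_group a b"
  have "lin_comb 1 (d (e v)) (-1) v \<in> plane a b" for v
  proof -
    have "lin_comb 1 (d (e v)) (-1) v = lin_comb 1 (lin_comb 1 (d (e v)) (-1) (e v)) 1 (lin_comb 1 (e v) (-1) v)"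
      by (auto simp: lin_comb_def)
    then show ?thesis using d e plane_lin_comb by (auto simp: plane_group_def)
  qed
  then show ?thesis using d e comp_weyl by (simp add: plane_group_def)
qed

lemma plane_group_ginv: "d \<in> plane_group a b \<Longrightarrow> ginv d \<in> plane_group a b"
proof -
  assume d: "d \<in> plane_group a b"
  have "lin_comb 1 (ginv d v) (-1) v \<in> plane a b" for v
  proof -
    have p: "lin_comb 1 (d (ginv d v)) (-1) (ginv d v) \<in> plane a b" using d unfolding plane_group_def by blast
    have "lin_comb 1 (ginv d v) (-1) v = lin_comb (-1) (lin_comb 1 (d (ginv d v)) (-1) (ginv d v)) 0 a"
      using d by (auto simp: lin_comb_def plane_group_def)
    then show ?thesis using plane_lin_comb[OF p plane_left] by metis
  qed
  then show ?thesis using d ginv_weyl by (simp add: plane_group_def)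
qed

lemma reflection_plane_group: "c \<in> roots \<Longrightarrow> c \<in> plane a b \<Longrightarrow> reflection c \<in> plane_group a b"
proof -
  assume c: "c \<in> roots" "c \<in> plane a b"
  have "lin_comb 1 (reflection c v) (-1) v = lin_comb (- 2 * form v c) c 0 c" for v
    by (auto simp: reflection_def lin_comb_def)
  then show ?thesis using c plane_lin_comb reflection_weyl by (simp add: plane_group_def)
qed

text \<open>The form is positive definite on the plane, so the roots in it have bounded coordinates
  and are finite in number; an element of the group is determined by the two roots to which it sends
  \<open>a\<close> and \<open>b\<close>.\<close>

lemma finite_plane_group:
  assumes a: "a \<in> roots" and b: "b \<in> roots" and ab: "\<bar>form a b\<bar> < 1"
  shows "finite (plane_group a b)"
proof -
  define k where "k = form a b"
  have k: "k * k < 1" using ab abs_square_less_1[of k] by (simp add: k_def power2_eq_square)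
  have f1: "form a a = 1" "form b b = 1" "form b a = k" using a b form_sym by (auto simp: k_def)
  define R where "R = (\<Sum>s\<in>S. \<bar>a s\<bar> + \<bar>b s\<bar>) / (1 - k * k)"
  let ?B = "{c \<in> roots. \<forall>s\<in>S. \<bar>c s\<bar> \<le> R}"
  have bounded: "c \<in> ?B" if c: "c \<in> roots" "c \<in> plane a b" for c
  proof -
    obtain x y where xy: "c = lin_comb x a y b" using c by (auto simp: plane_def)
    have "form c c = 1" using c by simp
    then have "x * x + 2 * k * x * y + y * y = 1" using f1 by (simp add: xy k_def[symmetric] algebra_simps)
    then have eqs: "(y + k * x) * (y + k * x) + (1 - k * k) * (x * x) = 1"
      "(x + k * y) * (x + k * y) + (1 - k * k) * (y * y) = 1" by (simp_all add: algebra_simps)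
    \<comment> \<open>The completed squares bound the coordinates by
      \<open>1 / sqrt (1 - k * k)\<close>; the weaker bound without the square root is
      enough.\<close>
    have bnd: "\<bar>z\<bar> \<le> 1 / (1 - k * k)" if "u * u + (1 - k * k) * (z * z) = 1" for u z :: real
    proof -
      have "(1 - k * k) * (z * z) \<le> 1" using that zero_le_square[of u] by linarith
      moreover have "(1 - k * k) * (1 - k * k) * (z * z) \<le> (1 - k * k) * (z * z)"
        using k by (intro mult_right_mono mult_left_le) auto
      ultimately have "((1 - k * k) * z)\<^sup>2 \<le> 1" by (simp add: power2_eq_square algebra_simps)
      then have "\<bar>(1 - k * k) * z\<bar> \<le> 1" by (simp add: abs_square_le_1)
      then show ?thesis using k by (simp add: abs_mult field_simps)
    qed
    have x: "\<bar>x\<bar> \<le> 1 / (1 - k * k)" and y: "\<bar>y\<bar> \<le> 1 / (1 - k * k)" using eqs bnd by blast+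
    have "\<bar>c s\<bar> \<le> R" if "s \<in> S" for s
    proof -
      have "\<bar>c s\<bar> \<le> \<bar>x\<bar> * \<bar>a s\<bar> + \<bar>y\<bar> * \<bar>b s\<bar>"
        unfolding xy lin_comb_def by (metis abs_mult abs_triangle_ineq)
      also have "\<dots> \<le> 1 / (1 - k * k) * \<bar>a s\<bar> + 1 / (1 - k * k) * \<bar>b s\<bar>"
        using x y by (intro add_mono mult_right_mono) auto
      also have "\<dots> = (\<bar>a s\<bar> + \<bar>b s\<bar>) / (1 - k * k)" by (simp add: add_divide_distrib)
      also have "\<dots> \<le> R"
        unfolding R_def using k that finite_S by (intro divide_right_mono member_le_sum) auto
      finally show ?thesis .
    qed
    then show ?thesis using c by blast
  qed
  have img: "d c \<in> ?B" if "d \<in> plane_group a b" "c \<in> roots" "c \<in> plane a b" for d c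
  proof -
    have "d c = lin_comb 1 (lin_comb 1 (d c) (-1) c) 1 c" by (auto simp: lin_comb_def)
    moreover have "lin_comb 1 (d c) (-1) c \<in> plane a b" using that by (auto simp: plane_group_def)
    ultimately have "d c \<in> plane a b" using that(3) plane_lin_comb by metis
    then show ?thesis using bounded weyl_roots that by (auto simp: plane_group_def)
  qed
  have fixed: "e v = v" if e: "e \<in> plane_group a b" "e a = a" "e b = b" for e v
  proof -
    have eW: "e \<in> weyl" using e by (simp add: plane_group_def)
    obtain x y where q: "lin_comb 1 (e v) (-1) v = lin_comb x a y b"
      using e(1) unfolding plane_group_def plane_def by blast
    have "form (lin_comb x a y b) a = 0" "form (lin_comb x a y b) b = 0"
      unfolding q[symmetric] using form_weyl[OF eW, of v a] form_weyl[OF eW, of v b] e by simp_all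
    then have xy: "x + y * k = 0" "x * k + y = 0" using f1 by (simp_all add: k_def)
    have y: "y = - (x * k)" using xy(2) by linarith
    have "x * (1 - k * k) = 0" using xy(1) unfolding y by (simp add: algebra_simps)
    with y have "x = 0" "y = 0" using k by auto
    then have "\<And>p. e v p = v p" using q by (auto simp: lin_comb_def fun_eq_iff)
    then show ?thesis by blast
  qed
  have "inj_on (\<lambda>d. (d a, d b)) (plane_group a b)"
  proof (rule inj_onI)
    fix d d' assume d: "d \<in> plane_group a b" "d' \<in> plane_group a b" "(d a, d b) = (d' a, d' b)"
    have W: "d \<in> weyl" "d' \<in> weyl" using d by (auto simp: plane_group_def)
    have e: "ginv d \<circ> d' \<in> plane_group a b" by (intro plane_group_comp plane_group_ginv d(1,2))
    have "ginv d (d' a) = a" "ginv d (d' b) = b" using d(3) ginv_apply[OF W(1)] by (metis Pair_inject)+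
    then have "ginv d (d' v) = v" for v using fixed[OF e, of v] by simp
    then have "d (ginv d (d' v)) = d v" for v by simp
    then show "d = d'" unfolding apply_ginv[OF W(1)] by (intro ext) simp
  qed
  moreover have "(\<lambda>d. (d a, d b)) ` plane_group a b \<subseteq> ?B \<times> ?B"
    using img a b plane_left plane_right by auto
  ultimately show ?thesis using finite_bounded_roots by (meson finite_SigmaI finite_imageD finite_subset)
qed

definition support_roots :: "'a set \<Rightarrow> 'a vec set" where
  "support_roots I = {c \<in> roots. \<forall>x. x \<notin> I \<longrightarrow> c x = 0}"

text \<open>Averaging the height over the finite group generated by the two reflections gives an invariant
  functional, which is moved into the closed fundamental chamber.\<close>

lemma definite_plane_in_finite_parabolic:
  assumes a: "a \<in> roots" and b: "b \<in> roots" and ab: "\<bar>form a b\<bar> < 1"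
  obtains g I where "g \<in> weyl" "I \<subseteq> S" "finite (support_roots I)"
    "g a \<in> support_roots I" "g b \<in> support_roots I"
proof -
  let ?D = "plane_group a b"
  have finD: "finite ?D" by (rule finite_plane_group[OF assms])
  define f where "f v = (\<Sum>d\<in>?D. height (d v))" for v
  have lin: "f (lin_comb x v y w) = x * f v + y * f w" for x v y w
    unfolding f_def sum_distrib_left sum.distrib[symmetric]
    by (intro sum.cong) (auto simp: plane_group_def weyl_lin_comb)
  have zero: "f c = 0" if c: "c \<in> roots" "c \<in> plane a b" for c
  proof -
    have cc: "reflection c (reflection c v) = v" for v using reflection_involutive c by simp
    have "f c = (\<Sum>d\<in>?D. height ((d \<circ> reflection c) c))"
      unfolding f_def
      by (rule sum.reindex_bij_witness[of _ "\<lambda>d. d \<circ> reflection c" "\<lambda>d. d \<circ> reflection c"])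
        (auto simp: comp_assoc cc fun_eq_iff reflection_plane_group[OF c] plane_group_comp)
    also have "\<dots> = f (neg c)" unfolding f_def using c by (simp add: reflection_self)
    also have "\<dots> = - f c" by (simp add: lin)
    finally show ?thesis by simp
  qed
  have idD: "id \<in> ?D"
  proof -
    have "lin_comb 1 v (-1) v = lin_comb 0 a 0 b" for v by (auto simp: lin_comb_def)
    then show ?thesis by (auto simp: plane_group_def plane_def)
  qed
  \<comment> \<open>Finite, because a positive root whose averaged height is at most 0 must be made
    negative by one of the finitely many elements of \<open>?D\<close>.\<close>
  define Z where "Z = {c \<in> pos. f c \<le> 0}"
  have "Z \<subseteq> (\<Union>d\<in>?D. \<N> (ginv d))"
  proof
    fix c assume c: "c \<in> Z"
    show "c \<in> (\<Union>d\<in>?D. \<N> (ginv d))"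
    proof (rule ccontr)
      assume "\<not> ?thesis"
      then have "height (d c) > 0" if "d \<in> ?D" for d
        using c that height_pos by (auto simp: Z_def inversions_def plane_group_def)
      then have "0 < f c" unfolding f_def using finD idD by (intro sum_pos) auto
      then show False using c by (simp add: Z_def)
    qed
  qed
  then have finZ: "finite Z"
    using finD finite_inversions ginv_weyl by (auto simp: plane_group_def intro: finite_subset)
  define M where "M g = {c \<in> pos. f (g c) < 0}" for g
  have finM: "finite (M g)" if g: "g \<in> weyl" for g
  proof -
    have "c \<in> ginv g ` Z \<union> \<N> (ginv g)" if "c \<in> M g" for c
    proof (cases "g c \<in> pos")
      case True
      then have "g c \<in> Z" using that by (simp add: M_def Z_def)
      then show ?thesis using g by (metis UnI1 ginv_apply imageI)
    next
      case False
      then show ?thesis using that g by (simp add: M_def inversions_def)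
    qed
    then show ?thesis using finZ finite_inversions ginv_weyl g by (meson finite_UnI finite_imageI finite_subset subsetI)
  qed
  \<comment> \<open>Minimality of this count puts the functional into the closed chamber: reflecting
    in a simple root of negative value would remove that root from the count and only permute the
    others.\<close>
  obtain g where g: "g \<in> weyl" and least: "\<And>h. h \<in> weyl \<Longrightarrow> card (M g) \<le> card (M h)"
    using ex_has_least_nat[of "\<lambda>g. g \<in> weyl" id "\<lambda>g. card (M g)"] id_weyl by blast
  have nn: "0 \<le> f (g (\<alpha> s))" if s: "s \<in> S" for s
  proof (rule ccontr)
    assume neg: "\<not> ?thesis"
    have in_M: "\<alpha> s \<in> M g" using neg s simple_root_pos by (simp add: M_def)
    have "M (g \<circ> refl s) \<subseteq> refl s ` (M g - {\<alpha> s})"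
    proof
      fix c assume c: "c \<in> M (g \<circ> refl s)"
      have "c \<noteq> \<alpha> s"
      proof
        assume "c = \<alpha> s"
        then have "f (neg (g (\<alpha> s))) < 0"
          using c s g by (simp add: M_def reflection_self weyl_lin_comb)
        then show False using neg by (simp add: lin)
      qed
      then have "refl s c \<in> pos" using refl_pos c s by (simp add: M_def)
      moreover have "refl s c \<noteq> \<alpha> s"
        using c s neg_pos_iff[OF simple_root_roots[OF s]] simple_root_pos[OF s]
        by (metis (no_types, lifting) M_def form_simple_self mem_Collect_eq refl_refl reflection_self)
      ultimately have "refl s c \<in> M g - {\<alpha> s}" using c by (simp add: M_def)
      then show "c \<in> refl s ` (M g - {\<alpha> s})" using s by (metis imageI refl_refl)
    qed
    then have "card (M (g \<circ> refl s)) \<le> card (M g - {\<alpha> s})"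
      using finM[OF g] by (meson card_image_le card_mono finite_Diff finite_imageI order_trans)
    also have "\<dots> < card (M g)" using in_M finM[OF g] by (meson card_Diff1_less)
    finally show False using least[OF comp_weyl[OF g refl_weyl[OF s]]] by simp
  qed
  \<comment> \<open>The walls on which the moved functional lies. As its values at simple roots are
    nonnegative, it vanishes on a positive root exactly when the root is supported in
    \<open>I\<close>.\<close>
  define I where "I = {s \<in> S. f (g (\<alpha> s)) = 0}"
  have expand: "f (g c) = (\<Sum>s\<in>S. c s * f (g (\<alpha> s)))" if "c \<in> roots" for c
    by (rule functional_expand[of "\<lambda>v. f (g v)"])
      (use lin weyl_lin_comb[OF g] finite_S root_outside[OF that] in auto)
  have iff: "c \<in> support_roots I \<longleftrightarrow> f (g c) = 0" if c: "c \<in> pos" for c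
  proof
    assume "c \<in> support_roots I"
    then have "c s * f (g (\<alpha> s)) = 0" if "s \<in> S" for s
      using that by (cases "s \<in> I") (auto simp: I_def support_roots_def)
    then have "(\<Sum>s\<in>S. c s * f (g (\<alpha> s))) = 0" by (intro sum.neutral ballI)
    then show "f (g c) = 0" unfolding expand[OF pos_roots[OF c]] .
  next
    assume "f (g c) = 0"
    moreover have "0 \<le> c s * f (g (\<alpha> s))" if "s \<in> S" for s
      using nn[OF that] pos_nonneg[OF c] by (simp add: nonneg_def)
    ultimately have "\<forall>s\<in>S. c s * f (g (\<alpha> s)) = 0"
      using expand[OF pos_roots[OF c]]
        sum_nonneg_eq_0_iff[OF finite_S, of "\<lambda>s. c s * f (g (\<alpha> s))"] by metis
    then have "c x = 0" if "x \<notin> I" for x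
      using that root_outside[OF pos_roots[OF c]] by (cases "x \<in> S") (auto simp: I_def)
    then show "c \<in> support_roots I" using pos_roots[OF c] by (simp add: support_roots_def)
  qed
  have iff': "c \<in> support_roots I \<longleftrightarrow> f (g c) = 0" if c: "c \<in> roots" for c
  proof (cases "c \<in> pos")
    case False
    then have "neg c \<in> support_roots I \<longleftrightarrow> f (g (neg c)) = 0" using iff neg_pos_iff c by blast
    then show ?thesis
      using c neg_roots[OF c] by (simp add: weyl_lin_comb[OF g] lin support_roots_def) (simp add: lin_comb_def)
  qed (rule iff)
  have "g ` support_roots I \<subseteq> Z \<union> neg ` Z"
  proof
    fix e assume "e \<in> g ` support_roots I"
    then obtain c where c: "c \<in> support_roots I" "e = g c" by blast
    then have e: "e \<in> roots" "f e = 0" using iff' weyl_roots[OF g] by (auto simp: support_roots_def)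
    show "e \<in> Z \<union> neg ` Z"
    proof (cases "e \<in> pos")
      case False
      then have "neg e \<in> Z" using e neg_pos_iff by (simp add: Z_def lin)
      then show ?thesis by (intro UnI2 image_eqI[of _ _ "neg e"]) simp_all
    qed (use e in \<open>simp add: Z_def\<close>)
  qed
  then have "finite (g ` support_roots I)" by (rule finite_subset) (use finZ in simp)
  then have "finite (support_roots I)"
    by (rule finite_imageD) (simp add: inj_on_def weyl_inject[OF g])
  moreover have "ginv g c \<in> support_roots I" if "c \<in> roots" "c \<in> plane a b" for c
    using iff'[OF weyl_roots[OF ginv_weyl[OF g] that(1)]] zero[OF that] g by simp
  ultimately show ?thesis
    using that[of "ginv g" I] ginv_weyl[OF g] a b plane_left plane_right by (auto simp: I_def)
qed

text \<open>The form is invariant, so each such value already occurs inside one of the finite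
  systems \<open>support_roots I\<close>, and there are finitely many sets \<open>I\<close>.\<close>

lemma finite_form_values: "finite {form a b | a b. a \<in> roots \<and> b \<in> roots \<and> \<bar>form a b\<bar> < 1}"
proof (rule finite_subset)
  let ?I = "{I. I \<subseteq> S \<and> finite (support_roots I)}"
  let ?U = "\<Union>I\<in>?I. (\<lambda>(a, b). form a b) ` (support_roots I \<times> support_roots I)"
  show "finite ?U" using finite_S by auto
  show "{form a b | a b. a \<in> roots \<and> b \<in> roots \<and> \<bar>form a b\<bar> < 1} \<subseteq> ?U"
  proof clarify
    fix a b assume "a \<in> roots" "b \<in> roots" "\<bar>form a b\<bar> < 1"
    then obtain g I where "g \<in> weyl" "I \<subseteq> S" "finite (support_roots I)"
      "g a \<in> support_roots I" "g b \<in> support_roots I"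
      by (rule definite_plane_in_finite_parabolic)
    moreover from this have "form a b = (\<lambda>(a, b). form a b) (g a, g b)" by (simp add: form_weyl)
    ultimately show "form a b \<in> ?U" by blast
  qed
qed

section \<open>Small roots\<close>

text \<open>The dominance order of Brink and Howlett, stated through inversion sets.\<close>

definition dominates :: "'a vec \<Rightarrow> 'a vec \<Rightarrow> bool" where
  "dominates b d \<longleftrightarrow> (\<forall>g\<in>weyl. b \<in> \<N> g \<longrightarrow> d \<in> \<N> g)"

definition small :: "'a vec \<Rightarrow> bool" where
  "small b \<longleftrightarrow> b \<in> pos \<and> (\<forall>d\<in>pos. dominates b d \<longrightarrow> d = b)"

lemma inversion_of_root:
  assumes "b \<in> pos"
  obtains g s where "g \<in> weyl" "s \<in> S" "\<N> (g \<circ> refl s) = insert b (\<N> g)" "b \<notin> \<N> g"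
    "g \<circ> refl s \<in> weyl"
proof -
  obtain g s where g: "g \<in> weyl" "s \<in> S" "b = g (\<alpha> s)"
    using assms by (auto simp: pos_def roots_def)
  then show ?thesis using that[of g s] inversions_comp_refl[OF g(2,1)] assms comp_weyl refl_weyl by simp
qed

text \<open>Take a step at which \<open>b\<close> is the only new inversion: \<open>d\<close> is an
  inversion after the step but not before it.\<close>

lemma dominates_antisym:
  assumes "b \<in> pos" "dominates b d" "dominates d b" shows "b = d"
proof -
  obtain g s where g: "g \<in> weyl" "\<N> (g \<circ> refl s) = insert b (\<N> g)" "b \<notin> \<N> g"
    "g \<circ> refl s \<in> weyl" using inversion_of_root[OF assms(1)] by metis
  have "d \<in> \<N> (g \<circ> refl s)" using assms(2) g unfolding dominates_def by blast
  moreover have "d \<notin> \<N> g" using assms(3) g unfolding dominates_def by blast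
  ultimately show ?thesis using g(2) by simp
qed

text \<open>The roots dominated by \<open>b\<close> lie in a single inversion set, so they are
  finite in number and passing to dominated roots terminates.\<close>

lemma dominated_small:
  "b \<in> pos \<Longrightarrow> \<exists>d. small d \<and> dominates b d"
proof (induction "card {d \<in> pos. dominates b d}" arbitrary: b rule: less_induct)
  case less
  show ?case
  proof (cases "small b")
    case True
    then show ?thesis by (auto simp: dominates_def)
  next
    case False
    then obtain d where d: "d \<in> pos" "dominates b d" "d \<noteq> b" using less.prems by (auto simp: small_def)
    have tr: "dominates b e" if "dominates d e" for e using d(2) that unfolding dominates_def by blast
    have "b \<notin> {e \<in> pos. dominates d e}" using dominates_antisym less.prems d by blast
    moreover have "b \<in> {e \<in> pos. dominates b e}" using less.prems by (simp add: dominates_def)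
    ultimately have sub: "{e \<in> pos. dominates d e} \<subset> {e \<in> pos. dominates b e}" using tr by blast
    obtain g s where "\<N> (g \<circ> refl s) = insert b (\<N> g)" "g \<circ> refl s \<in> weyl"
      using inversion_of_root[OF less.prems] by metis
    then have "{e \<in> pos. dominates b e} \<subseteq> \<N> (g \<circ> refl s)" unfolding dominates_def by blast
    then have "finite {e \<in> pos. dominates b e}" using finite_inversions \<open>g \<circ> refl s \<in> weyl\<close> finite_subset by blast
    then obtain e where "small e" "dominates d e" using less.hyps[OF _ d(1)] sub psubset_card_mono by blast
    then show ?thesis using tr by blast
  qed
qed

text \<open>A common inversion of \<open>v\<close> and \<open>w\<close> dominates a small root,
  which is then a common inversion as well.\<close>

lemma cone_type_small:
  "w \<in> weyl \<Longrightarrow> cone_type w = {v \<in> weyl. \<N> v \<inter> (\<N> w \<inter> Collect small) = {}}"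
proof -
  assume w: "w \<in> weyl"
  have "\<exists>d. small d \<and> d \<in> \<N> v \<and> d \<in> \<N> w" if "v \<in> weyl" "b \<in> \<N> v" "b \<in> \<N> w" for v b
    using dominated_small[of b] inversions_pos that w unfolding dominates_def by blast
  then show ?thesis unfolding cone_type_def by blast
qed

text \<open>In the infinite dihedral group generated by the two reflections, the positive roots
  \<open>x b - y d\<close> with \<open>x > y \<ge> 0\<close> are infinite in number, and all of them are inversions of an element
  that inverts \<open>b\<close> but not \<open>d\<close>.\<close>

lemma dominates_if_form_ge_1:
  assumes b: "b \<in> pos" and d: "d \<in> pos" and ge: "1 \<le> form b d"
    and coeff: "\<And>x y. 0 \<le> y \<Longrightarrow> y < x \<Longrightarrow> \<exists>p. 0 < lin_comb x b (- y) d p"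
  shows "dominates b d"
  unfolding dominates_def
proof (intro ballI impI, rule ccontr)
  fix g assume g: "g \<in> weyl" "b \<in> \<N> g" "d \<notin> \<N> g"
  define k where "k = form b d"
  have k: "1 \<le> k" using ge by (simp add: k_def)
  have f: "form b b = 1" "form d d = 1" "form d b = k" using b d pos_roots form_sym by (auto simp: k_def)
  \<comment> \<open>The effect of \<open>reflection b \<circ> reflection d\<close> on the
    coordinates \<open>x\<close>, \<open>y\<close> of the vector \<open>x b - y d\<close>.\<close>
  define step where "step = (\<lambda>(x, y). ((4 * k * k - 1) * x - 2 * k * y, 2 * k * x - y))"
  define xy where "xy n = (step ^^ n) (1, 0 :: real)" for n
  define r where "r n = lin_comb (fst (xy n)) b (- snd (xy n)) d" for n
  have rec: "xy (Suc n) = ((4 * k * k - 1) * fst (xy n) - 2 * k * snd (xy n), 2 * k * fst (xy n) - snd (xy n))" for n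
    by (simp add: xy_def step_def case_prod_beta)
  have inv: "0 \<le> snd (xy n) \<and> snd (xy n) < fst (xy n)" for n
  proof (induction n)
    case (Suc n)
    let ?x = "fst (xy n)" and ?y = "snd (xy n)"
    have "1 * ?x \<le> k * ?x" using k Suc by (intro mult_right_mono) auto
    moreover have "0 \<le> (4 * k * (k - 1)) * ?x" using k Suc by (intro mult_nonneg_nonneg) auto
    moreover have "0 < (2 * k - 1) * (?x - ?y)" using k Suc by (intro mult_pos_pos) auto
    moreover have "((4 * k * k - 1) * ?x - 2 * k * ?y) - (2 * k * ?x - ?y)
      = (4 * k * (k - 1)) * ?x + (2 * k - 1) * (?x - ?y)" by (simp add: algebra_simps)
    ultimately show ?case unfolding rec fst_conv snd_conv using Suc by linarith
  qed (simp add: xy_def)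
  have incr: "fst (xy n) \<le> fst (xy (Suc n)) \<and> snd (xy n) < snd (xy (Suc n))" for n
  proof -
    let ?x = "fst (xy n)" and ?y = "snd (xy n)"
    have 1: "1 * ?x \<le> k * ?x" using k inv[of n] by (intro mult_right_mono) auto
    have "0 \<le> (4 * k * k - 2) * (?x - ?y)"
      using k inv[of n] mult_mono[of 1 k 1 k] by (intro mult_nonneg_nonneg) auto
    moreover have "0 \<le> 2 * (2 * k + 1) * (k - 1) * ?y" using k inv[of n] by (intro mult_nonneg_nonneg) auto
    moreover have "((4 * k * k - 1) * ?x - 2 * k * ?y) - ?x
      = (4 * k * k - 2) * (?x - ?y) + 2 * (2 * k + 1) * (k - 1) * ?y" by (simp add: algebra_simps)
    ultimately show ?thesis unfolding rec fst_conv snd_conv using 1 inv[of n] by linarith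
  qed
  have roots: "r n \<in> roots" for n
  proof (induction n)
    case 0
    then show ?case using b pos_roots by (simp add: r_def xy_def)
  next
    case (Suc n)
    have "r (Suc n) = reflection b (reflection d (r n))"
      unfolding r_def rec reflection_def fst_conv snd_conv form_lin_comb_left f k_def[symmetric]
      by (auto simp: lin_comb_def algebra_simps)
    then show ?case using Suc weyl_roots reflection_weyl b d pos_roots by simp
  qed
  \<comment> \<open>Height measured after \<open>ginv g\<close>: negative at \<open>b\<close>,
    positive at \<open>d\<close>, hence strictly decreasing along \<open>r\<close>. This gives both
    injectivity of \<open>r\<close> and negativity of every \<open>ginv g (r n)\<close>.\<close>
  define h where "h v = height (ginv g v)" for v
  have gi: "ginv g \<in> weyl" using ginv_weyl g by blast
  have hb: "h b < 0" and hd: "0 < h d"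
    using g b d height_pos height_not_pos weyl_roots[OF gi] pos_roots by (auto simp: inversions_def h_def)
  have hr: "h (r n) = fst (xy n) * h b - snd (xy n) * h d" for n
    by (simp add: h_def r_def weyl_lin_comb[OF gi])
  have "strict_mono (\<lambda>n. - h (r n))"
  proof (rule strict_mono_Suc_iff[THEN iffD2], rule allI)
    fix n
    have "fst (xy (Suc n)) * h b \<le> fst (xy n) * h b" using incr[of n] hb by (intro mult_right_mono_neg) auto
    moreover have "snd (xy n) * h d < snd (xy (Suc n)) * h d" using incr[of n] hd by (intro mult_strict_right_mono) auto
    ultimately show "- h (r n) < - h (r (Suc n))" unfolding hr by linarith
  qed
  then have "inj r" by (metis injI strict_mono_eq)
  moreover have "range r \<subseteq> \<N> g"
  proof
    fix c assume "c \<in> range r"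
    then obtain n where n: "c = r n" by blast
    \<comment> \<open>Here \<open>coeff\<close> breaks the symmetry between \<open>b\<close> and
      \<open>d\<close>, which the bound on the form does not see.\<close>
    obtain p where "0 < r n p" using coeff inv[of n] unfolding r_def by blast
    then have "r n \<in> pos" using root_pos_if_coeff roots by blast
    moreover have "h (r n) < 0"
      unfolding hr using inv[of n] hb hd mult_pos_neg[of "fst (xy n)" "h b"] mult_nonneg_nonneg[of "snd (xy n)" "h d"]
      by linarith
    then have "ginv g (r n) \<notin> pos" using height_pos by (auto simp: h_def dest: less_asym)
    ultimately show "c \<in> \<N> g" using n by (simp add: inversions_def)
  qed
  ultimately show False using finite_inversions[OF g(1)] by (meson finite_imageD finite_subset infinite_UNIV_nat)
qed

lemma small_pos: "small b \<Longrightarrow> b \<in> pos"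
  by (simp add: small_def)

text \<open>Otherwise \<open>b\<close> would dominate \<alpha> s; the coefficient condition holds at
  a coordinate of \<open>b\<close> other than \<open>s\<close>.\<close>

lemma small_form_less_1:
  assumes b: "small b" and s: "s \<in> S" "b \<noteq> \<alpha> s" shows "form b (\<alpha> s) < 1"
proof (rule ccontr)
  assume "\<not> ?thesis"
  then have ge: "1 \<le> form b (\<alpha> s)" by simp
  obtain p where p: "p \<noteq> s" "0 < b p" using pos_other_coeff[OF small_pos[OF b] s] .
  have "dominates b (\<alpha> s)"
    by (rule dominates_if_form_ge_1[OF small_pos[OF b] simple_root_pos[OF s(1)] ge])
      (use p in \<open>auto intro!: exI[of _ p] simp: lin_comb_def simple_root_def\<close>)
  then show False using b s simple_root_pos by (auto simp: small_def)
qed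

section \<open>Depth of roots and chains of small roots\<close>

definition depth :: "'a vec \<Rightarrow> nat" where
  "depth b = (LEAST n. \<exists>g\<in>weyl. len g = n \<and> b \<in> \<N> g)"

lemma depth_le: "g \<in> weyl \<Longrightarrow> b \<in> \<N> g \<Longrightarrow> depth b \<le> len g"
  unfolding depth_def by (rule Least_le) auto

text \<open>Take a shortest \<open>g\<close> that inverts \<open>b\<close>. If it also inverts
  \<alpha> s, remove \<open>s\<close> in front; otherwise \<open>b\<close> is its last inversion and
  \<open>refl s b\<close> is inverted before the last letter. That \<alpha> s is not an inversion
  shows moreover that \<open>refl s b\<close> does not dominate \<alpha> s.\<close>

lemma depth_decrease:
  assumes b: "b \<in> pos" and s: "s \<in> S" "b \<noteq> \<alpha> s" and f: "0 < form b (\<alpha> s)"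
  obtains g where "g \<in> weyl" "refl s b \<in> \<N> g" "\<alpha> s \<notin> \<N> g" "len g < depth b"
proof -
  have "\<exists>n. \<exists>g\<in>weyl. len g = n \<and> b \<in> \<N> g"
    using inversion_of_root[OF b] by (metis insertI1)
  from LeastI_ex[OF this] obtain g where g: "g \<in> weyl" "len g = depth b" "b \<in> \<N> g"
    unfolding depth_def by blast
  show ?thesis
  proof (cases "\<alpha> s \<in> \<N> g")
    case True
    note down = inversions_refl_comp_down[OF s(1) g(1) True]
    have W: "refl s \<circ> g \<in> weyl" using comp_weyl refl_weyl s g by blast
    have "b \<in> refl s ` \<N> (refl s \<circ> g)" using g(3) s(2) unfolding down(1) by blast
    then have "refl s b \<in> \<N> (refl s \<circ> g)" using s(1) by auto
    moreover have "\<alpha> s \<notin> \<N> (refl s \<circ> g)" using simple_inversion_refl_comp s g True by blast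
    ultimately show ?thesis using that[OF W] len_refl_comp_down[OF s(1) g(1) True] g(2) by simp
  next
    case False
    have "g \<noteq> id" using g by auto
    then obtain g' r where g': "g' \<in> weyl" "r \<in> S" "\<N> g = insert (g' (\<alpha> r)) (\<N> g')"
      "len g = Suc (len g')" using obtain_last_step[OF g(1)] by metis
    have "b \<notin> \<N> g'" using depth_le[OF g'(1), of b] g g' by auto
    then have bg': "b = g' (\<alpha> r)" using g g' by blast
    have sb: "refl s b \<in> \<N> g"
    proof (rule ccontr)
      assume "refl s b \<notin> \<N> g"
      moreover have "b = lin_comb 1 (refl s b) (2 * form b (\<alpha> s)) (\<alpha> s)"
        by (simp add: reflection_def lin_comb_def)
      ultimately show False
        using inversions_cocone[OF g(1), of 1 "2 * form b (\<alpha> s)" "refl s b" "\<alpha> s"]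
          refl_pos[OF b s] simple_root_pos[OF s(1)] False f g(3) pos_roots[OF b] by simp
    qed
    have "refl s b \<noteq> b"
    proof
      assume "refl s b = b"
      then have "refl s b s = b s" by simp
      then show False using f by (simp add: reflection_def lin_comb_def simple_root_def)
    qed
    then have "refl s b \<in> \<N> g'" using sb g' bg' by blast
    then show ?thesis using that[OF g'(1)] False g' g by auto
  qed
qed

text \<open>A root \<open>d\<close> dominated by \<open>refl s b\<close> is not \<alpha> s, by
  \<open>depth_decrease\<close>, so it stays positive under \<open>refl s\<close>. Dominance is
  carried along by \<open>refl s\<close>, and smallness of \<open>b\<close> finishes.\<close>

lemma small_step:
  assumes b: "small b" and s: "s \<in> S" "b \<noteq> \<alpha> s" and f: "0 < form b (\<alpha> s)"
  shows "small (refl s b)"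
  unfolding small_def
proof (intro conjI ballI impI)
  show sbp: "refl s b \<in> pos" using refl_pos small_pos b s by blast
  fix d assume d: "d \<in> pos" "dominates (refl s b) d"
  obtain g where g: "g \<in> weyl" "refl s b \<in> \<N> g" "\<alpha> s \<notin> \<N> g"
    using depth_decrease[OF small_pos[OF b] s f] by metis
  have ds: "d \<noteq> \<alpha> s" using d(2) g unfolding dominates_def by blast
  then have sd: "refl s d \<in> pos" using refl_pos d s by blast
  have "dominates b (refl s d)"
    unfolding dominates_def
  proof (intro ballI impI)
    fix h assume h: "h \<in> weyl" "b \<in> \<N> h"
    have W: "refl s \<circ> h \<in> weyl" using comp_weyl refl_weyl s h by blast
    have gi: "ginv (refl s \<circ> h) v = ginv h (refl s v)" for v using s h refl_weyl by (simp add: ginv_comp)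
    have "refl s b \<in> \<N> (refl s \<circ> h)" using h sbp s by (simp add: inversions_def gi)
    then have "d \<in> \<N> (refl s \<circ> h)" using d(2) W unfolding dominates_def by blast
    then show "refl s d \<in> \<N> h" using sd by (simp add: inversions_def gi)
  qed
  then have "refl s d = b" using b sd by (simp add: small_def)
  then show "d = refl s b" using s by auto
qed

definition small_chain :: "nat \<Rightarrow> (nat \<Rightarrow> 'a) \<Rightarrow> (nat \<Rightarrow> 'a \<Rightarrow> real) \<Rightarrow> bool" where
  "small_chain n \<sigma> \<beta> \<longleftrightarrow> (\<forall>i\<le>n. small (\<beta> i)) \<and> (\<forall>i<n. \<sigma> i \<in> S \<and> \<beta> (Suc i) = refl (\<sigma> i) (\<beta> i)
      \<and> -1 < form (\<beta> i) (\<alpha> (\<sigma> i)) \<and> form (\<beta> i) (\<alpha> (\<sigma> i)) < 0)"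

text \<open>The chain is built downwards. As \<open>form b b = 1\<close> is the sum of the terms
  \<open>b s * form b (\<alpha> s)\<close>, some simple reflection lowers \<open>b\<close>; it stays
  small by \<open>small_step\<close> and loses depth. The bound -1 is
  \<open>small_form_less_1\<close> read in the upward direction.\<close>

lemma small_chain_exists:
  "small b \<Longrightarrow> \<exists>n \<sigma> \<beta>. small_chain n \<sigma> \<beta> \<and> \<beta> 0 \<in> \<alpha> ` S \<and> \<beta> n = b"
proof (induction "depth b" arbitrary: b rule: less_induct)
  case less
  show ?case
  proof (cases "b \<in> \<alpha> ` S")
    case True
    have "small_chain 0 (\<lambda>_. undefined) (\<lambda>_. b)" using less.prems by (simp add: small_chain_def)
    then show ?thesis using True by blast
  next
    case False
    have bp: "b \<in> pos" using small_pos less.prems by blast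
    have "\<exists>s\<in>S. 0 < b s * form b (\<alpha> s)"
    proof (rule ccontr)
      assume "\<not> ?thesis"
      then have "(\<Sum>s\<in>S. b s * form b (\<alpha> s)) \<le> 0" by (intro sum_nonpos) (auto simp: not_less)
      then show False using form_expand_right[of b b] form_root[OF pos_roots[OF bp]] by simp
    qed
    then obtain s where s: "s \<in> S" "0 < b s * form b (\<alpha> s)" by blast
    then have f: "0 < form b (\<alpha> s)"
      using pos_nonneg[OF bp] unfolding nonneg_def by (metis zero_less_mult_iff not_le)
    have ne: "b \<noteq> \<alpha> s" using False s by blast
    obtain g where "g \<in> weyl" "refl s b \<in> \<N> g" "len g < depth b"
      using depth_decrease[OF bp s(1) ne f] by metis
    then have "depth (refl s b) < depth b" using depth_le by (meson le_less_trans)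
    then obtain n \<sigma> \<beta> where c: "small_chain n \<sigma> \<beta>" "\<beta> 0 \<in> \<alpha> ` S" "\<beta> n = refl s b"
      using less.hyps small_step[OF less.prems s(1) ne f] by blast
    have fs: "form (refl s b) (\<alpha> s) = - form b (\<alpha> s)"
      using s by (simp add: reflection_def)
    have "small_chain (Suc n) (\<sigma>(n := s)) (\<beta>(Suc n := b))"
      unfolding small_chain_def
    proof (intro conjI allI impI)
      fix i
      show "small ((\<beta>(Suc n := b)) i)" if "i \<le> Suc n" using that c(1) less.prems by (auto simp: small_chain_def)
      assume i: "i < Suc n"
      show "(\<sigma>(n := s)) i \<in> S"
        and "(\<beta>(Suc n := b)) (Suc i) = refl ((\<sigma>(n := s)) i) ((\<beta>(Suc n := b)) i)"
        and "-1 < form ((\<beta>(Suc n := b)) i) (\<alpha> ((\<sigma>(n := s)) i))"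
        and "form ((\<beta>(Suc n := b)) i) (\<alpha> ((\<sigma>(n := s)) i)) < 0"
        using i c s fs f small_form_less_1[OF less.prems s(1) ne]
        by (cases "i = n"; simp add: small_chain_def)+
    qed
    moreover have "(\<beta>(Suc n := b)) 0 \<in> \<alpha> ` S" "(\<beta>(Suc n := b)) (Suc n) = b" using c by auto
    ultimately show ?thesis by blast
  qed
qed

text \<open>1 is the value of a simple root with itself; -1 stands for all values at most -1, which
  need not be finite in number and are cut off by \<open>chain_state\<close>.\<close>

definition form_values :: "real set" where
  "form_values = {-1, 1} \<union> {form a b | a b. a \<in> roots \<and> b \<in> roots \<and> \<bar>form a b\<bar> < 1}"

definition chain_state :: "'a vec \<Rightarrow> 'a vec" where
  "chain_state b = restrict (\<lambda>s. max (-1) (form b (\<alpha> s))) S"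

text \<open>Once \<open>form \<beta> (\<alpha> s) \<le> -1\<close>, the letter \<open>s\<close> is never used again. If two members of a chain
  have the same state, their difference \<open>\<lambda> \<ge> 0\<close> is isotropic, so that the later one dominates the earlier.\<close>

lemma small_chain_bound:
  assumes c: "small_chain n \<sigma> \<beta>"
  shows "n < card (PiE S (\<lambda>_. form_values))"
proof (rule ccontr)
  assume "\<not> ?thesis"
  let ?P = "PiE S (\<lambda>_. form_values)"
  have fin: "finite ?P" using finite_S finite_form_values by (intro finite_PiE) (auto simp: form_values_def)
  have "chain_state (\<beta> i) \<in> ?P" if "i \<le> n" for i
  proof -
    have sm: "small (\<beta> i)" using c that by (simp add: small_chain_def)
    have "max (-1) (form (\<beta> i) (\<alpha> s)) \<in> form_values" if s: "s \<in> S" for s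
    proof (cases "\<beta> i = \<alpha> s \<or> form (\<beta> i) (\<alpha> s) \<le> -1")
      case True
      then show ?thesis using s by (auto simp: form_values_def)
    next
      case False
      then have "\<bar>form (\<beta> i) (\<alpha> s)\<bar> < 1" using small_form_less_1[OF sm s] by auto
      then show ?thesis
        using pos_roots[OF small_pos[OF sm]] simple_root_roots[OF s] by (auto simp: form_values_def max_def)
    qed
    then show ?thesis by (auto simp: chain_state_def)
  qed
  then have sub: "(\<lambda>i. chain_state (\<beta> i)) ` {..n} \<subseteq> ?P" by (intro image_subsetI) simp
  have "\<not> inj_on (\<lambda>i. chain_state (\<beta> i)) {..n}"
  proof
    assume "inj_on (\<lambda>i. chain_state (\<beta> i)) {..n}"
    from card_inj_on_le[OF this sub fin] show False using \<open>\<not> n < card ?P\<close> by simp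
  qed
  then obtain i j where ij: "i < j" "j \<le> n" "chain_state (\<beta> i) = chain_state (\<beta> j)"
    unfolding inj_on_def by (metis atMost_iff linorder_neqE_nat)
  have state: "max (-1) (form (\<beta> i) (\<alpha> s)) = max (-1) (form (\<beta> j) (\<alpha> s))" if "s \<in> S" for s
    using fun_cong[OF ij(3), of s] that by (simp add: chain_state_def)
  have sm: "small (\<beta> k)" if "k \<le> n" for k using c that by (simp add: small_chain_def)
  have evol: "(\<forall>x. \<beta> i x \<le> \<beta> k x) \<and> (i < k \<longrightarrow> height (\<beta> i) < height (\<beta> k)) \<and>
      (\<forall>s\<in>S. form (\<beta> i) (\<alpha> s) \<le> -1 \<longrightarrow> \<beta> k s = \<beta> i s \<and> form (\<beta> k) (\<alpha> s) \<le> -1)"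
    if "i \<le> k" "k \<le> n" for k
    using that
  proof (induction k rule: dec_induct)
    case (step k)
    define t where "t = \<sigma> k"
    define e where "e = - 2 * form (\<beta> k) (\<alpha> t)"
    have t: "t \<in> S" "\<beta> (Suc k) = lin_comb 1 (\<beta> k) e (\<alpha> t)" "-1 < form (\<beta> k) (\<alpha> t)" "0 < e"
      using c step by (auto simp: small_chain_def t_def e_def reflection_def)
    have IH: "\<forall>x. \<beta> i x \<le> \<beta> k x" "i < k \<longrightarrow> height (\<beta> i) < height (\<beta> k)"
      "\<forall>s\<in>S. form (\<beta> i) (\<alpha> s) \<le> -1 \<longrightarrow> \<beta> k s = \<beta> i s \<and> form (\<beta> k) (\<alpha> s) \<le> -1"
      using step by auto
    have "\<beta> i x \<le> \<beta> (Suc k) x" for x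
      using IH(1) t(4) by (auto simp: t(2) lin_comb_def simple_root_def intro: add_increasing2)
    moreover have "height (\<beta> i) < height (\<beta> (Suc k))"
      using IH(2) t(1,4) step.hyps by (cases "i = k") (auto simp: t(2))
    moreover have "\<beta> (Suc k) s = \<beta> i s \<and> form (\<beta> (Suc k)) (\<alpha> s) \<le> -1"
      if s: "s \<in> S" "form (\<beta> i) (\<alpha> s) \<le> -1" for s
    proof -
      have k: "\<beta> k s = \<beta> i s" "form (\<beta> k) (\<alpha> s) \<le> -1" using IH(3) s by auto
      then have ts: "t \<noteq> s" using t(3) by auto
      \<comment> \<open>A step by another letter can only lower the value at \<open>s\<close>, so a
        value that is at most -1 stays so.\<close>
      have "e * gram t s \<le> 0" using gram_nonpos[OF t(1) s(1) ts] t(4) by (simp add: mult_nonneg_nonpos)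
      then show ?thesis using k ts t(1) s(1) by (simp add: t(2) form_simple_simple) (simp add: lin_comb_def simple_root_def)
    qed
    ultimately show ?case by blast
  qed simp
  note pj = evol[of j]
  define l where "l = lin_comb 1 (\<beta> j) (-1) (\<beta> i)"
  \<comment> \<open>Either \<open>s\<close> is frozen and its coordinate has not changed, or the
    state at \<open>s\<close> is not cut off and equal states mean equal values of the form.\<close>
  have "l s * form l (\<alpha> s) = 0" if s: "s \<in> S" for s
  proof (cases "form (\<beta> i) (\<alpha> s) \<le> -1")
    case True
    then have "l s = 0" using pj ij s by (simp add: l_def lin_comb_def)
    then show ?thesis by simp
  next
    case False
    then have "form (\<beta> j) (\<alpha> s) = form (\<beta> i) (\<alpha> s)" using state[OF s] by (auto simp: max_def split: if_splits)
    then show ?thesis by (simp add: l_def)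
  qed
  then have "form l l = 0" unfolding form_expand_right[of l l] by (intro sum.neutral ballI)
  moreover have "form (\<beta> i) (\<beta> i) = 1" "form (\<beta> j) (\<beta> j) = 1" using sm ij small_pos pos_roots by auto
  ultimately have ge: "1 \<le> form (\<beta> j) (\<beta> i)" by (simp add: l_def form_sym[of "\<beta> i" "\<beta> j"])
  have "dominates (\<beta> j) (\<beta> i)"
  proof (rule dominates_if_form_ge_1[OF _ _ ge])
    show "\<beta> j \<in> pos" "\<beta> i \<in> pos" using sm small_pos ij by auto
    then obtain p where p: "0 < \<beta> j p" using pos_coeff by blast
    fix x y :: real assume y: "0 \<le> y" "y < x"
    have "y * \<beta> i p \<le> y * \<beta> j p" using pj ij y by (intro mult_left_mono) auto
    also have "\<dots> < x * \<beta> j p" using y p by simp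
    finally show "\<exists>p. 0 < lin_comb x (\<beta> j) (- y) (\<beta> i) p" by (auto simp: lin_comb_def intro!: exI[of _ p])
  qed
  moreover have "small (\<beta> j)" "\<beta> i \<in> pos" using sm small_pos ij by auto
  ultimately have "\<beta> i = \<beta> j" unfolding small_def by blast
  moreover have "height (\<beta> i) < height (\<beta> j)" using pj ij by auto
  ultimately show False by simp
qed

text \<open>Every small root ends a chain from a simple root, and a chain of length \<open>n\<close>
  is the action of a word of \<open>n\<close> letters; \<open>small_chain_bound\<close> bounds
  \<open>n\<close>.\<close>

lemma finite_small: "finite (Collect small)"
proof -
  define N where "N = card (PiE S (\<lambda>_. form_values))"
  have word: "\<exists>w\<in>lists S. length w = k \<and> \<beta> k = act w (\<beta> 0)" if "small_chain n \<sigma> \<beta>" "k \<le> n" for n \<sigma> \<beta> k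
    using that(2)
  proof (induction k)
    case (Suc k)
    then obtain w where "w \<in> lists S" "length w = k" "\<beta> k = act w (\<beta> 0)" by auto
    then show ?case using that Suc.prems by (intro bexI[of _ "\<sigma> k # w"]) (auto simp: small_chain_def)
  qed (auto intro: bexI[of _ "[]"])
  have "Collect small \<subseteq> (\<lambda>(w, s). act w (\<alpha> s)) ` ({w. set w \<subseteq> S \<and> length w \<le> N} \<times> S)"
  proof
    fix b assume "b \<in> Collect small"
    then obtain n \<sigma> \<beta> where c: "small_chain n \<sigma> \<beta>" "\<beta> 0 \<in> \<alpha> ` S" "\<beta> n = b"
      using small_chain_exists by blast
    obtain w where w: "w \<in> lists S" "length w = n" "\<beta> n = act w (\<beta> 0)" using word[OF c(1), of n] by blast
    then show "b \<in> (\<lambda>(w, s). act w (\<alpha> s)) ` ({w. set w \<subseteq> S \<and> length w \<le> N} \<times> S)"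
      using c small_chain_bound[OF c(1)] by (force simp: N_def lists_eq_set)
  qed
  then show ?thesis using finite_lists_length_le[OF finite_S] finite_S by (meson finite_SigmaI finite_imageI finite_subset)
qed

lemma finite_gates: "finite (Collect gate)"
proof -
  have "cone_type ` Collect gate \<subseteq> (\<lambda>A. {v \<in> weyl. \<N> v \<inter> A = {}}) ` Pow (Collect small)"
    using cone_type_small gate_weyl by blast
  then have "finite (cone_type ` Collect gate)"
    using finite_small by (meson finite_Pow_iff finite_imageI finite_subset)
  then show ?thesis using finite_imageD inj_on_cone_type_gate by blast
qed

section \<open>The Artin--Tits monoid\<close>

abbreviation cong (infix "\<approx>" 50) where
  "u \<approx> v \<equiv> (u, v) \<in> presentation_congruence S (braid_relations S m)"

lemma cong_lists: "u \<approx> v \<Longrightarrow> u \<in> lists S \<and> v \<in> lists S"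
  by (rule presentation_congruence_lists[OF braid_relations_lists])

lemma cong_refl: "w \<in> lists S \<Longrightarrow> w \<approx> w"
  by (rule presentation_congruence.refl)

lemma cong_sym: "u \<approx> v \<Longrightarrow> v \<approx> u"
  by (rule presentation_congruence.sym)

lemma cong_trans [trans]: "u \<approx> v \<Longrightarrow> v \<approx> w \<Longrightarrow> u \<approx> w"
  by (rule presentation_congruence.trans)

lemma cong_append: "u \<approx> u' \<Longrightarrow> v \<approx> v' \<Longrightarrow> u @ v \<approx> u' @ v'"
  by (rule presentation_congruence_append[OF braid_relations_lists])

lemma cong_Cons: "s \<in> S \<Longrightarrow> u \<approx> v \<Longrightarrow> s # u \<approx> s # v"
  using cong_append[OF cong_refl[of "[s]"]] by simp

lemma cong_braid:
  assumes "s \<in> S" "t \<in> S" "s \<noteq> t" "m s t = enat k"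
  shows "alt k s t \<approx> alt k t s"
proof -
  have "(alt k s t, alt k t s) \<in> braid_relations S m"
    using assms by (auto simp: braid_relations_def)
  from presentation_congruence.rel[OF this, of "[]" S "[]"] show ?thesis by simp
qed

subsection \<open>Reduced words\<close>

definition reduced :: "'a list \<Rightarrow> bool" where
  "reduced w \<longleftrightarrow> w \<in> lists S \<and> length w = len (act w)"

lemma len_comp:
  assumes "g \<in> weyl" "h \<in> weyl" "\<N> (ginv g) \<inter> \<N> h = {}"
  shows "len (g \<circ> h) = len g + len h"
proof -
  have "len (g \<circ> h) = len g + card (g ` \<N> h)"
    unfolding inversions_comp(1)[OF assms]
    by (rule card_Un_disjoint) (use inversions_comp(2)[OF assms] finite_inversions assms in auto)
  also have "card (g ` \<N> h) = len h" by (rule card_image) (simp add: inj_on_def weyl_inject assms)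
  finally show ?thesis .
qed

lemma len_act_le: "w \<in> lists S \<Longrightarrow> len (act w) \<le> length w"
proof (induction w)
  case (Cons s w)
  then have s: "s \<in> S" and w: "act w \<in> weyl" "len (act w) \<le> length w" using act_weyl by auto
  have "len (refl s \<circ> act w) \<le> Suc (len (act w))"
    using len_refl_comp[OF s w(1)] len_refl_comp_down[OF s w(1)] by (cases "\<alpha> s \<in> \<N> (act w)") auto
  then show ?case using w(2) by (simp only: act_Cons length_Cons)
qed simp

lemma reduced_Nil [simp]: "reduced []"
  by (simp add: reduced_def)

lemma reduced_Cons:
  "reduced (s # w) \<longleftrightarrow> s \<in> S \<and> reduced w \<and> \<alpha> s \<notin> \<N> (act w)"
proof (cases "s \<in> S \<and> w \<in> lists S")
  case True
  then have s: "s \<in> S" and w: "act w \<in> weyl" using act_weyl by auto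
  show ?thesis
    using True len_refl_comp[OF s w] len_refl_comp_down[OF s w] len_act_le[of w]
    unfolding reduced_def act_Cons by (cases "\<alpha> s \<in> \<N> (act w)") auto
qed (auto simp: reduced_def)

lemma reduced_append:
  assumes "reduced u" "reduced v" "\<N> (ginv (act u)) \<inter> \<N> (act v) = {}"
  shows "reduced (u @ v)"
proof -
  have "act u \<in> weyl" "act v \<in> weyl" using assms act_weyl by (auto simp: reduced_def)
  then show ?thesis using assms len_comp by (simp add: reduced_def act_append)
qed

lemma reduced_exists: "g \<in> weyl \<Longrightarrow> \<exists>w. reduced w \<and> act w = g"
proof (induction "len g" arbitrary: g rule: less_induct)
  case less
  show ?case
  proof (cases "g = id")
    case False
    then obtain s where s: "s \<in> S" "\<alpha> s \<in> \<N> g" using exists_simple_inversion less.prems by blast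
    have W: "refl s \<circ> g \<in> weyl" using comp_weyl refl_weyl s less.prems by blast
    obtain w where w: "reduced w" "act w = refl s \<circ> g"
      using less.hyps[OF _ W] len_refl_comp_down[OF s(1) less.prems s(2)] by auto
    have "reduced (s # w)" unfolding reduced_Cons w(2) using s w simple_inversion_refl_comp less.prems by blast
    moreover have "act (s # w) = g" unfolding act_Cons w(2) using s by simp
    ultimately show ?thesis by blast
  qed (auto intro: exI[of _ "[]"])
qed

lemma reduced_weyl: "reduced w \<Longrightarrow> act w \<in> weyl"
  by (simp add: reduced_def act_weyl)

lemma reduced_lists: "reduced w \<Longrightarrow> w \<in> lists S"
  by (simp add: reduced_def)

lemma reduced_complement:
  assumes "reduced u" "g \<in> weyl" "act u \<preceq> g"
  obtains v where "reduced v" "reduced (u @ v)" "act (u @ v) = g"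
proof -
  note u = reduced_weyl[OF assms(1)]
  obtain v where v: "reduced v" "act v = ginv (act u) \<circ> g"
    using reduced_exists comp_weyl ginv_weyl u assms(2) by metis
  have "reduced (u @ v)" using reduced_append[OF assms(1) v(1)] weak_le_disjoint[OF u assms(2,3)] v by simp
  moreover have "act (u @ v) = g" using v u by (simp add: act_append)
  ultimately show ?thesis using that v by blast
qed

lemma reduced_alternating_word:
  assumes "s \<in> S" "t \<in> S" "s \<noteq> t" "enat k \<le> m s t"
  shows "reduced (alt k s t)"
  using assms
proof (induction k arbitrary: s t)
  case (Suc k)
  have k: "enat k \<le> m t s" using Suc.prems m_sym Suc_ile_eq order_less_imp_le by metis
  have "reduced (alt k t s)" using Suc k by blast
  moreover have "\<alpha> s \<notin> \<N> (act (alt k t s))"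
  proof
    assume "\<alpha> s \<in> \<N> (act (alt k t s))"
    then obtain i where i: "i < k" "\<alpha> s = dihedral_root t s i"
      using inversions_alternating_word[OF Suc.prems(2,1) _ k] Suc.prems(3) by auto
    have "dcoeff t s (Suc i) = 0"
      using fun_cong[OF i(2), of t] Suc.prems(3) by (simp add: dihedral_root_def lin_comb_def simple_root_def)
    moreover have "0 < dcoeff t s (Suc i)"
    proof (cases "m t s")
      case (enat n)
      then have "Suc i < n" using i(1) Suc.prems m_sym[of s t] by simp
      then show ?thesis using dcoeff_pos[OF Suc.prems(2,1) _ enat] Suc.prems(3) by simp
    next
      case infinity
      then show ?thesis using dcoeff_inf[of t s] Suc.prems(3) by simp
    qed
    ultimately show False by simp
  qed
  ultimately show ?case unfolding alternating_word.simps reduced_Cons using Suc.prems(1) by blast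
qed simp

text \<open>Induction on length. If the first letters \<open>s\<close> and \<open>t\<close> differ,
  both are inversions, so the longest alternating word in \<open>s\<close> and \<open>t\<close> is a
  prefix of the element. Both words are then congruent to words beginning with one of its two forms,
  which the braid relation exchanges.\<close>

lemma matsumoto:
  "reduced u \<Longrightarrow> reduced v \<Longrightarrow> act u = act v \<Longrightarrow> u \<approx> v"
proof (induction "length u" arbitrary: u v rule: less_induct)
  case less
  have lens: "length u = length v" using less.prems by (simp add: reduced_def)
  show ?case
  proof (cases u)
    case Nil
    then show ?thesis using lens cong_refl[of "[]"] by simp
  next
    case (Cons s u')
    then obtain t v' where v: "v = t # v'" using lens by (cases v) auto
    have s: "s \<in> S" "reduced u'" "\<alpha> s \<notin> \<N> (act u')"
      and t: "t \<in> S" "reduced v'" "\<alpha> t \<notin> \<N> (act v')"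
      using less.prems by (simp_all add: Cons v reduced_Cons)
    have IH: "a \<approx> b" if "length a < length u" "reduced a" "reduced b" "act a = act b" for a b
      using less.hyps that by blast
    have eq: "refl s \<circ> act u' = refl t \<circ> act v'" using less.prems(3) unfolding Cons v act_Cons .
    show ?thesis
    proof (cases "s = t")
      case True
      have "act u' = act v'" using eq s(1) unfolding True[symmetric] by (metis refl_comp_refl)
      then have "u' \<approx> v'" using IH[of u' v'] s t Cons by simp
      then show ?thesis using cong_Cons s Cons v True by simp
    next
      case False
      define g where "g = act u"
      have g: "g \<in> weyl" using reduced_weyl less.prems by (simp add: g_def)
      have "\<alpha> s \<in> \<N> g"
        unfolding g_def Cons act_Cons using simple_inversion_refl_comp s reduced_weyl by blast
      moreover have "\<alpha> t \<in> \<N> g"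
        unfolding g_def less.prems(3) v act_Cons using simple_inversion_refl_comp t reduced_weyl by blast
      ultimately have st: "\<alpha> s \<in> \<N> g" "\<alpha> t \<in> \<N> g" .
      obtain k where k: "m s t = enat k" using m_finite_if_descents[OF s(1) t(1) False g st] by blast
      have k': "m t s = enat k" using k m_sym s t by simp
      obtain n where n: "k = Suc n" using m_ge_2[OF s(1) t(1) False k] by (cases k) auto
      have red: "reduced (alt k s t)" using reduced_alternating_word[OF s(1) t(1) False] k by simp
      have red': "reduced (alt k t s)" using reduced_alternating_word[OF t(1) s(1)] False k' by simp
      obtain c where c: "reduced c" "reduced (alt k s t @ c)" "act (alt k s t @ c) = g"
        using reduced_complement[OF red g longest_alternating_word(3)[OF s(1) t(1) False k g st]] by metis
      have act': "act (alt k t s @ c) = g"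
        using c(3) act_braid[OF s(1) t(1) False k] by (simp add: act_append)
      have c': "reduced (alt k t s @ c)"
        using c(2) red' act' c(3) reduced_lists[OF c(1)] by (simp add: reduced_def)
      \<comment> \<open>Both words begin with \<open>a\<close>, so the induction hypothesis is
        applied to their tails.\<close>
      have step: "a # w \<approx> alt k a b @ c"
        if "a \<in> S" "reduced w" "length (a # w) = length u" "refl a \<circ> act w = g"
          "reduced (alt k a b @ c)" "act (alt k a b @ c) = g" for a b w
      proof -
        have "refl a \<circ> act (alt n b a @ c) = g" using that(6) unfolding n by simp
        then have "act w = act (alt n b a @ c)" using that(1,4) by (metis refl_comp_refl)
        moreover have "reduced (alt n b a @ c)" using that(5) by (simp add: n reduced_Cons)
        ultimately have "w \<approx> alt n b a @ c" using IH that by simp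
        then show ?thesis using cong_Cons that(1) unfolding n by simp
      qed
      have "u \<approx> alt k s t @ c"
        unfolding Cons by (rule step) (use s c Cons in \<open>auto simp: g_def\<close>)
      also have "alt k s t @ c \<approx> alt k t s @ c"
        using cong_append[OF cong_braid[OF s(1) t(1) False k] cong_refl[OF reduced_lists[OF c(1)]]] .
      also have "alt k t s @ c \<approx> v"
        unfolding v by (rule cong_sym, rule step) (use t c' act' lens eq in \<open>auto simp: g_def Cons v\<close>)
      finally show ?thesis .
    qed
  qed
qed

subsection \<open>The head of an element of the monoid\<close>

text \<open>The map \<open>star\<close> extends to an action of the Artin--Tits monoid on the Coxeter group, and \<open>head\<close> is the
  orbit map of the identity.\<close>

definition is_proj where
  "is_proj x h z \<longleftrightarrow> (z \<in> weyl \<and> z \<preceq> h \<and> \<N> (ginv x) \<inter> \<N> z = {}) \<and>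
    (\<forall>z'. z' \<in> weyl \<and> z' \<preceq> h \<and> \<N> (ginv x) \<inter> \<N> z' = {} \<longrightarrow> z' \<preceq> z)"

text \<open>The part of \<open>h\<close> that \<open>x\<close> can absorb on its right: the greatest
  prefix whose product with \<open>x\<close> has no cancellation.\<close>

definition proj where
  "proj x h = (SOME z. is_proj x h z)"

definition star where
  "star x h = x \<circ> proj x h"

definition head where
  "head w = foldr (\<lambda>s h. star (refl s) h) w id"

lemma is_proj_proj:
  assumes "x \<in> weyl" "h \<in> weyl" shows "is_proj x h (proj x h)"
proof -
  have "\<exists>z. is_proj x h z"
    unfolding is_proj_def
  proof (rule max_exists[OF assms(2)])
    fix z z' j
    assume z: "z \<in> weyl \<and> z \<preceq> h \<and> \<N> (ginv x) \<inter> \<N> z = {}"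
      and z': "z' \<in> weyl \<and> z' \<preceq> h \<and> \<N> (ginv x) \<inter> \<N> z' = {}" and j: "is_join z z' j"
    show "j \<in> weyl \<and> j \<preceq> h \<and> \<N> (ginv x) \<inter> \<N> j = {}"
      using is_joinD(1)[OF j] is_joinD(4)[OF j assms(2)] is_joinD(5)[OF j ginv_weyl[OF assms(1)]] z z' by simp
  qed simp_all
  then show ?thesis unfolding proj_def by (rule someI_ex)
qed

lemma proj_unique: "x \<in> weyl \<Longrightarrow> h \<in> weyl \<Longrightarrow> is_proj x h z \<Longrightarrow> proj x h = z"
  using is_proj_proj[of x h] unfolding is_proj_def by (intro weak_le_antisym) simp_all

lemma projD:
  assumes "x \<in> weyl" "h \<in> weyl"
  shows "proj x h \<in> weyl" "proj x h \<preceq> h" "\<N> (ginv x) \<inter> \<N> (proj x h) = {}"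
    "z \<in> weyl \<Longrightarrow> z \<preceq> h \<Longrightarrow> \<N> (ginv x) \<inter> \<N> z = {} \<Longrightarrow> z \<preceq> proj x h"
  using is_proj_proj[OF assms] unfolding is_proj_def by simp_all

lemma star_weyl: "x \<in> weyl \<Longrightarrow> h \<in> weyl \<Longrightarrow> star x h \<in> weyl"
  by (simp add: star_def comp_weyl projD)

lemma weak_le_star: "x \<in> weyl \<Longrightarrow> h \<in> weyl \<Longrightarrow> x \<preceq> star x h"
  unfolding star_def by (rule weak_le_comp) (simp_all add: projD)

lemma weak_le_comp_iff:
  assumes "y \<in> weyl" "a \<in> weyl" "b \<in> weyl"
    and "\<N> (ginv y) \<inter> \<N> a = {}" "\<N> (ginv y) \<inter> \<N> b = {}"
  shows "y \<circ> a \<preceq> y \<circ> b \<longleftrightarrow> a \<preceq> b"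
proof -
  have "y ` \<N> a \<subseteq> y ` \<N> b \<longleftrightarrow> a \<preceq> b"
    by (rule inj_image_subset_iff) (simp add: inj_on_def weyl_inject assms)
  then show ?thesis
    unfolding inversions_comp(1)[OF assms(1,2,4)] inversions_comp(1)[OF assms(1,3,5)]
    using inversions_comp(2)[OF assms(1,2,4)] by blast
qed

text \<open>Absence of cancellation in a product of three factors does not depend on the
  bracketing.\<close>

lemma disjoint_comp_iff:
  assumes "x \<in> weyl" "y \<in> weyl" "z \<in> weyl" "\<N> (ginv x) \<inter> \<N> y = {}"
    and yz: "\<N> (ginv y) \<inter> \<N> z = {}"
  shows "\<N> (ginv (x \<circ> y)) \<inter> \<N> z = {} \<longleftrightarrow> \<N> (ginv x) \<inter> \<N> (y \<circ> z) = {}"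
proof -
  have inv: "\<N> (ginv (x \<circ> y)) = \<N> (ginv y) \<union> ginv y ` \<N> (ginv x)"
    unfolding ginv_comp[OF assms(1,2)]
    by (rule inversions_comp(1)) (use assms ginv_weyl in auto)
  have "ginv y ` \<N> (ginv x) \<inter> \<N> z = {} \<longleftrightarrow> \<N> (ginv x) \<inter> y ` \<N> z = {}"
  proof -
    have "ginv y a \<in> \<N> z \<longleftrightarrow> a \<in> y ` \<N> z" for a
    proof
      assume "ginv y a \<in> \<N> z"
      then show "a \<in> y ` \<N> z" using apply_ginv[OF assms(2), of a] by (intro image_eqI[of _ _ "ginv y a"]) simp_all
    next
      assume "a \<in> y ` \<N> z"
      then show "ginv y a \<in> \<N> z" using assms(2) by auto
    qed
    then show ?thesis by blast
  qed
  then show ?thesis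
    unfolding inv inversions_comp(1)[OF assms(2,3) yz] using assms(4) yz by (simp add: Int_Un_distrib Int_Un_distrib2)
qed

text \<open>The action law for products without cancellation. It makes \<open>head\<close> depend,
  on a reduced initial word, only on the group element of that word, as the braid relations
  require.\<close>

lemma star_comp:
  assumes x: "x \<in> weyl" and y: "y \<in> weyl" and h: "h \<in> weyl" and xy: "\<N> (ginv x) \<inter> \<N> y = {}"
  shows "star (x \<circ> y) h = star x (star y h)"
proof -
  define z1 z2 z3 where "z1 = proj y h" and "z2 = proj x (star y h)" and "z3 = ginv y \<circ> z2"
  note z1 = projD[OF y h, folded z1_def] and z2 = projD[OF x star_weyl[OF y h], folded z2_def]
  have st: "star y h = y \<circ> z1" by (simp add: star_def z1_def)
  \<comment> \<open>Since \<open>y\<close> itself lies below \<open>star y h\<close> and can follow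
    \<open>x\<close>, the projection begins with \<open>y\<close>; what remains after
    \<open>y\<close> turns out to be the projection for \<open>x \<circ> y\<close>.\<close>
  have yz2: "y \<preceq> z2" by (rule z2(4)[OF y weak_le_star[OF y h] xy])
  have z3: "z3 \<in> weyl" using comp_weyl ginv_weyl y z2 by (simp add: z3_def)
  have z2_eq: "z2 = y \<circ> z3" using y by (simp add: z3_def)
  have yz3: "\<N> (ginv y) \<inter> \<N> z3 = {}" unfolding z3_def by (rule weak_le_disjoint[OF y z2(1) yz2])
  have "z3 \<preceq> z1" using z2(2) unfolding st z2_eq weak_le_comp_iff[OF y z3 z1(1) yz3 z1(3)] .
  then have 1: "z3 \<preceq> h" using z1(2) by blast
  have 2: "\<N> (ginv (x \<circ> y)) \<inter> \<N> z3 = {}"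
    unfolding disjoint_comp_iff[OF x y z3 xy yz3] using z2(3) z2_eq by simp
  have 3: "z' \<preceq> z3" if z': "z' \<in> weyl" "z' \<preceq> h" "\<N> (ginv (x \<circ> y)) \<inter> \<N> z' = {}" for z'
  proof -
    have "\<N> (ginv (x \<circ> y)) = \<N> (ginv y) \<union> ginv y ` \<N> (ginv x)"
      unfolding ginv_comp[OF x y] by (rule inversions_comp(1)) (use x y xy ginv_weyl in auto)
    then have yz': "\<N> (ginv y) \<inter> \<N> z' = {}" using z'(3) by blast
    have "y \<circ> z' \<preceq> star y h" unfolding st weak_le_comp_iff[OF y z'(1) z1(1) yz' z1(3)] by (rule z1(4)[OF z'(1,2) yz'])
    moreover have "\<N> (ginv x) \<inter> \<N> (y \<circ> z') = {}"
      using z'(3) unfolding disjoint_comp_iff[OF x y z'(1) xy yz'] .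
    ultimately have "y \<circ> z' \<preceq> z2" using z2(4)[OF comp_weyl[OF y z'(1)]] by blast
    then show ?thesis unfolding z2_eq weak_le_comp_iff[OF y z'(1) z3 yz' yz3] .
  qed
  have "proj (x \<circ> y) h = z3"
    by (rule proj_unique[OF comp_weyl[OF x y] h]) (use z3 1 2 3 in \<open>auto simp: is_proj_def\<close>)
  then show ?thesis by (simp add: star_def[of "x \<circ> y"] star_def[of x] z2_def[symmetric] z2_eq comp_assoc)
qed

lemma star_id: "h \<in> weyl \<Longrightarrow> star id h = h"
proof -
  assume h: "h \<in> weyl"
  have "proj id h = h" by (rule proj_unique[OF id_weyl h]) (simp add: is_proj_def h)
  then show ?thesis by (simp add: star_def)
qed

lemma head_Nil [simp]: "head [] = id" and head_Cons: "head (s # w) = star (refl s) (head w)"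
  by (simp_all add: head_def)

lemma head_weyl: "w \<in> lists S \<Longrightarrow> head w \<in> weyl"
  by (induction w) (auto simp: head_Cons intro: star_weyl refl_weyl)

lemma head_append_reduced:
  assumes "reduced u" "v \<in> lists S" shows "head (u @ v) = star (act u) (head v)"
  using assms(1)
proof (induction u)
  case Nil
  show ?case unfolding append_Nil act_Nil by (rule star_id[OF head_weyl[OF assms(2)], symmetric])
next
  case (Cons s u)
  then have s: "s \<in> S" "reduced u" "\<alpha> s \<notin> \<N> (act u)" by (simp_all add: reduced_Cons)
  have "star (refl s \<circ> act u) (head v) = star (refl s) (star (act u) (head v))"
    by (rule star_comp) (use s assms(2) in \<open>auto simp: refl_weyl reduced_weyl head_weyl inversions_refl\<close>)
  then show ?case using Cons.IH s by (simp only: append_Cons head_Cons act_Cons)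
qed

lemma head_append_cong: "head v = head w \<Longrightarrow> head (x @ v) = head (x @ w)"
  by (simp add: head_def)

text \<open>The two sides of a braid relation are reduced words of the same element, so they act
  alike on any head by \<open>head_append_reduced\<close>.\<close>

lemma head_cong: "u \<approx> v \<Longrightarrow> head u = head v"
proof (induction rule: presentation_congruence.induct)
  case (rel v w x y)
  then obtain n s t where st: "s \<in> S" "t \<in> S" "s \<noteq> t" "m s t = enat n"
    and vw: "v = alt n s t" "w = alt n t s" by (auto simp: braid_relations_def)
  have "reduced v" "reduced w"
    using reduced_alternating_word[OF st(1-3)] reduced_alternating_word[OF st(2,1)] st m_sym[of s t] by (simp_all add: vw)
  then have "head (v @ y) = head (w @ y)"
    using head_append_reduced[OF _ rel(3)] act_braid[OF st] by (simp add: vw)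
  then show ?case by (rule head_append_cong)
qed simp_all

text \<open>With the converse \<open>divides_if_weak_le_head\<close>: left-divisibility by a reduced
  word is the weak order below the head.\<close>

lemma weak_le_head:
  assumes "reduced u" "u @ v \<approx> w" shows "act u \<preceq> head w"
proof -
  have v: "v \<in> lists S" using cong_lists[OF assms(2)] by simp
  have "head w = star (act u) (head v)" using head_cong[OF assms(2)] head_append_reduced[OF assms(1) v] by simp
  then show ?thesis using weak_le_star[OF reduced_weyl[OF assms(1)] head_weyl[OF v]] by simp
qed

text \<open>The projection is a prefix of the old head, so by \<open>matsumoto\<close> the old head
  may be spelled with a reduced word that begins with it; the new letter goes in front.\<close>

lemma head_divides: "w \<in> lists S \<Longrightarrow> \<exists>r v. reduced r \<and> act r = head w \<and> r @ v \<approx> w"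
proof (induction w)
  case Nil
  then show ?case using cong_refl[of "[]"] by (intro exI[of _ "[]"]) simp
next
  case (Cons s w)
  then have s: "s \<in> S" and w: "w \<in> lists S" by auto
  obtain r v where r: "reduced r" "act r = head w" "r @ v \<approx> w" using Cons.IH w by blast
  define z where "z = proj (refl s) (head w)"
  note z = projD[OF refl_weyl[OF s] head_weyl[OF w], folded z_def]
  obtain rz where rz: "reduced rz" "act rz = z" using reduced_exists z(1) by blast
  obtain c where c: "reduced (rz @ c)" "act (rz @ c) = head w"
    using reduced_complement[OF rz(1) head_weyl[OF w]] rz(2) z(2) by metis
  have v: "v \<in> lists S" using cong_lists[OF r(3)] by simp
  have "rz @ c @ v \<approx> r @ v"
    using cong_append[OF matsumoto[OF c(1) r(1)] cong_refl[OF v]] c(2) r(2) by simp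
  also note r(3)
  finally have "(s # rz) @ (c @ v) \<approx> s # w" using cong_Cons[OF s] by simp
  moreover have "reduced (s # rz)" using rz s z(3) by (simp add: reduced_Cons inversions_refl)
  moreover have "act (s # rz) = head (s # w)" by (simp only: act_Cons rz(2) head_Cons star_def z_def)
  ultimately show ?case by blast
qed

lemma divides_if_weak_le_head:
  assumes "reduced u" "w \<in> lists S" "act u \<preceq> head w" shows "\<exists>v. u @ v \<approx> w"
proof -
  obtain r v where r: "reduced r" "act r = head w" "r @ v \<approx> w" using head_divides[OF assms(2)] by blast
  obtain c where c: "reduced (u @ c)" "act (u @ c) = head w"
    using reduced_complement[OF assms(1) head_weyl[OF assms(2)] assms(3)] by metis
  have v: "v \<in> lists S" using cong_lists[OF r(3)] by simp
  have "u @ c @ v \<approx> r @ v"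
    using cong_append[OF matsumoto[OF c(1) r(1)] cong_refl[OF v]] c(2) r(2) by simp
  then show ?thesis using cong_trans r(3) by blast
qed

subsection \<open>Normal decompositions\<close>

definition is_gate_head where
  "is_gate_head w r \<longleftrightarrow> reduced r \<and> gate (act r) \<and> act r \<preceq> head w \<and> (\<forall>z. gate z \<longrightarrow> z \<preceq> head w \<longrightarrow> z \<preceq> act r)"

lemma gate_head_exists: "w \<in> lists S \<Longrightarrow> \<exists>r. is_gate_head w r"
proof -
  assume w: "w \<in> lists S"
  have "\<exists>z. (gate z \<and> z \<preceq> head w) \<and> (\<forall>z'. gate z' \<and> z' \<preceq> head w \<longrightarrow> z' \<preceq> z)"
  proof (rule max_exists[OF head_weyl[OF w]])
    fix z z' j assume "gate z \<and> z \<preceq> head w" "gate z' \<and> z' \<preceq> head w" and j: "is_join z z' j"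
    then show "gate j \<and> j \<preceq> head w" using gate_join[OF _ _ j] is_joinD(4)[OF j head_weyl[OF w]] by simp
  qed (simp_all add: gate_id gate_weyl)
  then obtain z where z: "gate z" "z \<preceq> head w" "\<And>z'. gate z' \<Longrightarrow> z' \<preceq> head w \<Longrightarrow> z' \<preceq> z" by blast
  obtain r where r: "reduced r" "act r = z" using reduced_exists gate_weyl[OF z(1)] by blast
  show ?thesis unfolding is_gate_head_def using r z by (intro exI[of _ r]) simp
qed

text \<open>Moving a gate \<open>u\<close> past the first letter \<open>a\<close> of \<open>f\<close>: the join of \<open>u\<close> and \<open>a\<close> is \<open>a u'\<close> with a gate \<open>u'\<close>.\<close>

lemma gate_head_greedy:
  assumes "reduced u" "gate (act u)" "f \<in> lists S" "w \<in> lists S" "is_gate_head w r" "u @ v \<approx> f @ w"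
  shows "\<exists>v'. u @ v' \<approx> f @ r"
  using assms(1-3,6)
proof (induction f arbitrary: u v)
  case Nil
  have "act u \<preceq> head w" using weak_le_head Nil by simp
  then have le: "act u \<preceq> act r" using assms(5) Nil(2) unfolding is_gate_head_def by blast
  have r: "reduced r" using assms(5) by (simp add: is_gate_head_def)
  obtain c where c: "reduced (u @ c)" "act (u @ c) = act r"
    using reduced_complement[OF Nil(1) reduced_weyl[OF r] le] by metis
  then show ?case using matsumoto[OF c(1) r c(2)] by auto
next
  case (Cons a f)
  then have a: "a \<in> S" and f: "f \<in> lists S" by auto
  have fw: "f @ w \<in> lists S" "a # f @ w \<in> lists S" using a f assms(4) by auto
  define g where "g = head (a # f @ w)"
  have g: "g \<in> weyl" using head_weyl fw by (simp add: g_def)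
  have ug: "act u \<preceq> g" using weak_le_head[OF Cons.prems(1,4)] by (simp add: g_def)
  have g_star: "g = star (refl a) (head (f @ w))" by (simp add: g_def head_Cons)
  have ag: "refl a \<preceq> g" unfolding g_star by (rule weak_le_star[OF refl_weyl[OF a] head_weyl[OF fw(1)]])
  obtain j where j: "is_join (act u) (refl a) j"
    using join_exists[OF g reduced_weyl[OF Cons.prems(1)] refl_weyl[OF a] ug ag] by blast
  note jD = is_joinD[OF j]
  have gate_j: "gate j" by (rule gate_join[OF Cons.prems(2) gate_refl[OF a] j])
  have aj: "\<alpha> a \<in> \<N> j" using jD(3) simple_weak_le[OF a] by blast
  define u' where "u' = refl a \<circ> j"
  have u': "u' \<in> weyl" using comp_weyl refl_weyl a jD(1) by (simp add: u'_def)
  have au': "\<alpha> a \<notin> \<N> u'" unfolding u'_def using simple_inversion_refl_comp a jD(1) aj by blast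
  have j_eq: "j = refl a \<circ> u'" using a by (simp add: u'_def)
  have gate_u': "gate u'" using gate_suffix[OF a u' au'] gate_j unfolding j_eq .
  obtain ru where ru: "reduced ru" "act ru = u'" using reduced_exists u' by blast
  note p = projD[OF refl_weyl[OF a] head_weyl[OF fw(1)]]
  \<comment> \<open>The head of \<open>a # f @ w\<close> is \<open>a\<close> followed by the
    projection. Cancelling \<open>a\<close> leaves \<open>u'\<close> below the head of
    \<open>f @ w\<close>, so the induction hypothesis applies to \<open>u'\<close>.\<close>
  have "refl a \<circ> u' \<preceq> refl a \<circ> proj (refl a) (head (f @ w))"
    using jD(4)[OF g ug ag] unfolding g_star star_def j_eq .
  then have "u' \<preceq> proj (refl a) (head (f @ w))"
    using weak_le_comp_iff[OF refl_weyl[OF a] u' p(1) _ p(3)] au' a by (simp add: inversions_refl)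
  then have "act ru \<preceq> head (f @ w)" using p(2) ru(2) by simp
  then obtain v2 where "ru @ v2 \<approx> f @ w" using divides_if_weak_le_head[OF ru(1) fw(1)] by blast
  then obtain v' where v': "ru @ v' \<approx> f @ r" using Cons.IH[OF ru(1) _ f] gate_u' ru(2) by blast
  have aru: "reduced (a # ru)" using ru a au' by (simp add: reduced_Cons)
  have act_aru: "act (a # ru) = j" by (simp only: act_Cons ru(2) j_eq)
  \<comment> \<open>The join is spelled a second time, now beginning with \<open>u\<close>;
    \<open>matsumoto\<close> exchanges it for \<open>a # ru\<close>.\<close>
  obtain c where c: "reduced (u @ c)" "act (u @ c) = j"
    using reduced_complement[OF Cons.prems(1) jD(1,2)] by metis
  have v'l: "v' \<in> lists S" using cong_lists[OF v'] by simp
  have "(u @ c) @ v' \<approx> (a # ru) @ v'"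
    using cong_append[OF matsumoto[OF c(1) aru] cong_refl[OF v'l]] c(2) act_aru by simp
  also have "(a # ru) @ v' \<approx> a # f @ r" using cong_Cons[OF a v'] by simp
  finally show ?case by auto
qed

definition gate_word :: "'a list \<Rightarrow> bool" where
  "gate_word r \<longleftrightarrow> reduced r \<and> gate (act r)"

text \<open>The condition on neighbours in a normal decomposition, transferred to words:
  \<open>u @ v \<approx> w\<close> for some \<open>v\<close> is left-divisibility by
  \<open>divides_cls_iff\<close>.\<close>

definition greedy_pair :: "'a list \<Rightarrow> 'a list \<Rightarrow> bool" where
  "greedy_pair r r' \<longleftrightarrow> (\<forall>u f v. gate_word u \<longrightarrow> f \<in> lists S \<longrightarrow> u @ v \<approx> f @ r @ r' \<longrightarrow> (\<exists>v'. u @ v' \<approx> f @ r))"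

text \<open>Braid relations preserve length, so the induction is on the length of \<open>w\<close>.
  The part split off is nonempty, because the first letter of \<open>w\<close> is itself a gate
  below the head.\<close>

lemma normal_words_exist:
  "w \<in> lists S \<Longrightarrow> \<exists>rs. (\<forall>r\<in>set rs. gate_word r) \<and> concat rs \<approx> w
    \<and> (\<forall>i. Suc i < length rs \<longrightarrow> greedy_pair (rs ! i) (rs ! Suc i))"
proof (induction "length w" arbitrary: w rule: less_induct)
  case less
  show ?case
  proof (cases w)
    case Nil
    then show ?thesis using cong_refl[of "[]"] by (intro exI[of _ "[]"]) simp
  next
    case (Cons a w1)
    obtain r where r: "is_gate_head w r" using gate_head_exists less.prems by blast
    have r': "reduced r" "gate (act r)" "act r \<preceq> head w" using r by (auto simp: is_gate_head_def)
    have a: "a \<in> S" "w1 \<in> lists S" using less.prems Cons by auto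
    have "refl a \<preceq> head w"
      unfolding Cons head_Cons by (rule weak_le_star[OF refl_weyl[OF a(1)] head_weyl[OF a(2)]])
    then have "refl a \<preceq> act r" using r gate_refl[OF a(1)] unfolding is_gate_head_def by blast
    then have "r \<noteq> []" using inversions_refl[OF a(1)] by auto
    obtain w' where w': "r @ w' \<approx> w" using divides_if_weak_le_head[OF r'(1) less.prems r'(3)] by blast
    have "length w' < length w" using braid_congruence_length[OF w'] \<open>r \<noteq> []\<close> by (cases r) auto
    moreover have w'l: "w' \<in> lists S" using cong_lists[OF w'] by simp
    ultimately obtain rs where rs: "\<forall>r\<in>set rs. gate_word r" "concat rs \<approx> w'"
      "\<forall>i. Suc i < length rs \<longrightarrow> greedy_pair (rs ! i) (rs ! Suc i)" using less.hyps by blast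
    have "concat (r # rs) \<approx> r @ w'" using cong_append[OF cong_refl[OF reduced_lists[OF r'(1)]] rs(2)] by simp
    then have cw: "concat (r # rs) \<approx> w" using cong_trans w' by blast
    have "greedy_pair ((r # rs) ! i) ((r # rs) ! Suc i)" if i: "Suc i < length (r # rs)" for i
    proof (cases i)
      case 0
      then obtain r1 rs1 where rs1: "rs = r1 # rs1" using i by (cases rs) auto
      \<comment> \<open>Appending the remaining entries turns \<open>f @ r @ r1\<close> into a word
        congruent to \<open>f @ w\<close>, for which \<open>r\<close> is the greatest gate.\<close>
      have "\<exists>v'. u @ v' \<approx> f @ r" if u: "gate_word u" "f \<in> lists S" "u @ v \<approx> f @ r @ r1" for u f v
      proof -
        have "concat rs1 \<in> lists S" using cong_lists[OF rs(2)] by (simp add: rs1)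
        from cong_append[OF u(3) cong_refl[OF this]]
        have "u @ v @ concat rs1 \<approx> f @ concat (r # rs)" by (simp add: rs1)
        also have "f @ concat (r # rs) \<approx> f @ w" by (rule cong_append[OF cong_refl[OF u(2)] cw])
        finally show ?thesis using gate_head_greedy[OF _ _ u(2) less.prems r] u(1) by (simp add: gate_word_def)
      qed
      then show ?thesis by (simp add: greedy_pair_def 0 rs1)
    next
      case (Suc i')
      then show ?thesis using rs(3) i by simp
    qed
    moreover have "\<forall>q\<in>set (r # rs). gate_word q" using rs(1) r' by (simp add: gate_word_def)
    ultimately show ?thesis using cw by (intro exI[of _ "r # rs"]) blast
  qed
qed

section \<open>From words to elements of the monoid\<close>

abbreviation cls :: "'a list \<Rightarrow> 'a list set" where
  "cls w \<equiv> presentation_congruence S (braid_relations S m) `` {w}"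

lemma cls_eq_iff: "u \<in> lists S \<Longrightarrow> v \<in> lists S \<Longrightarrow> cls u = cls v \<longleftrightarrow> u \<approx> v"
  using eq_equiv_class_iff[OF equiv_presentation_congruence[OF braid_relations_lists]] .

lemma carrier_artin_tits: "carrier (artin_tits_monoid S m) = cls ` lists S"
  by (auto simp: artin_tits_monoid_def presented_monoid_def quotient_def)

lemma mult_cls:
  "u \<in> lists S \<Longrightarrow> v \<in> lists S \<Longrightarrow> cls u \<otimes>\<^bsub>artin_tits_monoid S m\<^esub> cls v = cls (u @ v)"
  unfolding artin_tits_monoid_def by (rule presented_monoid_mult[OF braid_relations_lists])

lemma one_cls: "\<one>\<^bsub>artin_tits_monoid S m\<^esub> = cls []"
  by (simp add: artin_tits_monoid_def presented_monoid_def)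

lemma divides_cls_iff:
  assumes "u \<in> lists S" "w \<in> lists S"
  shows "cls u divides\<^bsub>artin_tits_monoid S m\<^esub> cls w \<longleftrightarrow> (\<exists>v. u @ v \<approx> w)"
proof
  assume "cls u divides\<^bsub>artin_tits_monoid S m\<^esub> cls w"
  then obtain v where "v \<in> lists S" "cls w = cls (u @ v)"
    by (auto simp: factor_def carrier_artin_tits mult_cls assms)
  then show "\<exists>v. u @ v \<approx> w" using cls_eq_iff[of "u @ v" w] assms by auto
next
  assume "\<exists>v. u @ v \<approx> w"
  then obtain v where v: "u @ v \<approx> w" by blast
  then have "v \<in> lists S" "cls w = cls (u @ v)" using cong_lists[OF v] cls_eq_iff[of "u @ v" w] assms by auto
  then show "cls u divides\<^bsub>artin_tits_monoid S m\<^esub> cls w"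
    using assms by (auto simp: factor_def carrier_artin_tits mult_cls intro!: bexI[of _ "cls v"])
qed

lemma list_prod_cls: "set ws \<subseteq> lists S \<Longrightarrow> list_prod (artin_tits_monoid S m) (map cls ws) = cls (concat ws)"
proof (induction ws)
  case (Cons w ws)
  then have "concat ws \<in> lists S" by (auto simp: in_lists_conv_set)
  then show ?case using Cons by (simp add: list_prod_def mult_cls)
qed (simp add: list_prod_def one_cls)

definition gate_family :: "'a list set set" where
  "gate_family = cls ` Collect gate_word"

text \<open>By \<open>matsumoto\<close> all reduced words of a gate lie in one class, so choosing
  one word per gate reaches the whole family.\<close>

lemma finite_gate_family: "finite gate_family"
proof -
  define rw where "rw g = (SOME w. reduced w \<and> act w = g)" for g
  have rw: "reduced (rw g) \<and> act (rw g) = g" if "g \<in> weyl" for g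
    unfolding rw_def by (rule someI_ex) (rule reduced_exists[OF that])
  have "cls r = cls (rw (act r))" if "gate_word r" for r
  proof -
    have r: "reduced r" using that by (simp add: gate_word_def)
    have w: "reduced (rw (act r))" "act (rw (act r)) = act r" using rw[OF reduced_weyl[OF r]] by auto
    show ?thesis
      using cls_eq_iff[OF reduced_lists[OF r] reduced_lists[OF w(1)]] matsumoto[OF r w(1)] w(2) by simp
  qed
  then have "gate_family \<subseteq> (\<lambda>g. cls (rw g)) ` Collect gate"
    unfolding gate_family_def by (auto simp: gate_word_def)
  then show ?thesis using finite_gates finite_subset by blast
qed

lemma garside_gate_family: "garside_family (artin_tits_monoid S m) gate_family"
  unfolding garside_family_def
proof (intro conjI ballI)
  let ?M = "artin_tits_monoid S m"
  have gwl: "r \<in> lists S" if "gate_word r" for r using that reduced_lists by (simp add: gate_word_def)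
  then show "gate_family \<subseteq> carrier ?M" by (auto simp: gate_family_def carrier_artin_tits)
  show "\<one>\<^bsub>?M\<^esub> \<in> gate_family"
    unfolding one_cls gate_family_def using gate_id by (intro imageI) (simp add: gate_word_def)
  fix g assume "g \<in> carrier ?M"
  then obtain w where w: "w \<in> lists S" "g = cls w" by (auto simp: carrier_artin_tits)
  obtain rs where rs: "\<forall>r\<in>set rs. gate_word r" "concat rs \<approx> w"
    "\<forall>i. Suc i < length rs \<longrightarrow> greedy_pair (rs ! i) (rs ! Suc i)" using normal_words_exist[OF w(1)] by blast
  have rsl: "set rs \<subseteq> lists S" using rs(1) gwl by blast
  have "list_prod ?M (map cls rs) = g"
    unfolding list_prod_cls[OF rsl] w(2) using cls_eq_iff[OF _ w(1)] cong_lists[OF rs(2)] rs(2) by blast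
  moreover have "normal_sequence ?M gate_family (map cls rs)"
    unfolding normal_sequence_def
  proof (intro conjI allI impI ballI)
    show "set (map cls rs) \<subseteq> gate_family" using rs(1) by (auto simp: gate_family_def)
    fix i s f assume i: "Suc i < length (map cls rs)" and "s \<in> gate_family" "f \<in> carrier ?M"
      and div: "s divides\<^bsub>?M\<^esub> (f \<otimes>\<^bsub>?M\<^esub> map cls rs ! i \<otimes>\<^bsub>?M\<^esub> map cls rs ! Suc i)"
    then obtain u x where u: "gate_word u" "s = cls u" and x: "x \<in> lists S" "f = cls x"
      by (auto simp: gate_family_def carrier_artin_tits)
    have l: "rs ! i \<in> lists S" "rs ! Suc i \<in> lists S" using i rsl by (auto dest: nth_mem)
    have "cls u divides\<^bsub>?M\<^esub> cls (x @ rs ! i @ rs ! Suc i)"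
      using div i l x by (simp add: u mult_cls)
    then obtain v where "u @ v \<approx> x @ rs ! i @ rs ! Suc i"
      using divides_cls_iff[OF gwl[OF u(1)]] x l by auto
    moreover have "greedy_pair (rs ! i) (rs ! Suc i)" using rs(3) i by simp
    ultimately have "\<exists>v'. u @ v' \<approx> x @ rs ! i" using u(1) x(1) unfolding greedy_pair_def by blast
    then show "s divides\<^bsub>?M\<^esub> (f \<otimes>\<^bsub>?M\<^esub> map cls rs ! i)"
      using divides_cls_iff[OF gwl[OF u(1)], of "x @ rs ! i"] x l i by (simp add: u mult_cls)
  qed
  ultimately show "\<exists>ss. normal_sequence ?M gate_family ss \<and> list_prod ?M ss = g" by blast
qed

end

section \<open>Finite generation forces finitely many letters\<close>

lemma braid_congruence_singleton:
  assumes "coxeter_matrix S m" "(u, v) \<in> presentation_congruence S (braid_relations S m)" "length u = 1"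
  shows "u = v"
  using assms(2,3)
proof (induction rule: presentation_congruence.induct)
  case (rel v w x y)
  then obtain n s t where "s \<in> S" "t \<in> S" "s \<noteq> t" "m s t = enat n" "v = alt n s t"
    by (auto simp: braid_relations_def)
  moreover from this have "2 \<le> n" using assms(1) unfolding coxeter_matrix_def
    by (metis enat_ord_simps(1) numeral_eq_enat)
  ultimately show ?case using rel.prems by simp
qed (auto dest: braid_congruence_length)

text \<open>Both sides of a braid relation have length at least 2, so the class of a letter contains
  nothing else. A product equal to a letter thus has that letter as a factor, every generating set
  contains all letters, and different letters have different classes.\<close>

lemma finite_generators:
  assumes cox: "coxeter_matrix S m" and fg: "finitely_generated_monoid (artin_tits_monoid S m)"
  shows "finite S"
proof -
  let ?M = "artin_tits_monoid S m" and ?C = "presentation_congruence S (braid_relations S m)"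
  have carrier: "carrier ?M = (\<lambda>w. ?C `` {w}) ` lists S"
    by (auto simp: artin_tits_monoid_def presented_monoid_def quotient_def)
  have mult: "?C `` {v} \<otimes>\<^bsub>?M\<^esub> ?C `` {w} = ?C `` {v @ w}" if "v \<in> lists S" "w \<in> lists S" for v w
    unfolding artin_tits_monoid_def by (rule presented_monoid_mult[OF braid_relations_lists that])
  obtain A where A: "finite A" "A \<subseteq> carrier ?M" "\<forall>g\<in>carrier ?M. \<exists>xs. set xs \<subseteq> A \<and> list_prod ?M xs = g"
    using fg unfolding finitely_generated_monoid_def by (elim exE conjE)
  have repr: "\<exists>ws. set ws \<subseteq> lists S \<and> xs = map (\<lambda>w. ?C `` {w}) ws \<and> list_prod ?M xs = ?C `` {concat ws}"
    if "set xs \<subseteq> A" for xs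
    using that
  proof (induction xs)
    case Nil
    then show ?case by (auto simp: list_prod_def artin_tits_monoid_def presented_monoid_def)
  next
    case (Cons x xs)
    then obtain ws where ws: "set ws \<subseteq> lists S" "xs = map (\<lambda>w. ?C `` {w}) ws" "list_prod ?M xs = ?C `` {concat ws}" by auto
    obtain w where w: "w \<in> lists S" "x = ?C `` {w}" using Cons.prems A(2) carrier by auto
    have "concat ws \<in> lists S" using ws(1) by (auto simp: in_lists_conv_set)
    then have "list_prod ?M (x # xs) = ?C `` {concat (w # ws)}"
      using ws(3) w mult by (simp add: list_prod_def)
    then show ?case using ws w by (intro exI[of _ "w # ws"]) auto
  qed
  have "(\<lambda>s. ?C `` {[s]}) ` S \<subseteq> A"
  proof (rule image_subsetI)
    fix s assume s: "s \<in> S"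
    then have s': "[s] \<in> lists S" by simp
    have "?C `` {[s]} \<in> carrier ?M" unfolding carrier by (rule imageI[OF s'])
    from bspec[OF A(3) this] obtain xs where xs: "set xs \<subseteq> A" "list_prod ?M xs = ?C `` {[s]}"
      by (elim exE conjE)
    obtain ws where ws: "set ws \<subseteq> lists S" "xs = map (\<lambda>w. ?C `` {w}) ws" "list_prod ?M xs = ?C `` {concat ws}"
      using repr[OF xs(1)] by blast
    have "concat ws \<in> lists S" using ws(1) by (auto simp: in_lists_conv_set)
    then have "([s], concat ws) \<in> ?C"
      using xs(2) ws(3) eq_equiv_class[OF _ equiv_presentation_congruence[OF braid_relations_lists]] by metis
    then have "[s] = concat ws" using braid_congruence_singleton[OF cox] by simp
    then have "[s] \<in> set ws"
      by (induction ws) (auto simp: Cons_eq_append_conv)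
    then show "?C `` {[s]} \<in> A" using ws(2) xs(1) by auto
  qed
  moreover have "inj_on (\<lambda>s. ?C `` {[s]}) S"
  proof (rule inj_onI)
    fix s t assume st: "s \<in> S" "t \<in> S" "?C `` {[s]} = ?C `` {[t]}"
    then have "([s], [t]) \<in> ?C"
      using eq_equiv_class[OF st(3) equiv_presentation_congruence[OF braid_relations_lists]] by simp
    from braid_congruence_singleton[OF cox this] show "s = t" by simp
  qed
  ultimately show ?thesis using A(1) by (meson finite_imageD finite_subset)
qed

theorem theorem1p1:
  fixes S :: "'a set" and m :: "'a \<Rightarrow> 'a \<Rightarrow> enat"
  assumes "coxeter_matrix S m"
    and "finitely_generated_monoid (artin_tits_monoid S m)"
  shows "\<exists>F. finite F \<and> garside_family (artin_tits_monoid S m) F"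
proof -
  interpret coxeter_geometry S m
    using assms finite_generators by unfold_locales
  show ?thesis using finite_gate_family garside_gate_family by blast
qed

end
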